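(* Let $m\in\mathbb{Z}_{\ge0}$ and let $p>1+(m+2)/n$. Let $u_0\in L^1_m(\mathbb{R}^n)\cap L^\infty(\mathbb{R}^n)$ and let $u\in X$ be a global solution to (P) satisfying $$\sup_{q\in[1,+\infty]}\ \sup_{t>0}\ t^{\frac n2\left(1-\frac1q\right)}\|u(t)\|_q<+\infty .$$ Then $$\lim_{t\to+\infty}t^{\frac n2\left(1-\frac1q\right)+\frac m2}\|u(t)-\mathcal{A}_m(t)\|_q=0$$ holds for any $q\in[1,+\infty]$, where $$\mathcal{A}_m(t):=\Lambda_{0,m}(t;u_0)+\sum_{|\gamma|\le m/2}\frac{(-\nu)^{|\gamma|}}{\gamma!}\Lambda_{2\gamma,\,m-2|\gamma|}(t;\psi_{|\gamma|}),$$ $$\Lambda_{\alpha,N}(t;\varphi):=(-2)^{-|\alpha|}t^{-\frac{|\alpha|}2}\sum_{k=0}^N2^{-k}t^{-\frac k2}\sum_{|\beta|=k}\mathcal{M}_\beta(\varphi)\,\delta_t(\boldsymbol{h}_{\nu,\alpha+\beta}G_\nu),$$ $$\mathcal{M}_\beta(\varphi):=\frac1{\beta!}\int_{\mathbb{R}^n}y^\beta\varphi(y)\,dy,\qquad \boldsymbol{h}_{\nu,\alpha}(x):=\sum_{2\beta\le\alpha}\frac{(-1)^{|\beta|}\alpha!}{\beta!(\alpha-2\beta)!}\nu^{-|\alpha-\beta|}x^{\alpha-2\beta},\qquad \psi_k:=\int_0^{+\infty}s^kf(u(s))\,ds,$$ and $(\delta_t\varphi)(x)=t^{-\frac n2}\varphi(t^{-\frac12}x)$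 for functions $\varphi$ on $\mathbb{R}^n$.
   Context: Let $n\in\mathbb{Z}_{>0}$, $\nu\in\mathbb{C}$ with $\operatorname{Re}\nu>0$, and $p\in(1,+\infty)$. Let $f:\mathbb{C}\to\mathbb{C}$ satisfy $f(0)=0$ and, for some $K>0$, $|f(\xi)-f(\eta)|\le K(|\xi|^{p-1}+|\eta|^{p-1})|\xi-\eta|$ for all $\xi,\eta\in\mathbb{C}$. (P) denotes the Cauchy problem $\partial_t u-\nu\Delta u=f(u)$ in $(0,+\infty)\times\mathbb{R}^n$, $u(0)=u_0$ in $\mathbb{R}^n$, for a complex-valued unknown $u$. $L^q(\mathbb{R}^n)$, $q\in[1,+\infty]$, is the complex-valued Lebesgue space with norm $\|\cdot\|_q$. Greek indices $\alpha,\beta,\gamma$ range over $\mathbb{Z}_{\ge0}^n$; $|\alpha|=\sum_j\alpha_j$, $\alpha!=\prod_j\alpha_j!$, $x^\alpha=\prod_jx_j^{\alpha_j}$, and $\alpha\le\beta$ means $\alpha_j\le\beta_j$ for all $j$. For $m\in\mathbb{Z}_{>0}$, $L^1_m(\mathbb{R}^n)$ is the set of $\varphi\in L^1(\mathbb{R}^n)$ with $x^\alpha\varphi\in L^1(\mathbb{R}^n)$ for all $|\alpha|\le m$; $L^1_0(\mathbb{R}^n)=L^1(\mathbb{R}^n)$. $G_{t\nu}(x)=(4\pi t\nu)^{-n/2}\exp\left(-\frac{|x|^2}{4t\nu}\right)$ (principal branch of the power), $G_\nu$ is the case $t=1$, and $e^{t\nu\Delta}\varphi=G_{t\nu}*\varphi$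 for $t>0$, $e^{0\nu\Delta}\varphi=\varphi$. $X=(C\cap L^\infty)([0,+\infty);L^1(\mathbb{R}^n))\cap(C\cap L^\infty)((0,+\infty);L^\infty(\mathbb{R}^n))$. For $u_0\in L^1(\mathbb{R}^n)\cap L^\infty(\mathbb{R}^n)$, a function $u\in X$ is a global (mild) solution to (P) if $u(t)=e^{t\nu\Delta}u_0+\int_0^t e^{(t-s)\nu\Delta}f(u(s))\,ds$ holds in $L^1(\mathbb{R}^n)\cap L^\infty(\mathbb{R}^n)$ for all $t>0$. *)

theory Defs
  imports "HOL-Analysis.Analysis" "HOL-Probability.Essential_Supremum"
begin

section \<open>Lebesgue spaces\<close>

text \<open>
  Elements of \<open>L\<^sup>q\<close> are represented by Lebesgue measurable functions; every notion below depends
  only on the almost-everywhere class of the representative. The norm takes the value \<open>\<infinity>\<close>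
  outside \<open>L\<^sup>q\<close>, and the exponent \<open>q\<close> ranges over \<open>[1, \<infinity>]\<close> inside \<open>ennreal\<close>.
\<close>

definition Lq_norm :: "ennreal \<Rightarrow> ('a::euclidean_space \<Rightarrow> complex) \<Rightarrow> ennreal" where
  "Lq_norm q \<phi> =
     (if q = \<infinity> then esssup lebesgue (\<lambda>x. ennreal (cmod (\<phi> x)))
      else (let I = (\<integral>\<^sup>+ x. ennreal (cmod (\<phi> x) powr enn2real q) \<partial>lebesgue)
            in if I = \<infinity> then \<infinity> else ennreal (enn2real I powr (1 / enn2real q))))"

definition normed_fun_space ::
  "(('a::euclidean_space \<Rightarrow> complex) \<Rightarrow> ennreal) \<Rightarrow> ('a \<Rightarrow> complex) set" where
  "normed_fun_space N = {\<phi>. \<phi> \<in> borel_measurable lebesgue \<and> N \<phi> < \<infinity>}"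

abbreviation Lq :: "ennreal \<Rightarrow> ('a::euclidean_space \<Rightarrow> complex) set" where
  "Lq q \<equiv> normed_fun_space (Lq_norm q)"

definition L1_Linf_norm :: "('a::euclidean_space \<Rightarrow> complex) \<Rightarrow> ennreal" where
  "L1_Linf_norm \<phi> = Lq_norm 1 \<phi> + Lq_norm \<infinity> \<phi>"

section \<open>Bochner integrals in function spaces\<close>

text \<open>
  The library's \<^const>\<open>has_bochner_integral\<close> needs a second countable normed type as codomain, so
  the textbook definition (approximation by integrable simple functions) is restated for functions
  with values in the space of all measurable \<open>\<phi>\<close> with \<open>N \<phi> < \<infinity>\<close>. The measure \<open>M\<close> should be
  complete: the almost-everywhere convergence then makes the integrated
  norms measurable.
\<close>

definition simple_fun_integral ::
  "'s measure \<Rightarrow> ('s \<Rightarrow> 'a \<Rightarrow> complex) \<Rightarrow> 'a \<Rightarrow> complex" where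
  "simple_fun_integral M \<sigma> =
     (\<lambda>x. \<Sum>\<phi> \<in> \<sigma> ` space M. of_real (measure M {s \<in> space M. \<sigma> s = \<phi>}) * \<phi> x)"

definition has_fun_bochner_integral ::
  "(('a::euclidean_space \<Rightarrow> complex) \<Rightarrow> ennreal) \<Rightarrow> 's measure \<Rightarrow> ('s \<Rightarrow> 'a \<Rightarrow> complex)
     \<Rightarrow> ('a \<Rightarrow> complex) \<Rightarrow> bool" where
  "has_fun_bochner_integral N M F w \<longleftrightarrow>
     w \<in> normed_fun_space N \<and>
     (AE s in M. F s \<in> normed_fun_space N) \<and>
     (\<exists>\<sigma> :: nat \<Rightarrow> 's \<Rightarrow> 'a \<Rightarrow> complex.
        (\<forall>k. simple_function M (\<sigma> k) \<and> \<sigma> k ` space M \<subseteq> normed_fun_space N \<and>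
             emeasure M {s \<in> space M. \<sigma> k s \<noteq> (\<lambda>_. 0)} < \<infinity>) \<and>
        (AE s in M. (\<lambda>k. N (\<lambda>x. F s x - \<sigma> k s x)) \<longlonglongrightarrow> 0) \<and>
        (\<lambda>k. \<integral>\<^sup>+ s. N (\<lambda>x. F s x - \<sigma> k s x) \<partial>M) \<longlonglongrightarrow> 0 \<and>
        (\<lambda>k. N (\<lambda>x. simple_fun_integral M (\<sigma> k) x - w x)) \<longlonglongrightarrow> 0)"

text \<open>Any representative of the \<open>L\<^sup>1\<close>-valued Bochner integral; it is unique almost everywhere.\<close>

definition L1_bochner_integral ::
  "'s measure \<Rightarrow> ('s \<Rightarrow> 'a::euclidean_space \<Rightarrow> complex) \<Rightarrow> 'a \<Rightarrow> complex" where
  "L1_bochner_integral M F = (SOME w. has_fun_bochner_integral (Lq_norm 1) M F w)"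

section \<open>Multi-indices and moments\<close>

definition mi_abs :: "('n::finite \<Rightarrow> nat) \<Rightarrow> nat" where
  "mi_abs \<alpha> = (\<Sum>j\<in>UNIV. \<alpha> j)"

definition mi_fact :: "('n::finite \<Rightarrow> nat) \<Rightarrow> nat" where
  "mi_fact \<alpha> = (\<Prod>j\<in>UNIV. fact (\<alpha> j))"

definition mi_power :: "real ^ 'n \<Rightarrow> ('n::finite \<Rightarrow> nat) \<Rightarrow> real" where
  "mi_power x \<alpha> = (\<Prod>j\<in>UNIV. (x $ j) ^ \<alpha> j)"

text \<open>
  All index sets of the multi-index sums below are finite, so none of the sums is zero by convention.
\<close>

lemma finite_mi_abs_le: "finite {\<beta> :: 'n::finite \<Rightarrow> nat. mi_abs \<beta> \<le> k}"
proof (rule finite_subset)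
  show "{\<beta> :: 'n \<Rightarrow> nat. mi_abs \<beta> \<le> k} \<subseteq> PiE UNIV (\<lambda>_. {..k})"
  proof
    fix \<beta> :: "'n \<Rightarrow> nat"
    assume "\<beta> \<in> {\<beta>. mi_abs \<beta> \<le> k}"
    moreover have "\<beta> j \<le> mi_abs \<beta>" for j
      unfolding mi_abs_def by (rule member_le_sum) auto
    ultimately show "\<beta> \<in> PiE UNIV (\<lambda>_. {..k})"
      by (auto intro: order_trans)
  qed
qed (simp add: finite_PiE)

lemma finite_mi_abs_eq: "finite {\<beta> :: 'n::finite \<Rightarrow> nat. mi_abs \<beta> = k}"
  by (rule finite_subset[OF _ finite_mi_abs_le[of k]]) auto

lemma finite_mi_abs_le_half: "finite {\<gamma> :: 'n::finite \<Rightarrow> nat. real (mi_abs \<gamma>) \<le> real m / 2}"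
proof (rule finite_subset[OF _ finite_mi_abs_le[of m]], clarify)
  fix \<gamma> :: "'n \<Rightarrow> nat"
  assume "real (mi_abs \<gamma>) \<le> real m / 2"
  then show "mi_abs \<gamma> \<le> m" by linarith
qed

lemma finite_mi_double_le: "finite {\<beta> :: 'n::finite \<Rightarrow> nat. (\<lambda>j. 2 * \<beta> j) \<le> \<alpha>}"
proof (rule finite_subset)
  show "{\<beta> :: 'n \<Rightarrow> nat. (\<lambda>j. 2 * \<beta> j) \<le> \<alpha>} \<subseteq> {\<beta>. mi_abs \<beta> \<le> mi_abs \<alpha>}"
  proof clarsimp
    fix \<beta> :: "'n \<Rightarrow> nat"
    assume le: "(\<lambda>j. 2 * \<beta> j) \<le> \<alpha>"
    have "\<beta> j \<le> \<alpha> j" for j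
      using le_funD[OF le, of j] by simp
    then show "mi_abs \<beta> \<le> mi_abs \<alpha>"
      unfolding mi_abs_def by (intro sum_mono) auto
  qed
qed (rule finite_mi_abs_le)

definition L1_weighted :: "nat \<Rightarrow> (real ^ 'n \<Rightarrow> complex) set" where
  "L1_weighted m =
     {\<phi> \<in> Lq 1. \<forall>\<alpha>. mi_abs \<alpha> \<le> m \<longrightarrow> (\<lambda>x. of_real (mi_power x \<alpha>) * \<phi> x) \<in> Lq 1}"

definition moment :: "('n::finite \<Rightarrow> nat) \<Rightarrow> (real ^ 'n \<Rightarrow> complex) \<Rightarrow> complex" where
  "moment \<beta> \<phi> =
     1 / of_nat (mi_fact \<beta>) * (LINT y|lebesgue. of_real (mi_power y \<beta>) * \<phi> y)"

section \<open>The heat semigroup and mild solutions\<close>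

text \<open>\<open>gauss z\<close> is the kernel \<open>G\<^sub>z\<close>; it is used for \<open>z = \<nu>\<close> and \<open>z = t\<nu>\<close>.\<close>

definition gauss :: "complex \<Rightarrow> real ^ 'n \<Rightarrow> complex" where
  "gauss z x =
     (of_real (4 * pi) * z) powr (- of_nat CARD('n) / 2) * exp (- of_real ((norm x)\<^sup>2) / (4 * z))"

definition convolution ::
  "(real ^ 'n \<Rightarrow> complex) \<Rightarrow> (real ^ 'n \<Rightarrow> complex) \<Rightarrow> real ^ 'n \<Rightarrow> complex" where
  "convolution \<phi> g = (\<lambda>x. LINT y|lebesgue. \<phi> (x - y) * g y)"

definition heat_semigroup ::
  "complex \<Rightarrow> real \<Rightarrow> (real ^ 'n \<Rightarrow> complex) \<Rightarrow> real ^ 'n \<Rightarrow> complex" where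
  "heat_semigroup \<nu> t \<phi> = (if t = 0 then \<phi> else convolution (gauss (of_real t * \<nu>)) \<phi>)"

definition C_Linf :: "real set \<Rightarrow> ennreal \<Rightarrow> (real \<Rightarrow> 'a::euclidean_space \<Rightarrow> complex) set" where
  "C_Linf I q =
     {u. (\<forall>t\<in>I. u t \<in> Lq q) \<and>
         (\<forall>t\<in>I. ((\<lambda>s. Lq_norm q (\<lambda>x. u s x - u t x)) \<longlongrightarrow> 0) (at t within I)) \<and>
         esssup (lebesgue_on I) (\<lambda>t. Lq_norm q (u t)) < \<infinity>}"

definition solution_space :: "(real \<Rightarrow> real ^ 'n \<Rightarrow> complex) set" where
  "solution_space = C_Linf {0..} 1 \<inter> C_Linf {0<..} \<infinity>"

definition global_solution ::
  "complex \<Rightarrow> (complex \<Rightarrow> complex) \<Rightarrow> (real ^ 'n \<Rightarrow> complex)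
     \<Rightarrow> (real \<Rightarrow> real ^ 'n \<Rightarrow> complex) \<Rightarrow> bool" where
  "global_solution \<nu> f u0 u \<longleftrightarrow>
     u0 \<in> Lq 1 \<inter> Lq \<infinity> \<and> u \<in> solution_space \<and>
     (\<forall>t>0. \<exists>w. has_fun_bochner_integral L1_Linf_norm (lebesgue_on {0..t})
                    (\<lambda>s. heat_semigroup \<nu> (t - s) (\<lambda>x. f (u s x))) w \<and>
                (AE x in lebesgue. u t x = heat_semigroup \<nu> t u0 x + w x))"

section \<open>The asymptotic profile\<close>

definition dilation :: "real \<Rightarrow> (real ^ 'n \<Rightarrow> complex) \<Rightarrow> real ^ 'n \<Rightarrow> complex" where
  "dilation t \<phi> = (\<lambda>x. of_real (t powr (- real CARD('n) / 2)) * \<phi> ((t powr (- 1 / 2)) *\<^sub>R x))"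

definition hermite :: "complex \<Rightarrow> ('n::finite \<Rightarrow> nat) \<Rightarrow> real ^ 'n \<Rightarrow> complex" where
  "hermite \<nu> \<alpha> x =
     (\<Sum>\<beta> | (\<lambda>j. 2 * \<beta> j) \<le> \<alpha>.
        (-1) ^ mi_abs \<beta> * of_nat (mi_fact \<alpha>)
          / (of_nat (mi_fact \<beta>) * of_nat (mi_fact (\<lambda>j. \<alpha> j - 2 * \<beta> j)))
        * \<nu> powi (- int (mi_abs (\<lambda>j. \<alpha> j - \<beta> j)))
        * of_real (mi_power x (\<lambda>j. \<alpha> j - 2 * \<beta> j)))"

definition Lambda_profile ::
  "complex \<Rightarrow> ('n::finite \<Rightarrow> nat) \<Rightarrow> nat \<Rightarrow> real \<Rightarrow> (real ^ 'n \<Rightarrow> complex)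
     \<Rightarrow> real ^ 'n \<Rightarrow> complex" where
  "Lambda_profile \<nu> \<alpha> N t \<phi> x =
     (-2) powi (- int (mi_abs \<alpha>)) * of_real (t powr (- real (mi_abs \<alpha>) / 2)) *
     (\<Sum>k = 0..N. 2 powi (- int k) * of_real (t powr (- real k / 2)) *
        (\<Sum>\<beta> | mi_abs \<beta> = k.
           moment \<beta> \<phi> * dilation t (\<lambda>y. hermite \<nu> (\<lambda>j. \<alpha> j + \<beta> j) y * gauss \<nu> y) x))"

definition psi ::
  "(complex \<Rightarrow> complex) \<Rightarrow> (real \<Rightarrow> real ^ 'n \<Rightarrow> complex) \<Rightarrow> nat \<Rightarrow> real ^ 'n \<Rightarrow> complex" where
  "psi f u k =
     L1_bochner_integral (lebesgue_on {0..}) (\<lambda>s x. of_real (s ^ k) * f (u s x))"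

definition asymptotic_profile ::
  "complex \<Rightarrow> (complex \<Rightarrow> complex) \<Rightarrow> (real ^ 'n \<Rightarrow> complex) \<Rightarrow> (real \<Rightarrow> real ^ 'n \<Rightarrow> complex)
     \<Rightarrow> nat \<Rightarrow> real \<Rightarrow> real ^ 'n \<Rightarrow> complex" where
  "asymptotic_profile \<nu> f u0 u m t x =
     Lambda_profile \<nu> (\<lambda>_. 0) m t u0 x +
     (\<Sum>\<gamma> | real (mi_abs \<gamma>) \<le> real m / 2.
        (- \<nu>) ^ mi_abs \<gamma> / of_nat (mi_fact \<gamma>) *
        Lambda_profile \<nu> (\<lambda>j. 2 * \<gamma> j) (m - 2 * mi_abs \<gamma>) t (psi f u (mi_abs \<gamma>)) x)"

end

theory Submission
  imports Defs "HOL-Complex_Analysis.Complex_Analysis" "HOL-Probability.Distributions"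
begin

text \<open>The kernel \<open>(s, y) \<mapsto> G\<^bsub>(t - s)\<nu>\<^esub>(x - y)\<close> has an expansion into parabolically homogeneous
  polynomials in \<open>(s, y)\<close>: the function \<open>\<zeta> \<mapsto> G\<^bsub>(t - \<zeta>\<^sup>2 s)\<nu>\<^esub>(x - \<zeta> y)\<close> is holomorphic near the
  origin and its Taylor coefficients, found from the recurrence that its differential equation
  imposes, are the Hermite terms of the profile. Cauchy's estimates on a disc whose radius is of order
  \<open>t\<^bsup>1/2\<^esup>/(|y| + s\<^bsup>1/2\<^esup>)\<close> bound the remainder by Gaussians, with an extra factor that tends to \<open>0\<close>
  pointwise as \<open>t \<rightarrow> \<infinity>\<close>. A jointly measurable representative of \<open>f \<circ> u\<close> turns the Bochner
  integrals into Lebesgue integrals on \<open>(0, t) \<times> \<real>\<^sup>n\<close>. Gronwall's inequality bounds the growth of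
  the weighted moment of \<open>u(t)\<close>, and since \<open>p > 1 + (m + 2)/n\<close> makes \<open>|f(u)|\<close> decay faster than
  \<open>t\<^bsup>-1-m/2\<^esup> |u|\<close>, dominated convergence gives the limit for \<open>q = 1\<close> and \<open>q = \<infinity>\<close>. The
  intermediate exponents follow by interpolation.\<close>

section \<open>The Mehler formula\<close>

text \<open>Time s carries parabolic degree 2 and space y degree 1, so one complex parameter scaling
  both orders all mixed Taylor terms at once: degree k collects the indices with 2|\<gamma>| +
  |\<beta>| = k, and cutting at m reproduces the index ranges of the profile. Two obstacles shape
  the estimates. The kernel is singular at s = t, so it is expanded only for s < t/2 and set to 0
  beyond. There the polynomial has to be bounded alone, which is affordable because the parabolic
  size of (s, y) is then at least a multiple of t^{1/2}; the part of Duhamel's integral over [t/2,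
  t) is estimated without any expansion. Moreover only moments of order m are finite, so the
  remainder must not cost one more power of the weight: a factor min(1, .) keeps the order m and
  still vanishes for large t, but yields no rate. Finally, the unknown is a curve in function
  spaces, and nothing in its definition makes (s, y) \<mapsto> u(s)(y) measurable; this is why
  Fubini's theorem has to wait for a Borel representative.\<close>

text \<open>The Taylor coefficients of \<open>exp (a\<zeta> + b\<zeta>\<^sup>2)\<close>, i.e. rescaled Hermite polynomials.\<close>

definition gexp_coeff :: "complex \<Rightarrow> complex \<Rightarrow> nat \<Rightarrow> complex" where
  "gexp_coeff a b k = (\<Sum>c | 2 * c \<le> k. b ^ c * a ^ (k - 2 * c) / (fact c * fact (k - 2 * c)))"

lemma finite_double_le [simp]: "finite {c::nat. 2 * c \<le> k}"
  by (rule finite_subset[of _ "{..k}"]) auto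

lemma gexp_coeff_0 [simp]: "gexp_coeff a b 0 = 1"
proof -
  have "{c::nat. 2 * c \<le> 0} = {0}" by auto
  then show ?thesis by (simp add: gexp_coeff_def)
qed

lemma gexp_coeff_1 [simp]: "gexp_coeff a b (Suc 0) = a"
proof -
  have "{c::nat. 2 * c \<le> Suc 0} = {0}" by auto
  then show ?thesis by (simp add: gexp_coeff_def)
qed

text \<open>Coefficient form of F' = (a + 2 b \<zeta>) F for F = exp(a \<zeta> + b \<zeta>^2).
  Directly: k + 2 is split as (k + 2 - 2c) + 2c; the first part cancels into the factorial that
  belongs to a and lowers its power, the second cancels into \<open>fact c\<close> and shifts c by
  one.\<close>

lemma gexp_coeff_Suc_Suc:
  "of_nat (k + 2) * gexp_coeff a b (k + 2) = a * gexp_coeff a b (k + 1) + 2 * b * gexp_coeff a b k"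
proof -
  let ?t = "\<lambda>c. b ^ c * a ^ (k + 2 - 2 * c) / (fact c * fact (k + 2 - 2 * c)) :: complex"
  have "of_nat (k + 2) * gexp_coeff a b (k + 2) =
      (\<Sum>c | 2 * c \<le> k + 2. of_nat (k + 2 - 2 * c) * ?t c) + (\<Sum>c | 2 * c \<le> k + 2. 2 * of_nat c * ?t c)"
    unfolding gexp_coeff_def sum_distrib_left sum.distrib[symmetric]
  proof (rule sum.cong)
    fix c assume "c \<in> {c. 2 * c \<le> k + 2}"
    then have "of_nat (k + 2) = (of_nat (k + 2 - 2 * c) + 2 * of_nat c :: complex)"
      by (simp add: of_nat_diff)
    then show "of_nat (k + 2) * ?t c = of_nat (k + 2 - 2 * c) * ?t c + 2 * of_nat c * ?t c"
      by (metis distrib_right)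
  qed auto
  also have "(\<Sum>c | 2 * c \<le> k + 2. of_nat (k + 2 - 2 * c) * ?t c) =
      (\<Sum>c | 2 * c \<le> k + 1. of_nat (k + 2 - 2 * c) * ?t c)"
  proof (rule sum.mono_neutral_right)
    show "\<forall>i\<in>{c. 2 * c \<le> k + 2} - {c. 2 * c \<le> k + 1}. of_nat (k + 2 - 2 * i) * ?t i = 0"
    proof
      fix i assume "i \<in> {c. 2 * c \<le> k + 2} - {c. 2 * c \<le> k + 1}"
      then have "k + 2 - 2 * i = 0" by auto
      then have "of_nat (k + 2 - 2 * i) = (0::complex)" by (simp only: of_nat_0)
      then show "of_nat (k + 2 - 2 * i) * ?t i = 0" by simp
    qed
  qed auto
  also have "\<dots> = a * gexp_coeff a b (k + 1)"
    unfolding gexp_coeff_def sum_distrib_left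
  proof (rule sum.cong)
    fix c assume c: "c \<in> {c. 2 * c \<le> k + 1}"
    then have "k + 2 - 2 * c = Suc (k + 1 - 2 * c)" by auto
    then show "of_nat (k + 2 - 2 * c) * ?t c =
        a * (b ^ c * a ^ (k + 1 - 2 * c) / (fact c * fact (k + 1 - 2 * c)))"
      by (simp add: field_simps del: of_nat_Suc)
  qed auto
  also have "(\<Sum>c | 2 * c \<le> k + 2. 2 * of_nat c * ?t c) = (\<Sum>c\<in>Suc ` {c. 2 * c \<le> k}. 2 * of_nat c * ?t c)"
  proof (rule sum.mono_neutral_right)
    show "\<forall>i\<in>{c. 2 * c \<le> k + 2} - Suc ` {c. 2 * c \<le> k}. 2 * of_nat i * ?t i = 0"
    proof
      fix i assume i: "i \<in> {c. 2 * c \<le> k + 2} - Suc ` {c. 2 * c \<le> k}"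
      then have "i = 0" by (cases i) auto
      then show "2 * of_nat i * ?t i = 0" by simp
    qed
  qed auto
  also have "\<dots> = (\<Sum>c | 2 * c \<le> k. 2 * of_nat (Suc c) * ?t (Suc c))"
    by (subst sum.reindex) auto
  also have "\<dots> = 2 * b * gexp_coeff a b k"
    unfolding gexp_coeff_def sum_distrib_left
    by (rule sum.cong) (auto simp add: field_simps simp del: of_nat_Suc)
  finally show ?thesis .
qed

text \<open>With s = 4 b d this is the coefficient form of the differential equation derived in
  \<open>mehler_1d\<close>. A product of two three-term sequences satisfies a recurrence of order
  four; it is found by eliminating the terms of index k and k + 1 in favour of those of index k + 2
  and k + 3.\<close>

lemma mehler_recurrence:
  fixes P Q :: "nat \<Rightarrow> complex"
  assumes P: "\<And>k. of_nat (k + 2) * P (k + 2) = x * P (k + 1) + 2 * b * P k"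
    and Q: "\<And>k. of_nat (k + 2) * Q (k + 2) = y * Q (k + 1) + 2 * d * Q k"
    and 1: "P 0 = 1" "Q 0 = 1" "P 1 = x" "Q 1 = y"
  defines "a \<equiv> \<lambda>k. fact k * P k * Q k"
  shows "of_nat (k + 4) * a (k + 4) = x * y * a (k + 3) + (2 * (of_nat k + 2) * (4 * b * d) + 4 * b * d
      + 2 * b * y\<^sup>2 + 2 * d * x\<^sup>2) * a (k + 2) + 4 * b * d * x * y * a (k + 1)
      - (4 * b * d)\<^sup>2 * (of_nat k + 1) * a k"
proof -
  define n :: complex where "n = of_nat k"
  have nz: "n + 1 \<noteq> 0" "n + 2 \<noteq> 0" "n + 3 \<noteq> 0" "n + 4 \<noteq> 0"
    unfolding n_def by (metis of_nat_1 of_nat_add of_nat_numeral of_nat_eq_0_iff add_is_0 one_neq_zero zero_neq_numeral)+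
  have P2: "(n + 2) * P (k + 2) = x * P (k + 1) + 2 * b * P k" using P[of k] by (simp add: n_def add.commute)
  have P3: "(n + 3) * P (k + 3) = x * P (k + 2) + 2 * b * P (k + 1)"
    using P[of "k + 1"] by (simp add: n_def add.commute eval_nat_numeral add_ac)
  have P4: "(n + 4) * P (k + 4) = x * P (k + 3) + 2 * b * P (k + 2)"
    using P[of "k + 2"] by (simp add: n_def add.commute eval_nat_numeral add_ac)
  have Q2: "(n + 2) * Q (k + 2) = y * Q (k + 1) + 2 * d * Q k" using Q[of k] by (simp add: n_def add.commute)
  have Q3: "(n + 3) * Q (k + 3) = y * Q (k + 2) + 2 * d * Q (k + 1)"
    using Q[of "k + 1"] by (simp add: n_def add.commute eval_nat_numeral add_ac)
  have Q4: "(n + 4) * Q (k + 4) = y * Q (k + 3) + 2 * d * Q (k + 2)"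
    using Q[of "k + 2"] by (simp add: n_def add.commute eval_nat_numeral add_ac)
  define F :: complex where "F = fact k"
  have a: "a k = F * P k * Q k" "a (k + 1) = (n + 1) * F * P (k + 1) * Q (k + 1)"
    "a (k + 2) = (n + 2) * (n + 1) * F * P (k + 2) * Q (k + 2)"
    "a (k + 3) = (n + 3) * (n + 2) * (n + 1) * F * P (k + 3) * Q (k + 3)"
    "a (k + 4) = (n + 4) * (n + 3) * (n + 2) * (n + 1) * F * P (k + 4) * Q (k + 4)"
    unfolding a_def F_def n_def by (simp_all add: eval_nat_numeral algebra_simps)
  define p2 q2 p3 q3 where defs: "p2 = P (k + 2)" "q2 = Q (k + 2)" "p3 = P (k + 3)" "q3 = Q (k + 3)"
  \<comment> \<open>b or d may vanish (d does for s = 0), so P and Q cannot be solved backwards.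
    Only the multiples of the earlier terms by 2b and 2d are available, and the coefficients 4bd and
    (4bd)^2 of the claim provide exactly these factors.\<close>
  define U W where UW: "U = (n + 3) * p3 - x * p2" "W = (n + 3) * q3 - y * q2"
  have U: "2 * b * P (k + 1) = U" and W: "2 * d * Q (k + 1) = W"
    using P3 Q3 by (simp_all add: UW defs)
  have U0: "2 * b * P k = (n + 2) * p2 - x * P (k + 1)" and W0: "2 * d * Q k = (n + 2) * q2 - y * Q (k + 1)"
    using P2 Q2 by (simp_all add: defs)
  have a1: "4 * b * d * a (k + 1) = (n + 1) * F * (U * W)"
    unfolding a U[symmetric] W[symmetric] by (simp add: algebra_simps)
  have "(4 * b * d)\<^sup>2 * a k = F * ((2 * b) * (2 * d) * ((2 * b * P k) * (2 * d * Q k)))"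
    unfolding a by (simp add: power2_eq_square algebra_simps)
  also have "\<dots> = F * (4 * b * d * (n + 2)\<^sup>2 * p2 * q2 - 2 * b * (n + 2) * y * p2 * (2 * d * Q (k + 1))
      - 2 * d * (n + 2) * x * q2 * (2 * b * P (k + 1)) + x * y * (2 * b * P (k + 1)) * (2 * d * Q (k + 1)))"
    unfolding U0 W0 by (simp add: power2_eq_square algebra_simps)
  finally have a0: "(4 * b * d)\<^sup>2 * a k = F * (4 * b * d * (n + 2)\<^sup>2 * p2 * q2 - 2 * b * (n + 2) * y * p2 * W
      - 2 * d * (n + 2) * x * q2 * U + x * y * U * W)"
    unfolding U W .
  have "(n + 4) * a (k + 4) = (n + 3) * (n + 2) * (n + 1) * F * (((n + 4) * P (k + 4)) * ((n + 4) * Q (k + 4)))"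
    unfolding a by (simp add: algebra_simps)
  also have "\<dots> = (n + 3) * (n + 2) * (n + 1) * F * ((x * p3 + 2 * b * p2) * (y * q3 + 2 * d * q2))"
    unfolding P4 Q4 defs ..
  also have "\<dots> = x * y * a (k + 3) + (2 * (n + 2) * (4 * b * d) + 4 * b * d
      + 2 * b * y\<^sup>2 + 2 * d * x\<^sup>2) * a (k + 2) + x * y * (4 * b * d * a (k + 1))
      - (n + 1) * ((4 * b * d)\<^sup>2 * a k)"
    unfolding a1 a0 unfolding a(3,4) defs[symmetric] UW
    by (simp add: power2_eq_square algebra_simps)
  finally show ?thesis by (simp add: n_def algebra_simps)
qed

lemma nat_cases_4:
  fixes k :: nat
  obtains "k = 0" | "k = 1" | "k = 2" | "k = 3" | j where "k = j + 4"
proof -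
  have "k = 0 \<or> k = 1 \<or> k = 2 \<or> k = 3 \<or> k = (k - 4) + 4" by linarith
  with that show ?thesis by metis
qed

lemma fps_recurrence_nth:
  fixes \<Phi> :: "complex fps"
  assumes eq: "fps_deriv \<Phi> - fps_const (2 * s) * (fps_X ^ 2 * fps_deriv \<Phi>) + fps_const (s\<^sup>2) * (fps_X ^ 4 * fps_deriv \<Phi>) =
     fps_const c0 * \<Phi> + fps_const c1 * (fps_X ^ 1 * \<Phi>) + fps_const c2 * (fps_X ^ 2 * \<Phi>) - fps_const (s\<^sup>2) * (fps_X ^ 3 * \<Phi>)"
  shows "fps_nth \<Phi> 1 = c0 * fps_nth \<Phi> 0"
    and "2 * fps_nth \<Phi> 2 = c0 * fps_nth \<Phi> 1 + c1 * fps_nth \<Phi> 0"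
    and "3 * fps_nth \<Phi> 3 - 2 * s * fps_nth \<Phi> 1 = c0 * fps_nth \<Phi> 2 + c1 * fps_nth \<Phi> 1 + c2 * fps_nth \<Phi> 0"
    and "of_nat (j + 4) * fps_nth \<Phi> (j + 4) - 2 * s * of_nat (j + 2) * fps_nth \<Phi> (j + 2) + s\<^sup>2 * of_nat j * fps_nth \<Phi> j
      = c0 * fps_nth \<Phi> (j + 3) + c1 * fps_nth \<Phi> (j + 2) + c2 * fps_nth \<Phi> (j + 1) - s\<^sup>2 * fps_nth \<Phi> j"
proof -
  note e = arg_cong[OF eq, of "\<lambda>h. fps_nth h k" for k,
    unfolded fps_add_nth fps_sub_nth fps_mult_left_const_nth fps_X_power_mult_nth fps_deriv_nth]
  show "fps_nth \<Phi> 1 = c0 * fps_nth \<Phi> 0" using e[of 0] by simp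
  show "2 * fps_nth \<Phi> 2 = c0 * fps_nth \<Phi> 1 + c1 * fps_nth \<Phi> 0"
    using e[of 1] by (simp add: numeral_2_eq_2)
  show "3 * fps_nth \<Phi> 3 - 2 * s * fps_nth \<Phi> 1 = c0 * fps_nth \<Phi> 2 + c1 * fps_nth \<Phi> 1 + c2 * fps_nth \<Phi> 0"
    using e[of 2] by (simp add: numeral_2_eq_2 numeral_3_eq_3)
  have n: "j + 3 + 1 = j + 4" "j + 1 + 1 = j + 2" "j + 3 - 2 = j + 1" "j + 3 - 1 = j + 2" "j + 3 - 3 = j"
     "(j + 3 < 2) = False" "(j + 3 < 1) = False" "(j + 3 < 3) = False" by simp_all
  \<comment> \<open>For j = 0 the series \<open>fps_X ^ 4 * fps_deriv \<Phi>\<close> has no term of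
    degree 3; the factor \<open>of_nat j\<close> vanishes then, so one formula serves both
    cases.\<close>
  have s: "s\<^sup>2 * of_nat j * fps_nth \<Phi> j = s\<^sup>2 * (if j + 3 < 4 then 0 else of_nat (j + 3 - 4 + 1) * fps_nth \<Phi> (j + 3 - 4 + 1))"
    by (cases j) simp_all
  show "of_nat (j + 4) * fps_nth \<Phi> (j + 4) - 2 * s * of_nat (j + 2) * fps_nth \<Phi> (j + 2) + s\<^sup>2 * of_nat j * fps_nth \<Phi> j
      = c0 * fps_nth \<Phi> (j + 3) + c1 * fps_nth \<Phi> (j + 2) + c2 * fps_nth \<Phi> (j + 1) - s\<^sup>2 * fps_nth \<Phi> j"
    using e[of "j + 3"] unfolding s n if_False by (simp only: mult.assoc)
qed

text \<open>Mehler's formula in one variable. The factor exp(x^2 / (4 \<nu>)) normalises the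
  function to 1 at \<zeta> = 0. Its logarithmic derivative times (1 - s \<zeta>^2)^2 is a cubic
  polynomial, which yields a linear recurrence for the Taylor coefficients; the Hermite products
  satisfy the same recurrence and have the same initial values.\<close>

lemma mehler_1d:
  fixes x y s \<nu> :: complex
  assumes \<nu>: "\<nu> \<noteq> 0"
  assumes exp: "(\<lambda>\<zeta>. (1 - s * \<zeta>\<^sup>2) powr (- 1 / 2) *
      exp (x\<^sup>2 / (4 * \<nu>) - (x - \<zeta> * y)\<^sup>2 / (4 * \<nu> * (1 - s * \<zeta>\<^sup>2)))) has_fps_expansion \<Phi>"
  shows "fps_nth \<Phi> k = fact k * gexp_coeff (x / (2 * \<nu>)) (- 1 / (4 * \<nu>)) k * gexp_coeff y (- \<nu> * s) k"
proof -
  define F where "F = (\<lambda>\<zeta>. (1 - s * \<zeta>\<^sup>2) powr (- 1 / 2) *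
      exp (x\<^sup>2 / (4 * \<nu>) - (x - \<zeta> * y)\<^sup>2 / (4 * \<nu> * (1 - s * \<zeta>\<^sup>2))))"
  have F: "F has_fps_expansion \<Phi>" using exp by (simp add: F_def)
  let ?c0 = "x * y / (2 * \<nu>)" and ?c1 = "s - (y\<^sup>2 + s * x\<^sup>2) / (2 * \<nu>)" and ?c2 = "s * x * y / (2 * \<nu>)"
  \<comment> \<open>Close to 0 the base of the power avoids the branch cut, so the differential
    equation holds on a neighbourhood; an identity of germs is enough to equate two power
    series.\<close>
  have ev: "\<forall>\<^sub>F \<zeta> in nhds 0. 1 - s * \<zeta>\<^sup>2 \<in> - \<real>\<^sub>\<le>\<^sub>0"
  proof (rule eventually_nhds_in_open[THEN eventually_mono])
    show "open ((\<lambda>\<zeta>. 1 - s * \<zeta>\<^sup>2) -` (- \<real>\<^sub>\<le>\<^sub>0))"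
      by (intro open_vimage continuous_intros) auto
  qed auto
  have de: "(1 - s * \<zeta>\<^sup>2)\<^sup>2 * deriv F \<zeta> = (?c0 + ?c1 * \<zeta> + ?c2 * \<zeta>\<^sup>2 - s\<^sup>2 * \<zeta> ^ 3) * F \<zeta>"
    if "1 - s * \<zeta>\<^sup>2 \<in> - \<real>\<^sub>\<le>\<^sub>0" for \<zeta>
  proof -
    have nz: "1 - s * \<zeta>\<^sup>2 \<noteq> 0" using that by auto
    define g where "g = 1 - s * \<zeta>\<^sup>2"
    have g: "g \<noteq> 0" using nz by (simp add: g_def)
    have p32: "g powr (3 / 2) = g * g powr (1 / 2)" using powr_add[of g 1 "1/2"] g by simp
    have "(F has_field_derivative
      (F \<zeta> * (s * \<zeta> / g + 2 * y * (x - \<zeta> * y) / (4 * \<nu> * g) - (x - \<zeta> * y)\<^sup>2 * (2 * s * \<zeta>) / (4 * \<nu> * g\<^sup>2)))) (at \<zeta>)"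
      unfolding F_def using that nz \<nu>
      apply (auto intro!: derivative_eq_intros)
      apply (simp add: g_def[symmetric] powr_diff powr_minus)
      apply (simp add: field_simps power2_eq_square g p32)
      done
    then have d: "deriv F \<zeta> = F \<zeta> * (s * \<zeta> / g + 2 * y * (x - \<zeta> * y) / (4 * \<nu> * g) - (x - \<zeta> * y)\<^sup>2 * (2 * s * \<zeta>) / (4 * \<nu> * g\<^sup>2))"
      by (rule DERIV_imp_deriv)
    have "g\<^sup>2 * deriv F \<zeta> = F \<zeta> * (s * \<zeta> * g + y * (x - \<zeta> * y) * g / (2 * \<nu>) - (x - \<zeta> * y)\<^sup>2 * (s * \<zeta>) / (2 * \<nu>))"
      unfolding d using g \<nu> by (simp add: field_simps power2_eq_square)
    also have "s * \<zeta> * g + y * (x - \<zeta> * y) * g / (2 * \<nu>) - (x - \<zeta> * y)\<^sup>2 * (s * \<zeta>) / (2 * \<nu>) =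
       ?c0 + ?c1 * \<zeta> + ?c2 * \<zeta>\<^sup>2 - s\<^sup>2 * \<zeta> ^ 3"
      using \<nu> by (simp add: field_simps power2_eq_square power3_eq_cube g_def)
    finally show ?thesis by (simp add: g_def)
  qed
  define c where "c i = fps_nth \<Phi> i" for i
  have L: "(\<lambda>\<zeta>. (1 - s * \<zeta>\<^sup>2)\<^sup>2 * deriv F \<zeta>) has_fps_expansion
      (1 - fps_const s * fps_X ^ 2) ^ 2 * fps_deriv \<Phi>"
    by (intro fps_expansion_intros F)
  have R: "(\<lambda>\<zeta>. (?c0 + ?c1 * \<zeta> + ?c2 * \<zeta>\<^sup>2 - s\<^sup>2 * \<zeta> ^ 3) * F \<zeta>) has_fps_expansion
      (fps_const ?c0 + fps_const ?c1 * fps_X + fps_const ?c2 * fps_X ^ 2 - fps_const (s\<^sup>2) * fps_X ^ 3) * \<Phi>"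
    by (intro fps_expansion_intros F)
  have "(\<lambda>\<zeta>. (1 - s * \<zeta>\<^sup>2)\<^sup>2 * deriv F \<zeta>) has_fps_expansion
    (fps_const ?c0 + fps_const ?c1 * fps_X + fps_const ?c2 * fps_X ^ 2 - fps_const (s\<^sup>2) * fps_X ^ 3) * \<Phi>"
    using R by (rule iffD1[OF has_fps_expansion_cong, rotated -1])
      (use ev in \<open>auto elim!: eventually_mono simp: de\<close>)
  then have "(1 - fps_const s * fps_X ^ 2) ^ 2 * fps_deriv \<Phi> =
      (fps_const ?c0 + fps_const ?c1 * fps_X + fps_const ?c2 * fps_X ^ 2 - fps_const (s\<^sup>2) * fps_X ^ 3) * \<Phi>"
    using L fps_expansion_unique_complex by blast
  also have "(1 - fps_const s * fps_X ^ 2) ^ 2 * fps_deriv \<Phi> =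
    fps_deriv \<Phi> - fps_const (2 * s) * (fps_X ^ 2 * fps_deriv \<Phi>) + fps_const (s\<^sup>2) * (fps_X ^ 4 * fps_deriv \<Phi>)"
  proof -
    have "fps_const (2 * s) = 2 * fps_const s" "fps_const (s\<^sup>2) = (fps_const s)\<^sup>2"
      by (simp_all add: numeral_fps_const power2_eq_square flip: fps_const_mult)
    moreover have "(fps_X :: complex fps) ^ 4 = (fps_X ^ 2) ^ 2" by (simp flip: power_mult)
    moreover have "(1 - A * X) ^ 2 * D = D - 2 * A * (X * D) + A\<^sup>2 * (X\<^sup>2 * D)" for A X D :: "complex fps"
      by (simp add: power2_eq_square algebra_simps)
    ultimately show ?thesis by (simp only:)
  qed
  also have "(fps_const ?c0 + fps_const ?c1 * fps_X + fps_const ?c2 * fps_X ^ 2 - fps_const (s\<^sup>2) * fps_X ^ 3) * \<Phi> =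
    fps_const ?c0 * \<Phi> + fps_const ?c1 * (fps_X ^ 1 * \<Phi>) + fps_const ?c2 * (fps_X ^ 2 * \<Phi>) - fps_const (s\<^sup>2) * (fps_X ^ 3 * \<Phi>)"
    by (simp only: power_one_right ring_distribs mult.assoc)
  finally have eq: "fps_deriv \<Phi> - fps_const (2 * s) * (fps_X ^ 2 * fps_deriv \<Phi>) + fps_const (s\<^sup>2) * (fps_X ^ 4 * fps_deriv \<Phi>) =
     fps_const ?c0 * \<Phi> + fps_const ?c1 * (fps_X ^ 1 * \<Phi>) + fps_const ?c2 * (fps_X ^ 2 * \<Phi>) - fps_const (s\<^sup>2) * (fps_X ^ 3 * \<Phi>)" .
  note nth = fps_recurrence_nth[OF eq, folded c_def]
  \<comment> \<open>The parameters of the two Hermite factors. They give 4 b d = s, which turns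
    \<open>mehler_recurrence\<close> into the recurrence of the differential equation.\<close>
  define b d where "b = - 1 / (4 * \<nu>)" and "d = - \<nu> * s"
  define P Q where "P = gexp_coeff (x / (2 * \<nu>)) b" and "Q = gexp_coeff y d"
  define x' where "x' = x / (2 * \<nu>)"
  define a where "a k = fact k * P k * Q k" for k
  have bd: "4 * b * d = s" "2 * b = - 1 / (2 * \<nu>)" "2 * d = - 2 * \<nu> * s" using \<nu> by (simp_all add: b_def d_def)
  have P: "of_nat (k + 2) * P (k + 2) = x / (2 * \<nu>) * P (k + 1) + 2 * b * P k" for k
    unfolding P_def by (rule gexp_coeff_Suc_Suc)
  have Q: "of_nat (k + 2) * Q (k + 2) = y * Q (k + 1) + 2 * d * Q k" for k
    unfolding Q_def by (rule gexp_coeff_Suc_Suc)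
  have 1: "P 0 = 1" "Q 0 = 1" "P 1 = x / (2 * \<nu>)" "Q 1 = y" by (simp_all add: P_def Q_def)
  have c1: "2 * b * y\<^sup>2 + 2 * d * (x / (2 * \<nu>))\<^sup>2 + s = ?c1"
    unfolding bd using \<nu> by (simp add: field_simps power2_eq_square)
  have rec: "of_nat (k + 4) * a (k + 4) = ?c0 * a (k + 3) + (2 * (of_nat k + 2) * s + ?c1) * a (k + 2)
      + ?c2 * a (k + 1) - s\<^sup>2 * (of_nat k + 1) * a k" for k
    using mehler_recurrence[OF P Q 1, folded a_def, unfolded bd(1), of k]
    unfolding c1[symmetric] bd(1) by (simp add: ac_simps)
  have c0: "c 0 = 1"
    unfolding c_def using has_fps_expansion_imp_0_eq_fps_nth_0[OF F] by (simp add: F_def)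
  have c1': "c 1 = x' * y" unfolding nth(1) c0 x'_def by simp
  have P2: "P 2 = (x' * x' + 2 * b) / 2" and Q2: "Q 2 = (y * y + 2 * d) / 2"
    using P[of 0] Q[of 0] 1 by (simp_all add: x'_def numeral_2_eq_2 field_simps)
  have P3: "P 3 = (x' * P 2 + 2 * b * x') / 3" and Q3: "Q 3 = (y * Q 2 + 2 * d * y) / 3"
    using P[of 1] Q[of 1] 1 by (simp_all add: x'_def numeral_2_eq_2 numeral_3_eq_3 field_simps)
  have c01: "?c0 = x' * y" "?c1 = 2 * b * y\<^sup>2 + 2 * d * x'\<^sup>2 + 4 * b * d" "?c2 = 4 * b * d * x' * y"
    using c1 by (simp_all add: x'_def bd(1))
  \<comment> \<open>Degrees 2 and 3 are checked by hand: the general recurrence expresses a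
    coefficient by its four predecessors, so it starts at degree 4.\<close>
  have c2: "c 2 = a 2"
  proof -
    have "2 * c 2 = 2 * a 2"
      unfolding nth(2) c01 c1' c0 a_def P2 Q2 by (simp add: fact_numeral field_simps power2_eq_square)
    then show ?thesis by simp
  qed
  have c3: "c 3 = a 3"
  proof -
    have "3 * c 3 = 2 * (4 * b * d) * c 1 + (?c0 * c 2 + ?c1 * c 1 + ?c2 * c 0)"
      unfolding bd(1) using nth(3) by (simp only: diff_eq_eq ac_simps)
    also have "\<dots> = 3 * a 3"
      unfolding c2 c01 c1' c0 a_def P3 Q3 P2 Q2 by (simp add: fact_numeral field_simps power2_eq_square)
    finally show ?thesis by simp
  qed
  have "c k = a k" for k
  proof (induction k rule: less_induct)
    case (less k)
    show ?case
    proof (cases k rule: nat_cases_4)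
      case 1
      then show ?thesis using c0 by (simp add: a_def P_def Q_def)
    next
      case 2
      then show ?thesis using nth(1) c0 1 by (simp add: a_def)
    next
      case 3
      then show ?thesis using c2 by simp
    next
      case 4
      then show ?thesis using c3 by simp
    next
      case (5 j)
      have c: "c (j + 3) = a (j + 3)" "c (j + 2) = a (j + 2)" "c (j + 1) = a (j + 1)" "c j = a j"
        using less 5 by simp_all
      have "of_nat (j + 4) * c (j + 4) = ?c0 * a (j + 3) + ?c1 * a (j + 2) + ?c2 * a (j + 1) - s\<^sup>2 * a j
          + 2 * s * of_nat (j + 2) * a (j + 2) - s\<^sup>2 * of_nat j * a j"
        using nth(4)[of j, unfolded c] by (simp only: diff_add_eq diff_eq_eq add_diff_eq eq_diff_eq ac_simps)
      also have "\<dots> = of_nat (j + 4) * a (j + 4)"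
        unfolding rec by (simp add: ring_distribs)
      finally show ?thesis using 5 by (simp only: mult_cancel_left of_nat_eq_0_iff add_is_0 zero_neq_numeral) simp
    qed
  qed
  then show ?thesis by (simp add: a_def c_def P_def Q_def b_def d_def)
qed

text \<open>The quotient of the kernel of time 1 - \<zeta>^2 s at x - \<zeta> y by the one of time 1
  at x, continued to complex \<zeta>. The product over coordinates lets the one-dimensional formula
  act on each factor.\<close>

definition heat_gen :: "complex \<Rightarrow> real ^ 'n \<Rightarrow> real \<Rightarrow> real ^ 'n \<Rightarrow> complex \<Rightarrow> complex" where
  "heat_gen \<nu> x s y \<zeta> = (\<Prod>j\<in>UNIV. (1 - of_real s * \<zeta>\<^sup>2) powr (- 1 / 2) *
      exp ((of_real (x $ j))\<^sup>2 / (4 * \<nu>) -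
        (of_real (x $ j) - \<zeta> * of_real (y $ j))\<^sup>2 / (4 * \<nu> * (1 - of_real s * \<zeta>\<^sup>2))))"

definition heat_coeff :: "complex \<Rightarrow> real ^ 'n \<Rightarrow> real \<Rightarrow> real ^ 'n \<Rightarrow> nat \<Rightarrow> complex" where
  "heat_coeff \<nu> x s y k = (\<Sum>\<kappa> | mi_abs \<kappa> = k. \<Prod>j\<in>UNIV. fact (\<kappa> j) *
      gexp_coeff (of_real (x $ j) / (2 * \<nu>)) (- 1 / (4 * \<nu>)) (\<kappa> j) *
      gexp_coeff (of_real (y $ j)) (- \<nu> * of_real s) (\<kappa> j))"

text \<open>Arranged like the asymptotic profile, with \<gamma> for the powers of s and \<beta> for
  those of y. The source point (s, y) enters only through these monomials, so integrating over it
  leaves moments.\<close>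

definition heat_taylor :: "complex \<Rightarrow> nat \<Rightarrow> real ^ 'n \<Rightarrow> real \<Rightarrow> real ^ 'n \<Rightarrow> complex" where
  "heat_taylor \<nu> m x s y = (\<Sum>\<gamma> | real (mi_abs \<gamma>) \<le> real m / 2.
      (- \<nu>) ^ mi_abs \<gamma> / of_nat (mi_fact \<gamma>) * of_real (s ^ mi_abs \<gamma>) *
      (\<Sum>k = 0..m - 2 * mi_abs \<gamma>. \<Sum>\<beta> | mi_abs \<beta> = k.
         of_real (mi_power y \<beta>) / of_nat (mi_fact \<beta>) *
         (hermite \<nu> (\<lambda>j. 2 * \<gamma> j + \<beta> j) x / 2 ^ (2 * mi_abs \<gamma> + k))))"

text \<open>The general product formula sums over multisets of size k; over a finite index type,
  \<open>count\<close> identifies these with the multi-indices of modulus k.\<close>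

lemma fps_nth_prod_multi_index:
  fixes f :: "'n::finite \<Rightarrow> 'a::comm_ring_1 fps"
  shows "fps_nth (\<Prod>j\<in>UNIV. f j) k = (\<Sum>\<kappa> | mi_abs \<kappa> = k. \<Prod>j\<in>UNIV. fps_nth (f j) (\<kappa> j))"
proof -
  have size: "size X = mi_abs (count X)" for X :: "'n multiset"
    unfolding mi_abs_def size_multiset_overloaded_eq
    by (rule sum.mono_neutral_left) (auto simp: count_eq_zero_iff)
  have "fps_nth (\<Prod>j\<in>UNIV. f j) k = (\<Sum>X\<in>multisets_of_size UNIV k. \<Prod>j\<in>UNIV. fps_nth (f j) (count X j))"
    by (rule fps_prod_nth') simp
  also have "\<dots> = (\<Sum>\<kappa> | mi_abs \<kappa> = k. \<Prod>j\<in>UNIV. fps_nth (f j) (\<kappa> j))"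
    by (rule sum.reindex_bij_witness[where i = Abs_multiset and j = count])
       (auto simp: multisets_of_size_def size count_inverse Abs_multiset_inverse)
  finally show ?thesis .
qed

lemma heat_gen_has_fps_expansion:
  fixes x y :: "real ^ 'n"
  assumes "\<nu> \<noteq> 0"
  shows "heat_gen \<nu> x s y has_fps_expansion Abs_fps (heat_coeff \<nu> x s y)"
proof -
  define F where "F j = (\<lambda>\<zeta>. (1 - of_real s * \<zeta>\<^sup>2) powr (- 1 / 2) *
      exp ((of_real (x $ j))\<^sup>2 / (4 * \<nu>) -
        (of_real (x $ j) - \<zeta> * of_real (y $ j))\<^sup>2 / (4 * \<nu> * (1 - of_real s * \<zeta>\<^sup>2))))" for j
  have F: "F j has_fps_expansion fps_expansion (F j) 0" for j
    unfolding F_def using assms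
    by (intro analytic_at_imp_has_fps_expansion_0 analytic_intros) auto
  then have "(\<lambda>\<zeta>. \<Prod>j\<in>UNIV. F j \<zeta>) has_fps_expansion (\<Prod>j\<in>UNIV. fps_expansion (F j) 0)"
    by (intro fps_expansion_intros) auto
  moreover have "(\<Prod>j\<in>UNIV. fps_expansion (F j) 0) = Abs_fps (heat_coeff \<nu> x s y)"
    by (rule fps_ext) (simp add: fps_nth_prod_multi_index heat_coeff_def
        mehler_1d[OF assms F[unfolded F_def], folded F_def])
  moreover have "(\<lambda>\<zeta>. \<Prod>j\<in>UNIV. F j \<zeta>) = heat_gen \<nu> x s y"
    by (simp add: fun_eq_iff heat_gen_def F_def)
  ultimately show ?thesis by simp
qed

lemma double_le_eq_PiE: "{\<beta>. (\<lambda>j. 2 * \<beta> j) \<le> \<alpha>} = PiE UNIV (\<lambda>j. {c. 2 * c \<le> (\<alpha> :: 'n \<Rightarrow> nat) j})"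
  by (auto simp: le_fun_def)

lemma prod_gexp_coeff:
  fixes a :: "'n::finite \<Rightarrow> complex"
  shows "(\<Prod>j\<in>UNIV. gexp_coeff (a j) b (\<alpha> j)) = (\<Sum>\<beta> | (\<lambda>j. 2 * \<beta> j) \<le> \<alpha>. b ^ mi_abs \<beta> *
     (\<Prod>j\<in>UNIV. a j ^ (\<alpha> j - 2 * \<beta> j)) / (of_nat (mi_fact \<beta>) * of_nat (mi_fact (\<lambda>j. \<alpha> j - 2 * \<beta> j))))"
proof -
  have "(\<Prod>j\<in>UNIV. gexp_coeff (a j) b (\<alpha> j)) = (\<Sum>\<beta>\<in>PiE UNIV (\<lambda>j. {c. 2 * c \<le> \<alpha> j}).
     \<Prod>j\<in>UNIV. b ^ \<beta> j * a j ^ (\<alpha> j - 2 * \<beta> j) / (fact (\<beta> j) * fact (\<alpha> j - 2 * \<beta> j)))"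
    unfolding gexp_coeff_def by (rule prod_sum_PiE) auto
  also have "\<dots> = (\<Sum>\<beta> | (\<lambda>j. 2 * \<beta> j) \<le> \<alpha>. b ^ mi_abs \<beta> *
     (\<Prod>j\<in>UNIV. a j ^ (\<alpha> j - 2 * \<beta> j)) / (of_nat (mi_fact \<beta>) * of_nat (mi_fact (\<lambda>j. \<alpha> j - 2 * \<beta> j))))"
    unfolding double_le_eq_PiE
    by (simp add: prod.distrib prod_dividef mi_fact_def mi_abs_def power_sum of_nat_prod)
  finally show ?thesis .
qed

text \<open>With a = x / (2 \<nu>) and b = -1 / (4 \<nu>), a term with |\<beta>| = A and |\<alpha> -
  2 \<beta>| = B carries \<nu>^{-(A+B)} and 2^{-(2A+B)}. Since |\<alpha> - \<beta>| = A + B and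
  |\<alpha>| = 2A + B, the first is the power of \<nu> in \<open>hermite\<close> and the second is
  undone by the prefactor.\<close>

lemma hermite_eq_prod_gexp_coeff:
  fixes x :: "real ^ 'n"
  assumes "\<nu> \<noteq> 0"
  shows "hermite \<nu> \<alpha> x = 2 ^ mi_abs \<alpha> * of_nat (mi_fact \<alpha>) *
    (\<Prod>j\<in>UNIV. gexp_coeff (of_real (x $ j) / (2 * \<nu>)) (- 1 / (4 * \<nu>)) (\<alpha> j))"
  unfolding prod_gexp_coeff hermite_def sum_distrib_left
proof (rule sum.cong)
  fix \<beta> assume "\<beta> \<in> {\<beta>. (\<lambda>j. 2 * \<beta> j) \<le> \<alpha>}"
  then have le: "2 * \<beta> j \<le> \<alpha> j" for j by (simp add: le_fun_def)
  define A B where "A = mi_abs \<beta>" and "B = mi_abs (\<lambda>j. \<alpha> j - 2 * \<beta> j)"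
  have abs1: "mi_abs (\<lambda>j. \<alpha> j - \<beta> j) = A + B"
    unfolding A_def B_def mi_abs_def sum.distrib[symmetric]
  proof (rule sum.cong)
    show "\<alpha> j - \<beta> j = \<beta> j + (\<alpha> j - 2 * \<beta> j)" for j using le[of j] by linarith
  qed simp
  have abs2: "mi_abs \<alpha> = 2 * A + B"
    unfolding A_def B_def mi_abs_def sum.distrib[symmetric] sum_distrib_left
    by (rule sum.cong) (use le in auto)
  have pw: "(\<Prod>j\<in>UNIV. (of_real (x $ j) / (2 * \<nu>)) ^ (\<alpha> j - 2 * \<beta> j)) =
      of_real (mi_power x (\<lambda>j. \<alpha> j - 2 * \<beta> j)) / (2 * \<nu>) ^ B"
    by (simp add: power_divide prod_dividef mi_power_def B_def mi_abs_def power_sum)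
  have neg: "(- 1 / (4 * \<nu>)) ^ A = (- 1) ^ A / (2 ^ (2 * A) * \<nu> ^ A)"
    by (simp add: power_minus[of "1 / (4 * \<nu>)"] power_divide power_mult_distrib power_mult)
  show "(- 1) ^ mi_abs \<beta> * of_nat (mi_fact \<alpha>) / (of_nat (mi_fact \<beta>) * of_nat (mi_fact (\<lambda>j. \<alpha> j - 2 * \<beta> j)))
        * \<nu> powi (- int (mi_abs (\<lambda>j. \<alpha> j - \<beta> j))) * of_real (mi_power x (\<lambda>j. \<alpha> j - 2 * \<beta> j)) =
     2 ^ mi_abs \<alpha> * of_nat (mi_fact \<alpha>) * ((- 1 / (4 * \<nu>)) ^ mi_abs \<beta> *
       (\<Prod>j\<in>UNIV. (of_real (x $ j) / (2 * \<nu>)) ^ (\<alpha> j - 2 * \<beta> j)) /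
       (of_nat (mi_fact \<beta>) * of_nat (mi_fact (\<lambda>j. \<alpha> j - 2 * \<beta> j))))"
    unfolding pw abs1 abs2 A_def[symmetric] neg using assms
    by (simp add: power_int_minus power_int_of_nat power_add power_mult_distrib divide_simps
        flip: of_nat_add)
qed simp

text \<open>Only the factor in y is expanded; the factor in x is kept whole as the Hermite function
  of index \<kappa>.\<close>

lemma heat_coeff_eq:
  fixes x y :: "real ^ 'n"
  assumes "\<nu> \<noteq> 0"
  shows "heat_coeff \<nu> x s y k = (\<Sum>\<kappa> | mi_abs \<kappa> = k. \<Sum>\<gamma> | (\<lambda>j. 2 * \<gamma> j) \<le> \<kappa>.
    hermite \<nu> \<kappa> x / 2 ^ k * ((- \<nu> * of_real s) ^ mi_abs \<gamma> * of_real (mi_power y (\<lambda>j. \<kappa> j - 2 * \<gamma> j)) /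
      (of_nat (mi_fact \<gamma>) * of_nat (mi_fact (\<lambda>j. \<kappa> j - 2 * \<gamma> j)))))"
  unfolding heat_coeff_def
proof (rule sum.cong)
  fix \<kappa> :: "'n \<Rightarrow> nat" assume "\<kappa> \<in> {\<kappa>. mi_abs \<kappa> = k}"
  then have k: "mi_abs \<kappa> = k" by simp
  show "(\<Prod>j\<in>UNIV. fact (\<kappa> j) * gexp_coeff (of_real (x $ j) / (2 * \<nu>)) (- 1 / (4 * \<nu>)) (\<kappa> j) *
      gexp_coeff (of_real (y $ j)) (- \<nu> * of_real s) (\<kappa> j)) = (\<Sum>\<gamma> | (\<lambda>j. 2 * \<gamma> j) \<le> \<kappa>.
    hermite \<nu> \<kappa> x / 2 ^ k * ((- \<nu> * of_real s) ^ mi_abs \<gamma> * of_real (mi_power y (\<lambda>j. \<kappa> j - 2 * \<gamma> j)) /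
      (of_nat (mi_fact \<gamma>) * of_nat (mi_fact (\<lambda>j. \<kappa> j - 2 * \<gamma> j)))))"
  proof -
    have Q: "(\<Prod>j\<in>UNIV. gexp_coeff (of_real (y $ j)) (- \<nu> * of_real s) (\<kappa> j)) = (\<Sum>\<gamma> | (\<lambda>j. 2 * \<gamma> j) \<le> \<kappa>.
      (- \<nu> * of_real s) ^ mi_abs \<gamma> * of_real (mi_power y (\<lambda>j. \<kappa> j - 2 * \<gamma> j)) /
      (of_nat (mi_fact \<gamma>) * of_nat (mi_fact (\<lambda>j. \<kappa> j - 2 * \<gamma> j))))"
      unfolding mi_power_def of_real_prod of_real_power by (rule prod_gexp_coeff)
    show ?thesis
      unfolding sum_distrib_left[symmetric] Q[symmetric] prod.distrib hermite_eq_prod_gexp_coeff[OF assms] k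
      by (simp add: mi_fact_def)
  qed
qed simp

text \<open>The substitution \<kappa> = 2 \<gamma> + \<beta>. The parabolic degree is 2|\<gamma>| +
  |\<beta>|, so truncation at degree m becomes |\<gamma>| \<le> m/2 together with |\<beta>| \<le> m
  - 2|\<gamma>|, the index ranges of the profile.\<close>

lemma sum_heat_coeff:
  fixes x y :: "real ^ 'n"
  assumes "\<nu> \<noteq> 0"
  shows "(\<Sum>k\<le>m. heat_coeff \<nu> x s y k) = heat_taylor \<nu> m x s y"
proof -
  let ?t = "\<lambda>\<gamma> k \<beta>. (- \<nu>) ^ mi_abs \<gamma> / of_nat (mi_fact \<gamma>) * of_real (s ^ mi_abs \<gamma>) *
     (of_real (mi_power y \<beta>) / of_nat (mi_fact \<beta>) *
         (hermite \<nu> (\<lambda>j. 2 * \<gamma> j + \<beta> j) x / 2 ^ (2 * mi_abs \<gamma> + k)))"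
  have "(\<Sum>k\<le>m. heat_coeff \<nu> x s y k) = (\<Sum>(k,\<kappa>,\<gamma>)\<in>(SIGMA k:{..m}. SIGMA \<kappa>:{\<kappa>. mi_abs \<kappa> = k}. {\<gamma>. (\<lambda>j. 2 * \<gamma> j) \<le> \<kappa>}).
     hermite \<nu> \<kappa> x / 2 ^ k * ((- \<nu> * of_real s) ^ mi_abs \<gamma> * of_real (mi_power y (\<lambda>j. \<kappa> j - 2 * \<gamma> j)) /
      (of_nat (mi_fact \<gamma>) * of_nat (mi_fact (\<lambda>j. \<kappa> j - 2 * \<gamma> j)))))"
    unfolding heat_coeff_eq[OF assms]
    by (simp add: sum.Sigma finite_mi_abs_eq finite_mi_double_le finite_SigmaI)
  also have "\<dots> = (\<Sum>(\<gamma>,k,\<beta>)\<in>(SIGMA \<gamma>:{\<gamma>. real (mi_abs \<gamma>) \<le> real m / 2}. SIGMA k:{0..m - 2 * mi_abs \<gamma>}. {\<beta>::'n \<Rightarrow> nat. mi_abs \<beta> = k}).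
     ?t \<gamma> k \<beta>)"
  proof (rule sum.reindex_bij_witness[where i = "\<lambda>(\<gamma>,k,\<beta>). (2 * mi_abs \<gamma> + k, \<lambda>j. 2 * \<gamma> j + \<beta> j, \<gamma>)"
        and j = "\<lambda>(k,\<kappa>,\<gamma>). (\<gamma>, mi_abs \<kappa> - 2 * mi_abs \<gamma>, \<lambda>j. \<kappa> j - 2 * \<gamma> j)"])
    have abs: "mi_abs (\<lambda>j. \<kappa> j - 2 * \<gamma> j) = mi_abs \<kappa> - 2 * mi_abs \<gamma>" "2 * mi_abs \<gamma> \<le> mi_abs \<kappa>"
       if "(\<lambda>j. 2 * \<gamma> j) \<le> \<kappa>" for \<kappa> \<gamma> :: "'n \<Rightarrow> nat"
    proof -
      have le: "2 * \<gamma> j \<le> \<kappa> j" for j using that by (simp add: le_fun_def)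
      have "mi_abs \<kappa> = mi_abs (\<lambda>j. \<kappa> j - 2 * \<gamma> j) + 2 * mi_abs \<gamma>"
        unfolding mi_abs_def sum_distrib_left sum.distrib[symmetric]
        by (rule sum.cong) (use le in auto)
      then show "mi_abs (\<lambda>j. \<kappa> j - 2 * \<gamma> j) = mi_abs \<kappa> - 2 * mi_abs \<gamma>" "2 * mi_abs \<gamma> \<le> mi_abs \<kappa>"
        by simp_all
    qed
    have abs2: "mi_abs (\<lambda>j. 2 * \<gamma> j + \<beta> j) = 2 * mi_abs \<gamma> + mi_abs \<beta>" for \<gamma> \<beta> :: "'n \<Rightarrow> nat"
      by (simp add: mi_abs_def sum.distrib sum_distrib_left)
    fix a assume a: "a \<in> (SIGMA k:{..m}. SIGMA \<kappa>:{\<kappa>::'n \<Rightarrow> nat. mi_abs \<kappa> = k}. {\<gamma>. (\<lambda>j. 2 * \<gamma> j) \<le> \<kappa>})"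
    obtain k \<kappa> \<gamma> where [simp]: "a = (k, \<kappa>, \<gamma>)" by (cases a)
    have k: "k \<le> m" "mi_abs \<kappa> = k" and le: "(\<lambda>j. 2 * \<gamma> j) \<le> \<kappa>" using a by auto
    have le': "2 * \<gamma> j \<le> \<kappa> j" for j using le by (simp add: le_fun_def)
    show "(case case a of (k, \<kappa>, \<gamma>) \<Rightarrow> (\<gamma>, mi_abs \<kappa> - 2 * mi_abs \<gamma>, \<lambda>j. \<kappa> j - 2 * \<gamma> j) of
          (\<gamma>, k, \<beta>) \<Rightarrow> (2 * mi_abs \<gamma> + k, \<lambda>j. 2 * \<gamma> j + \<beta> j, \<gamma>)) = a"
      using abs(2)[OF le] k le' by simp
    show "(case a of (k, \<kappa>, \<gamma>) \<Rightarrow> (\<gamma>, mi_abs \<kappa> - 2 * mi_abs \<gamma>, \<lambda>j. \<kappa> j - 2 * \<gamma> j)) \<in>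
       (SIGMA \<gamma>:{\<gamma>. real (mi_abs \<gamma>) \<le> real m / 2}. SIGMA k:{0..m - 2 * mi_abs \<gamma>}. {\<beta>::'n \<Rightarrow> nat. mi_abs \<beta> = k})"
      using abs[OF le] k by auto
    show "(case case a of (k, \<kappa>, \<gamma>) \<Rightarrow> (\<gamma>, mi_abs \<kappa> - 2 * mi_abs \<gamma>, \<lambda>j. \<kappa> j - 2 * \<gamma> j) of
          (\<gamma>, k, \<beta>) \<Rightarrow> ?t \<gamma> k \<beta>) = (case a of (k, \<kappa>, \<gamma>) \<Rightarrow>
       hermite \<nu> \<kappa> x / 2 ^ k * ((- \<nu> * of_real s) ^ mi_abs \<gamma> * of_real (mi_power y (\<lambda>j. \<kappa> j - 2 * \<gamma> j)) /
      (of_nat (mi_fact \<gamma>) * of_nat (mi_fact (\<lambda>j. \<kappa> j - 2 * \<gamma> j)))))"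
    proof -
      have "(- \<nu> * of_real s) ^ mi_abs \<gamma> = (- \<nu>) ^ mi_abs \<gamma> * of_real (s ^ mi_abs \<gamma>)"
        by (simp only: power_mult_distrib of_real_power)
      then show ?thesis using abs[OF le] k le' by (simp del: mult_minus_left add: mult_ac)
    qed
  next
    fix b assume b: "b \<in> (SIGMA \<gamma>:{\<gamma>::'n \<Rightarrow> nat. real (mi_abs \<gamma>) \<le> real m / 2}. SIGMA k:{0..m - 2 * mi_abs \<gamma>}. {\<beta>::'n \<Rightarrow> nat. mi_abs \<beta> = k})"
    obtain \<gamma> k \<beta> where [simp]: "b = (\<gamma>, k, \<beta>)" by (cases b)
    have k: "2 * mi_abs \<gamma> \<le> m" "k \<le> m - 2 * mi_abs \<gamma>" "mi_abs \<beta> = k" using b by auto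
    have abs2: "mi_abs (\<lambda>j. 2 * \<gamma> j + \<beta> j) = 2 * mi_abs \<gamma> + mi_abs \<beta>" for \<gamma> \<beta> :: "'n \<Rightarrow> nat"
      by (simp add: mi_abs_def sum.distrib sum_distrib_left)
    show "(case case b of (\<gamma>, k, \<beta>) \<Rightarrow> (2 * mi_abs \<gamma> + k, \<lambda>j. 2 * \<gamma> j + \<beta> j, \<gamma>) of
        (k, \<kappa>, \<gamma>) \<Rightarrow> (\<gamma>, mi_abs \<kappa> - 2 * mi_abs \<gamma>, \<lambda>j. \<kappa> j - 2 * \<gamma> j)) = b"
      using k by (simp add: abs2)
    show "(case b of (\<gamma>, k, \<beta>) \<Rightarrow> (2 * mi_abs \<gamma> + k, \<lambda>j. 2 * \<gamma> j + \<beta> j, \<gamma>)) \<in>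
       (SIGMA k:{..m}. SIGMA \<kappa>:{\<kappa>::'n \<Rightarrow> nat. mi_abs \<kappa> = k}. {\<gamma>. (\<lambda>j. 2 * \<gamma> j) \<le> \<kappa>})"
      using k by (auto simp: abs2 le_fun_def)
  qed
  also have "\<dots> = heat_taylor \<nu> m x s y"
    unfolding heat_taylor_def sum_distrib_left
    by (simp add: sum.Sigma finite_mi_abs_eq finite_mi_abs_le_half finite_SigmaI del: le_divide_eq_numeral1)
  finally show ?thesis .
qed

section \<open>Gaussian bounds for the Taylor remainder\<close>

lemma norm_sq_eq_sum: "(norm (x :: real ^ 'n))\<^sup>2 = (\<Sum>j\<in>UNIV. (x $ j)\<^sup>2)"
  unfolding power2_norm_eq_inner inner_vec_def by (simp add: power2_eq_square)

lemma Re_quarter_inverse_pos: "Re \<nu> > 0 \<Longrightarrow> Re (1 / (4 * \<nu>)) > 0"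
  by (cases "\<nu> = 0")
     (auto simp: Re_divide power_mult_distrib intro!: divide_pos_pos add_pos_nonneg mult_pos_pos zero_less_power)

text \<open>The coordinate sums collapse to |x|^2, the inner product of x and y, and |y|^2, so that
  the later estimate of the exponent does not see the dimension.\<close>

lemma heat_gen_eq:
  fixes x y :: "real ^ 'n"
  assumes "\<nu> \<noteq> 0" "1 - of_real s * \<zeta>\<^sup>2 \<noteq> 0"
  shows "heat_gen \<nu> x s y \<zeta> = ((1 - of_real s * \<zeta>\<^sup>2) powr (- 1 / 2)) ^ CARD('n) *
     exp ((of_real ((norm x)\<^sup>2) - (of_real ((norm x)\<^sup>2) - 2 * \<zeta> * of_real (x \<bullet> y) + \<zeta>\<^sup>2 * of_real ((norm y)\<^sup>2)) /
        (1 - of_real s * \<zeta>\<^sup>2)) / (4 * \<nu>))"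
proof -
  define g where "g = 1 - of_real s * \<zeta>\<^sup>2"
  have g0: "g \<noteq> 0" using assms by (simp add: g_def)
  have "(\<Sum>j\<in>UNIV. (of_real (x $ j))\<^sup>2 / (4 * \<nu>) - (of_real (x $ j) - \<zeta> * of_real (y $ j))\<^sup>2 / (4 * \<nu> * g)) =
     (\<Sum>j\<in>UNIV. (of_real ((x $ j)\<^sup>2) - (of_real ((x $ j)\<^sup>2) - 2 * \<zeta> * of_real (x $ j * y $ j) + \<zeta>\<^sup>2 * of_real ((y $ j)\<^sup>2)) / g) / (4 * \<nu>))"
    using assms(1) g0 by (intro sum.cong refl) (simp add: field_simps power2_eq_square)
  also have "\<dots> = (of_real ((norm x)\<^sup>2) - (of_real ((norm x)\<^sup>2) - 2 * \<zeta> * of_real (x \<bullet> y) + \<zeta>\<^sup>2 * of_real ((norm y)\<^sup>2)) / g) / (4 * \<nu>)"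
    by (simp add: norm_sq_eq_sum inner_vec_def of_real_sum sum_divide_distrib[symmetric] sum_subtractf sum.distrib sum_distrib_left mult.assoc)
  finally have e: "(\<Sum>j\<in>UNIV. (of_real (x $ j))\<^sup>2 / (4 * \<nu>) - (of_real (x $ j) - \<zeta> * of_real (y $ j))\<^sup>2 / (4 * \<nu> * g)) = \<dots>" .
  show ?thesis
    unfolding heat_gen_def g_def[symmetric] prod.distrib exp_sum[OF finite, symmetric] e by simp
qed

text \<open>A positive real factor splits off the principal logarithm without a jump of branch; this
  reconciles the single power of order -n/2 in \<open>gauss\<close> with the n square roots in
  \<open>heat_gen\<close>.\<close>

lemma gauss_eq_heat_gen:
  fixes x y :: "real ^ 'n"
  assumes "\<nu> \<noteq> 0" "s < 1"
  shows "gauss (of_real (1 - s) * \<nu>) (x - y) = gauss \<nu> x * heat_gen \<nu> x s y 1"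
proof -
  have s: "1 - complex_of_real s \<noteq> 0" using assms
    by (metis eq_iff_diff_eq_0 less_irrefl of_real_1 of_real_eq_iff)
  have "Ln (of_real (4 * pi) * (of_real (1 - s) * \<nu>)) = Ln (of_real (1 - s) * (of_real (4 * pi) * \<nu>))"
    by (simp add: mult_ac)
  also have "\<dots> = of_real (ln (1 - s)) + Ln (of_real (4 * pi) * \<nu>)"
    using assms by (subst Ln_times_of_real) (auto simp: Ln_of_real simp del: of_real_diff)
  finally have "(of_real (4 * pi) * (of_real (1 - s) * \<nu>)) powr (- of_nat CARD('n) / 2) =
      exp (- of_nat CARD('n) / 2 * of_real (ln (1 - s))) * (of_real (4 * pi) * \<nu>) powr (- of_nat CARD('n) / 2)"
    using assms s by (simp add: powr_def exp_add[symmetric] algebra_simps)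
  also have "exp (- of_nat CARD('n) / 2 * of_real (ln (1 - s))) = ((1 - of_real s) powr (- 1 / 2 :: complex)) ^ CARD('n)"
    using assms s Ln_of_real[of "1 - s"] by (simp add: powr_def exp_of_nat_mult[symmetric])
  finally have pw: "(of_real (4 * pi) * (of_real (1 - s) * \<nu>)) powr (- of_nat CARD('n) / 2) =
     ((1 - of_real s) powr (- 1 / 2 :: complex)) ^ CARD('n) * (of_real (4 * pi) * \<nu>) powr (- of_nat CARD('n) / 2)" .
  have nn: "(norm (x - y))\<^sup>2 = (norm x)\<^sup>2 - 2 * (x \<bullet> y) + (norm y)\<^sup>2"
    by (simp add: power2_norm_eq_inner inner_diff inner_commute)
  have "- of_real ((norm (x - y))\<^sup>2) / (4 * (of_real (1 - s) * \<nu>)) = - of_real ((norm x)\<^sup>2) / (4 * \<nu>) +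
     (of_real ((norm x)\<^sup>2) - (of_real ((norm x)\<^sup>2) - 2 * of_real (x \<bullet> y) + of_real ((norm y)\<^sup>2)) /
        (1 - of_real s)) / (4 * \<nu>)"
    unfolding nn using assms(1) s by (simp add: divide_simps)
  then show ?thesis
    unfolding gauss_def pw using heat_gen_eq[of \<nu> s 1 x y] assms s
    by (simp add: exp_add[symmetric] mult_ac)
qed

lemma cmod_powr_minus_half:
  assumes "cmod (z - 1) \<le> 3 / 4"
  shows "cmod (z powr (- 1 / 2)) \<le> 2"
proof -
  have z: "cmod z \<ge> 1 / 4" using norm_triangle_ineq2[of 1 "1 - z"] assms by (simp add: norm_minus_commute)
  then have nz: "z \<noteq> 0" by auto
  have "cmod (z powr (- 1 / 2)) = exp (- ln (cmod z) / 2)"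
    using nz by (simp add: powr_def)
  also have "\<dots> \<le> exp (ln 2)"
  proof -
    have "ln (1 / 4) \<le> ln (cmod z)" using z nz by (subst ln_le_cancel_iff) auto
    moreover have "ln (1 / 4 :: real) = - 2 * ln 2"
      using ln_realpow[of 2 2] by (simp add: ln_div)
    ultimately show ?thesis unfolding exp_le_cancel_iff by linarith
  qed
  finally show ?thesis by simp
qed

text \<open>With L = |1 / (4 \<nu>)|, the constant c is chosen so that c L = b / 4. On the region
  considered the quadratic form in the exponent deviates from |x|^2 by at most 2c (1 + |x|^2);
  multiplied by L this is (b / 2)(1 + |x|^2), so half of the decay exp(-b |x|^2) survives.\<close>

lemma heat_gen_bound:
  fixes x y :: "real ^ 'n"
  assumes \<nu>: "Re \<nu> > 0"
  defines "b \<equiv> Re (1 / (4 * \<nu>))" and "c \<equiv> Re (1 / (4 * \<nu>)) / (4 * cmod (1 / (4 * \<nu>)))"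
  assumes s: "cmod (of_real s * \<zeta>\<^sup>2) \<le> c\<^sup>2" and y: "cmod \<zeta> * norm y \<le> c"
  shows "cmod (gauss \<nu> x * heat_gen \<nu> x s y \<zeta>) \<le>
     cmod ((of_real (4 * pi) * \<nu>) powr (- of_nat CARD('n) / 2)) * 2 ^ CARD('n) * exp (b / 2) * exp (- b / 2 * (norm x)\<^sup>2)"
proof -
  define L where "L = cmod (1 / (4 * \<nu>))"
  define X where "X = (norm x)\<^sup>2"
  have nz: "\<nu> \<noteq> 0" using \<nu> by auto
  have b: "0 < b" unfolding b_def using \<nu> by (rule Re_quarter_inverse_pos)
  have "b \<le> L" unfolding b_def L_def by (rule complex_Re_le_cmod)
  then have L: "0 < L" and c: "0 < c" "c \<le> 1 / 4" "c * L = b / 4"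
    using b by (auto simp: c_def b_def[symmetric] L_def[symmetric] divide_simps)
  define g where "g = 1 - of_real s * \<zeta>\<^sup>2"
  have c2: "c\<^sup>2 \<le> c / 4" using c mult_left_mono[of c "1/4" c] by (simp add: power2_eq_square)
  have g1: "cmod (g - 1) \<le> c\<^sup>2" using s by (simp add: g_def)
  have g34: "cmod g \<ge> 3 / 4"
    using norm_triangle_ineq2[of 1 "1 - g"] g1 c2 c by (simp add: norm_minus_commute)
  then have g0: "g \<noteq> 0" by auto
  define W where "W = (of_real X - 2 * \<zeta> * of_real (x \<bullet> y) + \<zeta>\<^sup>2 * of_real ((norm y)\<^sup>2)) / g"
  have "cmod (W - of_real X) \<le> 2 * c * (1 + X)"
  proof -
    have "W - of_real X = (- 2 * \<zeta> * of_real (x \<bullet> y) + \<zeta>\<^sup>2 * of_real ((norm y)\<^sup>2) + of_real X * (of_real s * \<zeta>\<^sup>2)) / g"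
      using g0 by (simp add: W_def field_simps) (simp add: g_def algebra_simps)
    then have "cmod (W - of_real X) = cmod (- 2 * \<zeta> * of_real (x \<bullet> y) + \<zeta>\<^sup>2 * of_real ((norm y)\<^sup>2) + of_real X * (of_real s * \<zeta>\<^sup>2)) / cmod g"
      by (simp add: norm_divide)
    also have "\<dots> \<le> (c * (1 + X) + c\<^sup>2 + X * c\<^sup>2) / (3 / 4)"
    proof (rule frac_le)
      have "cmod (- 2 * \<zeta> * of_real (x \<bullet> y)) = 2 * (cmod \<zeta> * \<bar>x \<bullet> y\<bar>)" by (simp add: norm_mult)
      also have "\<dots> \<le> 2 * (cmod \<zeta> * (norm x * norm y))"
        by (intro mult_left_mono Cauchy_Schwarz_ineq2) auto
      also have "\<dots> = 2 * norm x * (cmod \<zeta> * norm y)" by simp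
      also have "\<dots> \<le> 2 * norm x * c" using y by (intro mult_left_mono) auto
      also have "\<dots> \<le> c * (1 + X)"
        using c sum_squares_bound[of 1 "norm x"] by (simp add: X_def power2_eq_square mult.commute)
      finally have 1: "cmod (- 2 * \<zeta> * of_real (x \<bullet> y)) \<le> c * (1 + X)" .
      have 2: "cmod (\<zeta>\<^sup>2 * of_real ((norm y)\<^sup>2)) \<le> c\<^sup>2"
        using power_mono[OF y, of 2] by (simp add: norm_mult norm_power power_mult_distrib)
      have 3: "cmod (of_real X * (of_real s * \<zeta>\<^sup>2)) \<le> X * c\<^sup>2"
        unfolding norm_mult[of "of_real X"] using s by (simp add: X_def mult_left_mono norm_power)
      show "cmod (- 2 * \<zeta> * of_real (x \<bullet> y) + \<zeta>\<^sup>2 * of_real ((norm y)\<^sup>2) + of_real X * (of_real s * \<zeta>\<^sup>2))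
         \<le> c * (1 + X) + c\<^sup>2 + X * c\<^sup>2"
        using 1 2 3 by (intro norm_triangle_le add_mono)
    qed (use g34 c in \<open>auto simp: X_def\<close>)
    also have "\<dots> = (c + c\<^sup>2) * (1 + X) * (4 / 3)" by (simp add: field_simps)
    also have "\<dots> \<le> (c + c / 4) * (1 + X) * (4 / 3)"
      using c2 by (intro mult_right_mono) (auto simp: X_def)
    also have "\<dots> = (5 / 3) * (c * (1 + X))" by (simp add: field_simps)
    also have "\<dots> \<le> 2 * (c * (1 + X))"
      using c by (intro mult_right_mono) (auto simp: X_def)
    finally show ?thesis by simp
  qed
  then have "cmod ((W - of_real X) * (1 / (4 * \<nu>))) \<le> 2 * c * (1 + X) * L"
    unfolding norm_mult L_def[symmetric] using L by (intro mult_right_mono) auto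
  then have "- Re ((W - of_real X) * (1 / (4 * \<nu>))) \<le> 2 * c * (1 + X) * L"
    using complex_Re_le_cmod[of "- ((W - of_real X) * (1 / (4 * \<nu>)))"] by simp
  also have "\<dots> = b / 2 * (1 + X)" using c(3) by (simp add: algebra_simps)
  finally have ReW: "- Re ((W - of_real X) * (1 / (4 * \<nu>))) \<le> b / 2 * (1 + X)" .
  have "Re (- of_real X / (4 * \<nu>) + (of_real X - W) / (4 * \<nu>)) = - Re ((W - of_real X) * (1 / (4 * \<nu>))) - X * b"
  proof -
    have "- of_real X / (4 * \<nu>) + (of_real X - W) / (4 * \<nu>) = - ((W - of_real X) * (1 / (4 * \<nu>))) - of_real X * (1 / (4 * \<nu>))"
      using nz by (simp add: field_simps)
    moreover have "Re (of_real X * (1 / (4 * \<nu>))) = X * b"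
      unfolding b_def by (simp only: times_complex.sel Re_complex_of_real Im_complex_of_real mult_zero_left diff_zero)
    ultimately show ?thesis by (simp only: minus_complex.sel uminus_complex.sel)
  qed
  then have e: "cmod (exp (- of_real X / (4 * \<nu>)) * exp ((of_real X - W) / (4 * \<nu>))) \<le> exp (b / 2 * (1 + X) - X * b)"
    using ReW unfolding exp_add[symmetric] by simp
  have "cmod (g powr (- 1 / 2)) \<le> 2"
    using g1 c2 c by (intro cmod_powr_minus_half) auto
  then have P: "cmod ((g powr (- 1 / 2)) ^ CARD('n)) \<le> 2 ^ CARD('n)"
    unfolding norm_power by (intro power_mono) auto
  have "cmod (gauss \<nu> x * heat_gen \<nu> x s y \<zeta>) = cmod ((of_real (4 * pi) * \<nu>) powr (- of_nat CARD('n) / 2)) *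
      (cmod ((g powr (- 1 / 2)) ^ CARD('n)) * cmod (exp (- of_real X / (4 * \<nu>)) * exp ((of_real X - W) / (4 * \<nu>))))"
    unfolding heat_gen_eq[OF nz g0[unfolded g_def]] g_def[symmetric] gauss_def X_def W_def by (simp add: norm_mult)
  also have "\<dots> \<le> cmod ((of_real (4 * pi) * \<nu>) powr (- of_nat CARD('n) / 2)) * (2 ^ CARD('n) * exp (b / 2 * (1 + X) - X * b))"
    by (intro mult_left_mono mult_mono P e) auto
  also have "exp (b / 2 * (1 + X) - X * b) = exp (b / 2) * exp (- b / 2 * X)"
    by (simp add: exp_add[symmetric] field_simps)
  finally show ?thesis by (simp add: X_def mult_ac)
qed

text \<open>\<rho> bounds the parabolic size of (s, y), and \<open>heat_gen_bound\<close> applies on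
  the disc |\<zeta>| \<le> c / \<rho>; Cauchy's estimates on it cost the factor (\<rho> / c)^k. For
  \<rho> < c the open disc contains \<zeta> = 1, where the Taylor series sums to the shifted
  kernel.\<close>

lemma heat_coeff_bound:
  fixes x y :: "real ^ 'n"
  assumes \<nu>: "Re \<nu> > 0"
  obtains c C b where "0 < c" "c \<le> 1" "0 < C" "0 < b"
    "\<And>(x::real^'n) y s \<rho> k. 0 \<le> s \<Longrightarrow> s \<le> \<rho>\<^sup>2 \<Longrightarrow> norm y \<le> \<rho> \<Longrightarrow> 0 < \<rho> \<Longrightarrow>
       cmod (gauss \<nu> x * heat_coeff \<nu> x s y k) \<le> C * exp (- b * (norm x)\<^sup>2) * (\<rho> / c) ^ k"
    "\<And>(x::real^'n) y s \<rho>. 0 \<le> s \<Longrightarrow> s \<le> \<rho>\<^sup>2 \<Longrightarrow> norm y \<le> \<rho> \<Longrightarrow> 0 < \<rho> \<Longrightarrow> \<rho> < c \<Longrightarrow>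
       (\<lambda>k. gauss \<nu> x * heat_coeff \<nu> x s y k) sums gauss (of_real (1 - s) * \<nu>) (x - y)"
proof -
  have nz: "\<nu> \<noteq> 0" using \<nu> by auto
  define b0 where "b0 = Re (1 / (4 * \<nu>))"
  define c where "c = Re (1 / (4 * \<nu>)) / (4 * cmod (1 / (4 * \<nu>)))"
  define C where "C = cmod ((of_real (4 * pi) * \<nu>) powr (- of_nat CARD('n) / 2)) * 2 ^ CARD('n) * exp (b0 / 2)"
  have b0: "0 < b0" unfolding b0_def using \<nu> by (rule Re_quarter_inverse_pos)
  have "b0 \<le> cmod (1 / (4 * \<nu>))" unfolding b0_def by (rule complex_Re_le_cmod)
  then have c: "0 < c" "c \<le> 1 / 4"
    using b0 unfolding c_def b0_def[symmetric] by (auto simp: divide_simps)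
  have C: "0 < C" using nz by (simp add: C_def powr_def)
  \<comment> \<open>One radius serves both conditions, because s is measured by \<rho>^2 and comes
    with \<zeta>^2, while y is measured by \<rho> and comes with \<zeta>.\<close>
  have small: "cmod (of_real s * \<zeta>\<^sup>2) \<le> c\<^sup>2 \<and> cmod \<zeta> * norm y \<le> c"
    if "0 \<le> s" "s \<le> \<rho>\<^sup>2" "norm y \<le> \<rho>" "0 < \<rho>" "cmod \<zeta> \<le> c / \<rho>" for s \<rho> \<zeta> and y :: "real^'n"
  proof
    have z: "cmod \<zeta> * \<rho> \<le> c" using that by (simp add: field_simps)
    then show "cmod \<zeta> * norm y \<le> c" using that mult_left_mono[of "norm y" \<rho> "cmod \<zeta>"] by simp
    have "cmod (of_real s * \<zeta>\<^sup>2) = s * (cmod \<zeta>)\<^sup>2" using that by (simp add: norm_mult norm_power)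
    also have "\<dots> \<le> \<rho>\<^sup>2 * (cmod \<zeta>)\<^sup>2" using that by (intro mult_right_mono) auto
    also have "\<dots> = (cmod \<zeta> * \<rho>)\<^sup>2" by (simp add: power_mult_distrib)
    also have "\<dots> \<le> c\<^sup>2" using z that by (intro power_mono) auto
    finally show "cmod (of_real s * \<zeta>\<^sup>2) \<le> c\<^sup>2" .
  qed
  have notin: "1 - of_real s * \<zeta>\<^sup>2 \<notin> \<real>\<^sub>\<le>\<^sub>0" if "cmod (of_real s * \<zeta>\<^sup>2) \<le> c\<^sup>2" for s \<zeta>
  proof -
    have "c\<^sup>2 < 1" using c by (simp add: power_less_one_iff abs_square_less_1)
    then have "Re (of_real s * \<zeta>\<^sup>2) < 1" using complex_Re_le_cmod[of "of_real s * \<zeta>\<^sup>2"] that by linarith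
    then show ?thesis by (auto simp: complex_nonpos_Reals_iff)
  qed
  have holo: "(\<lambda>\<zeta>. gauss \<nu> x * heat_gen \<nu> x s y \<zeta>) holomorphic_on {\<zeta>. 1 - of_real s * \<zeta>\<^sup>2 \<notin> \<real>\<^sub>\<le>\<^sub>0}"
    for x y :: "real^'n" and s
    unfolding heat_gen_def using nz by (intro holomorphic_intros) auto
  have fps: "(\<lambda>\<zeta>. gauss \<nu> x * heat_gen \<nu> x s y \<zeta>) has_fps_expansion fps_const (gauss \<nu> x) * Abs_fps (heat_coeff \<nu> x s y)"
    for x y :: "real^'n" and s
    by (intro fps_expansion_intros heat_gen_has_fps_expansion nz)
  show ?thesis
  proof (rule that[of c C "b0 / 2"])
    fix x y :: "real^'n" and s \<rho> :: real and k
    assume *: "0 \<le> s" "s \<le> \<rho>\<^sup>2" "norm y \<le> \<rho>" "0 < \<rho>"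
    define h where "h = (\<lambda>\<zeta>. gauss \<nu> x * heat_gen \<nu> x s y \<zeta>)"
    have sub: "(cball 0 (c / \<rho>) :: complex set) \<subseteq> {\<zeta>. 1 - of_real s * \<zeta>\<^sup>2 \<notin> \<real>\<^sub>\<le>\<^sub>0}"
      using small[OF *] notin by auto
    have hol: "h holomorphic_on cball 0 (c / \<rho>)"
      unfolding h_def by (rule holomorphic_on_subset[OF holo sub])
    have "gauss \<nu> x * heat_coeff \<nu> x s y k = (deriv ^^ k) h 0 / fact k"
      using fps_nth_fps_expansion[OF fps[of x s y], of k] by (simp add: h_def)
    also have "cmod \<dots> \<le> (fact k * (C * exp (- (b0 / 2) * (norm x)\<^sup>2)) / (c / \<rho>) ^ k) / fact k"
      unfolding norm_divide norm_fact
    proof (intro divide_right_mono Cauchy_inequality)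
      show "h holomorphic_on ball 0 (c / \<rho>)" using hol by (rule holomorphic_on_subset) auto
      show "continuous_on (cball 0 (c / \<rho>)) h" using hol by (rule holomorphic_on_imp_continuous_on)
      show "0 < c / \<rho>" using c * by simp
      fix \<zeta> :: complex assume "norm (0 - \<zeta>) = c / \<rho>"
      then have "cmod \<zeta> \<le> c / \<rho>" by simp
      from small[OF * this] show "norm (h \<zeta>) \<le> C * exp (- (b0 / 2) * (norm x)\<^sup>2)"
        using heat_gen_bound[OF \<nu>, of s \<zeta> y x] unfolding h_def C_def b0_def c_def by simp
    qed simp
    finally show "cmod (gauss \<nu> x * heat_coeff \<nu> x s y k) \<le> C * exp (- (b0 / 2) * (norm x)\<^sup>2) * (\<rho> / c) ^ k"
      by (simp add: power_divide)
  next
    fix x y :: "real^'n" and s \<rho> :: real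
    assume *: "0 \<le> s" "s \<le> \<rho>\<^sup>2" "norm y \<le> \<rho>" "0 < \<rho>" and \<rho>: "\<rho> < c"
    have sub: "(eball 0 (ereal (c / \<rho>)) :: complex set) \<subseteq> {\<zeta>. 1 - of_real s * \<zeta>\<^sup>2 \<notin> \<real>\<^sub>\<le>\<^sub>0}"
      using small[OF *] notin by auto
    have "(\<lambda>k. fps_nth (fps_const (gauss \<nu> x) * Abs_fps (heat_coeff \<nu> x s y)) k * 1 ^ k) sums (gauss \<nu> x * heat_gen \<nu> x s y 1)"
      by (rule has_fps_expansion_imp_sums_complex[OF fps holomorphic_on_subset[OF holo sub]])
         (use * \<rho> in \<open>auto simp: one_ereal_def\<close>)
    moreover have "s < 1"
    proof -
      have "\<rho>\<^sup>2 < 1" using \<rho> c * by (simp add: abs_square_less_1)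
      then show ?thesis using * by simp
    qed
    ultimately show "(\<lambda>k. gauss \<nu> x * heat_coeff \<nu> x s y k) sums gauss (of_real (1 - s) * \<nu>) (x - y)"
      using gauss_eq_heat_gen[OF nz, of s x y] by simp
  qed (use c C b0 in auto)
qed

lemma cmod_gauss:
  fixes x :: "real ^ 'n"
  assumes "\<nu> \<noteq> 0" "0 < t"
  shows "cmod (gauss (of_real t * \<nu>) x) = cmod ((of_real (4 * pi) * \<nu>) powr (- of_nat CARD('n) / 2)) *
    t powr (- real CARD('n) / 2) * exp (- Re (1 / (4 * \<nu>)) * (norm x)\<^sup>2 / t)"
proof -
  have "Ln (of_real (4 * pi) * (of_real t * \<nu>)) = Ln (of_real t * (of_real (4 * pi) * \<nu>))"
    by (simp add: mult_ac)
  also have "\<dots> = of_real (ln t) + Ln (of_real (4 * pi) * \<nu>)"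
    using assms by (subst Ln_times_of_real) (auto simp: Ln_of_real simp del: of_real_diff)
  finally have "(of_real (4 * pi) * (of_real t * \<nu>)) powr (- of_nat CARD('n) / 2) =
      of_real (t powr (- real CARD('n) / 2)) * (of_real (4 * pi) * \<nu>) powr (- of_nat CARD('n) / 2)"
    using assms by (simp add: powr_def exp_add[symmetric] algebra_simps add_divide_distrib flip: exp_of_real)
  moreover have "Re (- of_real ((norm x)\<^sup>2) / (4 * (of_real t * \<nu>))) = - Re (1 / (4 * \<nu>)) * (norm x)\<^sup>2 / t"
  proof -
    have "- of_real ((norm x)\<^sup>2) / (4 * (of_real t * \<nu>)) = of_real (- (norm x)\<^sup>2 / t) * (1 / (4 * \<nu>))"
      using assms by simp
    then show ?thesis
      by (simp only: times_complex.sel Re_complex_of_real Im_complex_of_real mult_zero_left diff_zero) simp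
  qed
  ultimately show ?thesis
    unfolding gauss_def norm_mult norm_exp_eq_Re by (simp add: norm_mult)
qed

text \<open>Replacing the kernel by 0 for s \<ge> 1/2 keeps 1 - s away from the singularity. If
  \<rho> \<le> c/2, then s < 1/2 and the Taylor tail is dominated by a geometric series of ratio
  1/2, which gains \<rho>^{m+1}. If \<rho> > c/2, nothing cancels: kernel and polynomial are bounded
  one by one, and 1 \<le> 2 \<rho> / c supplies the missing powers of \<rho>.\<close>

lemma heat_remainder_bound:
  assumes \<nu>: "Re \<nu> > 0"
  obtains C a where "0 < C" "0 < a"
    "\<And>(x::real^'n) y s \<rho>. 0 \<le> s \<Longrightarrow> s \<le> \<rho>\<^sup>2 \<Longrightarrow> norm y \<le> \<rho> \<Longrightarrow> 0 < \<rho> \<Longrightarrow>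
       cmod ((if s < 1 / 2 then gauss (of_real (1 - s) * \<nu>) (x - y) else 0) - gauss \<nu> x * heat_taylor \<nu> m x s y)
       \<le> C * \<rho> ^ m * min 1 \<rho> * (exp (- a * (norm x)\<^sup>2) + exp (- a * (norm (x - y))\<^sup>2))"
proof -
  have nz: "\<nu> \<noteq> 0" using \<nu> by auto
  from heat_coeff_bound[OF \<nu>, where 'n = 'n] obtain c C b where c: "0 < c" "c \<le> 1" and C: "0 < C" and b: "0 < b"
    and coeff: "\<And>(x::real^'n) y s \<rho> k. 0 \<le> s \<Longrightarrow> s \<le> \<rho>\<^sup>2 \<Longrightarrow> norm y \<le> \<rho> \<Longrightarrow> 0 < \<rho> \<Longrightarrow>
       cmod (gauss \<nu> x * heat_coeff \<nu> x s y k) \<le> C * exp (- b * (norm x)\<^sup>2) * (\<rho> / c) ^ k"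
    and sums: "\<And>(x::real^'n) y s \<rho>. 0 \<le> s \<Longrightarrow> s \<le> \<rho>\<^sup>2 \<Longrightarrow> norm y \<le> \<rho> \<Longrightarrow> 0 < \<rho> \<Longrightarrow> \<rho> < c \<Longrightarrow>
       (\<lambda>k. gauss \<nu> x * heat_coeff \<nu> x s y k) sums gauss (of_real (1 - s) * \<nu>) (x - y)"
    by blast
  define B where "B = Re (1 / (4 * \<nu>))"
  have B: "0 < B" unfolding B_def using \<nu> by (rule Re_quarter_inverse_pos)
  define G where "G = cmod ((of_real (4 * pi) * \<nu>) powr (- of_nat CARD('n) / 2)) * 2 ^ CARD('n)"
  have G: "0 < G" using nz by (simp add: G_def powr_def)
  define a where "a = min b B"
  have a: "0 < a" "a \<le> b" "a \<le> B" using b B by (auto simp: a_def)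
  \<comment> \<open>One summand for each of the two regimes of \<rho>.\<close>
  define D where "D = 2 * C * (1 / c) ^ Suc m + (real (Suc m) * C + G) * (2 / c) ^ m * (2 / c)"
  have D: "0 < D" unfolding D_def using c C G by (intro add_pos_pos mult_pos_pos zero_less_power) auto
  show ?thesis
  proof (rule that[of D a])
    fix x y :: "real^'n" and s \<rho> :: real
    assume *: "0 \<le> s" "s \<le> \<rho>\<^sup>2" "norm y \<le> \<rho>" "0 < \<rho>"
    define E where "E = exp (- a * (norm x)\<^sup>2) + exp (- a * (norm (x - y))\<^sup>2)"
    have E0: "0 \<le> E" by (simp add: E_def)
    define A where "A k = gauss \<nu> x * heat_coeff \<nu> x s y k" for k
    have taylor: "gauss \<nu> x * heat_taylor \<nu> m x s y = (\<Sum>k\<le>m. A k)"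
      unfolding sum_heat_coeff[OF nz, symmetric] A_def by (simp add: sum_distrib_left)
    have Ak: "cmod (A k) \<le> C * E * (\<rho> / c) ^ k" for k
    proof -
      have "exp (- b * (norm x)\<^sup>2) \<le> exp (- a * (norm x)\<^sup>2)" using a by (simp add: mult_right_mono)
      also have "\<dots> \<le> E" by (simp add: E_def)
      finally have "C * exp (- b * (norm x)\<^sup>2) * (\<rho> / c) ^ k \<le> C * E * (\<rho> / c) ^ k"
        using C c * by (intro mult_right_mono mult_left_mono) auto
      with coeff[OF *, of x k] show ?thesis by (simp add: A_def)
    qed
    show "cmod ((if s < 1 / 2 then gauss (of_real (1 - s) * \<nu>) (x - y) else 0) - gauss \<nu> x * heat_taylor \<nu> m x s y)
       \<le> D * \<rho> ^ m * min 1 \<rho> * (exp (- a * (norm x)\<^sup>2) + exp (- a * (norm (x - y))\<^sup>2))"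
    proof (cases "\<rho> \<le> c / 2")
      case True
      then have r: "\<rho> < c" "\<rho> \<le> 1 / 2" "\<rho> / c \<le> 1 / 2" using c * by (auto simp: field_simps)
      have "\<rho>\<^sup>2 \<le> (1 / 2)\<^sup>2" using r * by (intro power_mono) auto
      then have s: "s < 1 / 2" using * by (simp add: power2_eq_square)
      have "(\<lambda>k. A (k + Suc m)) sums (gauss (of_real (1 - s) * \<nu>) (x - y) - (\<Sum>k<Suc m. A k))"
        using sums[OF * r(1), of x, folded A_def] sums_iff_shift[of A "Suc m"] by simp
      then have eq: "gauss (of_real (1 - s) * \<nu>) (x - y) - (\<Sum>k\<le>m. A k) = (\<Sum>k. A (k + Suc m))"
        by (simp add: sums_iff lessThan_Suc_atMost)
      have le: "cmod (A (k + Suc m)) \<le> C * E * (\<rho> / c) ^ Suc m * (1 / 2) ^ k" for k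
      proof -
        have "cmod (A (k + Suc m)) \<le> C * E * (\<rho> / c) ^ (k + Suc m)" by (rule Ak)
        also have "\<dots> = C * E * (\<rho> / c) ^ Suc m * (\<rho> / c) ^ k" by (simp add: power_add)
        also have "\<dots> \<le> C * E * (\<rho> / c) ^ Suc m * (1 / 2) ^ k"
          using C E0 c * r by (intro mult_left_mono power_mono) auto
        finally show ?thesis .
      qed
      have geo: "(\<lambda>k. C * E * (\<rho> / c) ^ Suc m * (1 / 2) ^ k) sums (C * E * (\<rho> / c) ^ Suc m * 2)"
        using sums_mult[OF geometric_sums[of "1 / 2 :: real"], of "C * E * (\<rho> / c) ^ Suc m"] by simp
      have "cmod (\<Sum>k. A (k + Suc m)) \<le> (\<Sum>k. C * E * (\<rho> / c) ^ Suc m * (1 / 2) ^ k)"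
        by (rule norm_suminf_le[OF le sums_summable[OF geo]])
      also have "\<dots> = C * E * (\<rho> / c) ^ Suc m * 2" using geo by (rule sums_unique[symmetric])
      also have "\<dots> = (2 * C * (1 / c) ^ Suc m) * (\<rho> ^ m * min 1 \<rho> * E)"
        using r by (simp add: power_divide)
      also have "\<dots> \<le> D * (\<rho> ^ m * min 1 \<rho> * E)"
        using C G c * E0 by (intro mult_right_mono) (auto simp: D_def)
      finally show ?thesis unfolding taylor using s eq by (simp add: E_def mult.assoc)
    next
      case False
      then have r: "1 \<le> 2 / c * \<rho>" using c * by (simp add: field_simps)
      have Am: "cmod (A k) \<le> C * E * (2 / c * \<rho>) ^ m" if "k \<le> m" for k
      proof -
        have "(\<rho> / c) ^ k \<le> (2 / c * \<rho>) ^ k" using c * by (intro power_mono) (auto simp: field_simps)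
        also have "\<dots> \<le> (2 / c * \<rho>) ^ m" using r that by (intro power_increasing)
        finally have "C * E * (\<rho> / c) ^ k \<le> C * E * (2 / c * \<rho>) ^ m" using C E0 by (intro mult_left_mono) auto
        with Ak[of k] show ?thesis by simp
      qed
      have "cmod (\<Sum>k\<le>m. A k) \<le> (\<Sum>k\<le>m. C * E * (2 / c * \<rho>) ^ m)"
        by (rule sum_norm_le) (use Am in auto)
      then have S: "cmod (\<Sum>k\<le>m. A k) \<le> real (Suc m) * C * E * (2 / c * \<rho>) ^ m" by (simp add: mult.assoc)
      have "cmod (if s < 1 / 2 then gauss (of_real (1 - s) * \<nu>) (x - y) else 0) \<le> G * E"
      proof (cases "s < 1 / 2")
        case True
        have "cmod (gauss (of_real (1 - s) * \<nu>) (x - y)) = cmod ((of_real (4 * pi) * \<nu>) powr (- of_nat CARD('n) / 2)) *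
            (1 - s) powr (- real CARD('n) / 2) * exp (- B * (norm (x - y))\<^sup>2 / (1 - s))"
          unfolding B_def using True nz by (intro cmod_gauss) auto
        also have "\<dots> \<le> cmod ((of_real (4 * pi) * \<nu>) powr (- of_nat CARD('n) / 2)) * 2 ^ CARD('n) * exp (- a * (norm (x - y))\<^sup>2)"
        proof (intro mult_mono mult_left_mono)
          have "(1 - s) powr (- real CARD('n) / 2) \<le> (1 / 2) powr (- real CARD('n) / 2)"
            using True by (intro powr_mono2') auto
          also have "\<dots> = 2 powr (real CARD('n) / 2)" by (simp add: powr_minus powr_divide)
          also have "\<dots> \<le> 2 powr real CARD('n)" by simp
          finally show "(1 - s) powr (- real CARD('n) / 2) \<le> 2 ^ CARD('n)" by (simp add: powr_realpow)
          have "a * (norm (x - y))\<^sup>2 \<le> B * (norm (x - y))\<^sup>2" using a by (intro mult_right_mono) auto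
          also have "\<dots> \<le> B * (norm (x - y))\<^sup>2 / (1 - s)"
            using True * B by (simp add: le_divide_eq mult_left_le)
          finally show "exp (- B * (norm (x - y))\<^sup>2 / (1 - s)) \<le> exp (- a * (norm (x - y))\<^sup>2)" by simp
        qed auto
        also have "\<dots> \<le> G * E" unfolding G_def E_def by (intro mult_left_mono) auto
        finally show ?thesis using True by simp
      qed (use G E0 in auto)
      also have "\<dots> \<le> G * E * (2 / c * \<rho>) ^ m"
        using mult_left_mono[OF one_le_power[OF r, of m], of "G * E"] G E0 by simp
      finally have Gs: "cmod (if s < 1 / 2 then gauss (of_real (1 - s) * \<nu>) (x - y) else 0) \<le> G * E * (2 / c * \<rho>) ^ m" .
      have "cmod ((if s < 1 / 2 then gauss (of_real (1 - s) * \<nu>) (x - y) else 0) - (\<Sum>k\<le>m. A k))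
          \<le> G * E * (2 / c * \<rho>) ^ m + real (Suc m) * C * E * (2 / c * \<rho>) ^ m"
        using norm_triangle_le_diff[OF add_mono[OF Gs S]] .
      also have "\<dots> = (real (Suc m) * C + G) * (2 / c) ^ m * 1 * (\<rho> ^ m * E)"
        by (simp only: power_mult_distrib) (simp add: algebra_simps)
      also have "\<dots> \<le> (real (Suc m) * C + G) * (2 / c) ^ m * (2 / c * min 1 \<rho>) * (\<rho> ^ m * E)"
        using r c C G E0 * by (intro mult_right_mono mult_left_mono) (auto simp: min_def)
      also have "\<dots> = ((real (Suc m) * C + G) * (2 / c) ^ m * (2 / c)) * (\<rho> ^ m * min 1 \<rho> * E)"
        by (simp add: mult_ac)
      also have "\<dots> \<le> D * (\<rho> ^ m * min 1 \<rho> * E)"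
        using C G c * E0 by (intro mult_right_mono) (auto simp: D_def)
      finally show ?thesis unfolding taylor by (simp add: E_def mult.assoc)
    qed
  qed (use D a in auto)
qed

section \<open>The heat kernel in parabolic scaling\<close>

definition heat_kernel :: "complex \<Rightarrow> real \<Rightarrow> real ^ 'n \<Rightarrow> complex" where
  "heat_kernel \<nu> t z = of_real (t powr (- real CARD('n) / 2)) * gauss \<nu> ((t powr (- 1 / 2)) *\<^sub>R z)"

text \<open>In the form of \<open>heat_kernel\<close>, time enters only through real powers and a
  dilation, which makes joint measurability in (t, z) and the scaling of all bounds immediate. The
  two forms agree since a positive factor t splits off the principal logarithm.\<close>

lemma gauss_eq_heat_kernel:
  fixes z :: "real ^ 'n"
  assumes "\<nu> \<noteq> 0" "0 < t"
  shows "gauss (of_real t * \<nu>) z = heat_kernel \<nu> t z"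
proof -
  have "Ln (of_real (4 * pi) * (of_real t * \<nu>)) = Ln (of_real t * (of_real (4 * pi) * \<nu>))"
    by (simp add: mult_ac)
  also have "\<dots> = of_real (ln t) + Ln (of_real (4 * pi) * \<nu>)"
    using assms by (subst Ln_times_of_real) (auto simp: Ln_of_real simp del: of_real_diff)
  finally have "(of_real (4 * pi) * (of_real t * \<nu>)) powr (- of_nat CARD('n) / 2) =
      of_real (t powr (- real CARD('n) / 2)) * (of_real (4 * pi) * \<nu>) powr (- of_nat CARD('n) / 2)"
    using assms by (simp add: powr_def exp_add[symmetric] algebra_simps add_divide_distrib flip: exp_of_real)
  moreover have "(t powr (- 1 / 2))\<^sup>2 = 1 / t"
    using assms by (simp add: power2_eq_square powr_add[symmetric] powr_minus_divide)
  then have "- of_real ((norm z)\<^sup>2) / (4 * (of_real t * \<nu>)) = - of_real ((norm ((t powr (- 1 / 2)) *\<^sub>R z))\<^sup>2) / (4 * \<nu>)"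
    using assms by (simp add: power_mult_distrib)
  ultimately show ?thesis
    unfolding gauss_def heat_kernel_def by (simp add: mult.assoc)
qed

lemma continuous_on_gauss [continuous_intros]:
  assumes "\<nu> \<noteq> 0" "continuous_on S (h :: 'a::topological_space \<Rightarrow> real ^ 'n)"
  shows "continuous_on S (\<lambda>x. gauss \<nu> (h x))"
  unfolding gauss_def using assms by (intro continuous_intros) auto

lemma borel_measurable_heat_kernel [measurable (raw)]:
  fixes h :: "'a \<Rightarrow> real ^ 'n"
  assumes "g \<in> borel_measurable M" "h \<in> borel_measurable M"
  shows "(\<lambda>x. heat_kernel \<nu> (g x) (h x)) \<in> borel_measurable M"
proof (cases "\<nu> = 0")
  case False
  have "(\<lambda>z :: real^'n. gauss \<nu> z) \<in> borel_measurable borel"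
    using False by (intro borel_measurable_continuous_onI continuous_intros)
  from measurable_compose[OF _ this] assms show ?thesis
    unfolding heat_kernel_def by measurable
next
  case True
  then have "(\<lambda>x. heat_kernel \<nu> (g x) (h x)) = (\<lambda>x. 0)"
    by (simp add: heat_kernel_def gauss_def fun_eq_iff)
  then show ?thesis by simp
qed

lemma nn_integral_gaussian:
  fixes y :: "real ^ 'n"
  assumes "0 < a" "0 < t"
  shows "(\<integral>\<^sup>+x. ennreal (t powr (- real CARD('n) / 2) * exp (- a * (norm (x - y))\<^sup>2 / t)) \<partial>lborel) =
    ennreal ((pi / a) powr (real CARD('n) / 2))"
proof -
  \<comment> \<open>The variance t / (2a) makes the normal density proportional to the
    one-dimensional factor; the prefactor t^{-n/2} then leaves a total mass independent of
    t.\<close>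
  define \<sigma> where "\<sigma> = sqrt (t / (2 * a))"
  have \<sigma>: "0 < \<sigma>" "\<sigma>\<^sup>2 = t / (2 * a)" using assms by (simp_all add: \<sigma>_def)
  have one: "(\<integral>\<^sup>+x. ennreal (exp (- a * (x - c)\<^sup>2 / t)) \<partial>lborel) = ennreal (sqrt (pi * t / a))" for c :: real
  proof -
    have "(\<integral>\<^sup>+x. ennreal (exp (- a * (x - c)\<^sup>2 / t)) \<partial>lborel) =
       (\<integral>\<^sup>+x. ennreal (sqrt (pi * t / a)) * ennreal (normal_density c \<sigma> x) \<partial>lborel)"
      using assms unfolding normal_density_def \<sigma>(2)
      by (intro nn_integral_cong) (simp add: ennreal_mult[symmetric] field_simps)
    also have "\<dots> = ennreal (sqrt (pi * t / a)) * (\<integral>\<^sup>+x. ennreal (normal_density c \<sigma> x) \<partial>lborel)"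
      by (intro nn_integral_cmult) auto
    also have "(\<integral>\<^sup>+x. ennreal (normal_density c \<sigma> x) \<partial>lborel) = 1"
      using nn_integral_eq_integral[OF integrable_normal_density[OF \<sigma>(1), of c]] integral_normal_density[OF \<sigma>(1), of c]
      by simp
    finally show ?thesis by simp
  qed
  have "(\<integral>\<^sup>+x. ennreal (exp (- a * (norm (x - y))\<^sup>2 / t)) \<partial>lborel) =
     (\<integral>\<^sup>+x. (\<Prod>b\<in>Basis. ennreal (exp (- a * (x \<bullet> b - y \<bullet> b)\<^sup>2 / t))) \<partial>lborel)"
  proof (intro nn_integral_cong)
    fix x :: "real ^ 'n"
    have "(norm (x - y))\<^sup>2 = (\<Sum>b\<in>Basis. (x \<bullet> b - y \<bullet> b)\<^sup>2)"
      unfolding power2_norm_eq_inner by (subst euclidean_inner) (simp add: power2_eq_square inner_diff_left)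
    then have "- a * (norm (x - y))\<^sup>2 / t = (\<Sum>b\<in>Basis. - a * (x \<bullet> b - y \<bullet> b)\<^sup>2 / t)"
      by (simp only: sum_distrib_left sum_divide_distrib)
    then show "ennreal (exp (- a * (norm (x - y))\<^sup>2 / t)) = (\<Prod>b\<in>Basis. ennreal (exp (- a * (x \<bullet> b - y \<bullet> b)\<^sup>2 / t)))"
      by (simp only: exp_sum[OF finite_Basis]) (simp add: prod_ennreal)
  qed
  also have "\<dots> = (\<Prod>b\<in>Basis. \<integral>\<^sup>+x. ennreal (exp (- a * (x - y \<bullet> b)\<^sup>2 / t)) \<partial>lborel)"
    by (intro nn_integral_lborel_prod) auto
  also have "\<dots> = ennreal ((sqrt (pi * t / a)) ^ CARD('n))"
    unfolding one using assms by (simp add: ennreal_power)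
  finally have *: "(\<integral>\<^sup>+x. ennreal (exp (- a * (norm (x - y))\<^sup>2 / t)) \<partial>lborel) = ennreal ((sqrt (pi * t / a)) ^ CARD('n))" .
  have "(\<integral>\<^sup>+x. ennreal (t powr (- real CARD('n) / 2) * exp (- a * (norm (x - y))\<^sup>2 / t)) \<partial>lborel) =
      ennreal (t powr (- real CARD('n) / 2)) * ennreal ((sqrt (pi * t / a)) ^ CARD('n))"
    unfolding *[symmetric] by (subst nn_integral_cmult[symmetric]) (auto simp: ennreal_mult)
  also have "\<dots> = ennreal ((pi / a) powr (real CARD('n) / 2))"
  proof -
    have "(sqrt (pi * t / a)) ^ CARD('n) = (pi / a * t) powr (real CARD('n) / 2)"
      using assms by (simp add: powr_half_sqrt[symmetric] powr_realpow[symmetric] powr_powr)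
    also have "\<dots> = (pi / a) powr (real CARD('n) / 2) * t powr (real CARD('n) / 2)"
      using assms by (intro powr_mult)
    finally show ?thesis using assms by (simp add: ennreal_mult[symmetric] powr_minus field_simps)
  qed
  finally show ?thesis .
qed

lemma power_le_fact_exp: "0 \<le> v \<Longrightarrow> v ^ m \<le> fact m * exp (v :: real)"
proof -
  assume "0 \<le> v"
  have "(\<Sum>k\<in>{m}. v ^ k /\<^sub>R fact k) \<le> exp v"
    unfolding exp_def by (rule sum_le_suminf) (use \<open>0 \<le> v\<close> summable_exp_generic[of v] in \<open>auto simp: divide_inverse mult.commute\<close>)
  then show ?thesis by (simp add: field_simps)
qed

text \<open>Half of the Gaussian exponent is spent on the factor |z|^m: with r = |z| / t^{1/2}, the
  product r^m exp(-B r^2) is at most a multiple of exp(-B r^2 / 2), and |z|^m = t^{m/2} r^m accounts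
  for the power of t.\<close>

lemma heat_kernel_bound:
  assumes "Re \<nu> > 0"
  obtains C b where "0 < C" "0 < b"
    "\<And>t (z :: real^'n). 0 < t \<Longrightarrow> cmod (heat_kernel \<nu> t z) \<le> C * (t powr (- real CARD('n) / 2) * exp (- b * (norm z)\<^sup>2 / t))"
    "\<And>t (z :: real^'n). 0 < t \<Longrightarrow> (norm z) ^ m * cmod (heat_kernel \<nu> t z) \<le>
       C * t powr (real m / 2) * (t powr (- real CARD('n) / 2) * exp (- b * (norm z)\<^sup>2 / t))"
proof -
  have nz: "\<nu> \<noteq> 0" using assms by auto
  define B where "B = Re (1 / (4 * \<nu>))"
  have B: "0 < B" unfolding B_def using assms by (rule Re_quarter_inverse_pos)
  define G where "G = cmod ((of_real (4 * pi) * \<nu>) powr (- of_nat CARD('n) / 2))"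
  have G: "0 < G" using nz by (simp add: G_def powr_def)
  define D where "D = 1 + (2 / B) ^ m * fact m"
  have D: "1 \<le> D" using B by (simp add: D_def)
  have eq: "cmod (heat_kernel \<nu> t z) = G * (t powr (- real CARD('n) / 2) * exp (- B * (norm z)\<^sup>2 / t))"
    if "0 < t" for t :: real and z :: "real^'n"
    using cmod_gauss[OF nz that, of z] gauss_eq_heat_kernel[OF nz that, of z] by (simp add: G_def B_def)
  have le: "exp (- B * (norm z)\<^sup>2 / t) \<le> exp (- (B / 2) * (norm z)\<^sup>2 / t)" if "0 < t" for t :: real and z :: "real^'n"
    unfolding exp_le_cancel_iff using that B by (intro divide_right_mono mult_right_mono) auto
  show ?thesis
  proof (rule that[of "G * D" "B / 2"])
    fix t :: real and z :: "real^'n" assume t: "0 < t"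
    have "cmod (heat_kernel \<nu> t z) \<le> G * (t powr (- real CARD('n) / 2) * exp (- (B / 2) * (norm z)\<^sup>2 / t))"
      unfolding eq[OF t] using le[OF t] G by (intro mult_left_mono) auto
    also have "\<dots> \<le> D * (G * (t powr (- real CARD('n) / 2) * exp (- (B / 2) * (norm z)\<^sup>2 / t)))"
      using mult_right_mono[OF D, of "G * (t powr (- real CARD('n) / 2) * exp (- (B / 2) * (norm z)\<^sup>2 / t))"] G by simp
    finally show "cmod (heat_kernel \<nu> t z) \<le> G * D * (t powr (- real CARD('n) / 2) * exp (- (B / 2) * (norm z)\<^sup>2 / t))"
      by (simp add: mult_ac)
    define r where "r = norm z / sqrt t"
    have r: "norm z = sqrt t * r" "0 \<le> r" using t by (auto simp: r_def)
    have r2: "(norm z)\<^sup>2 / t = r\<^sup>2" using t by (simp add: r_def power_divide)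
    \<comment> \<open>Passing to (r^2)^m lets odd m, too, be handled by the exponential series in
      r^2.\<close>
    have "r ^ m \<le> 1 + (r\<^sup>2) ^ m"
    proof (cases "r \<le> 1")
      case True
      then have "r ^ m \<le> 1" using r by (simp add: power_le_one)
      then show ?thesis by (simp add: add_increasing2)
    next
      case False
      then have "r ^ m \<le> (r\<^sup>2) ^ m" using r by (intro power_mono) (auto simp: power2_eq_square)
      then show ?thesis by simp
    qed
    also have "(r\<^sup>2) ^ m = (2 / B) ^ m * (B / 2 * r\<^sup>2) ^ m"
      using B by (simp flip: power_mult_distrib)
    also have "1 + \<dots> \<le> exp (B / 2 * r\<^sup>2) + (2 / B) ^ m * (fact m * exp (B / 2 * r\<^sup>2))"
      using B by (intro add_mono mult_left_mono power_le_fact_exp) auto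
    also have "\<dots> = D * exp (B / 2 * r\<^sup>2)" by (simp add: D_def algebra_simps)
    finally have rm: "r ^ m \<le> D * exp (B / 2 * r\<^sup>2)" .
    have "r ^ m * exp (- B * r\<^sup>2) \<le> D * exp (B / 2 * r\<^sup>2) * exp (- B * r\<^sup>2)"
      using rm by (intro mult_right_mono) auto
    also have "\<dots> = D * exp (- (B / 2) * r\<^sup>2)" by (simp add: exp_add[symmetric] mult.assoc)
    finally have *: "r ^ m * exp (- B * r\<^sup>2) \<le> D * exp (- (B / 2) * r\<^sup>2)" .
    have tm: "sqrt t ^ m = t powr (real m / 2)"
      using t by (simp add: powr_half_sqrt[symmetric] powr_realpow[symmetric] powr_powr)
    have "(norm z) ^ m * cmod (heat_kernel \<nu> t z) =
        G * t powr (real m / 2) * t powr (- real CARD('n) / 2) * (r ^ m * exp (- B * r\<^sup>2))"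
      unfolding eq[OF t] r2[symmetric] unfolding r(1) power_mult_distrib tm by simp
    also have "\<dots> \<le> G * t powr (real m / 2) * t powr (- real CARD('n) / 2) * (D * exp (- (B / 2) * r\<^sup>2))"
      using * G by (intro mult_left_mono) auto
    also have "\<dots> = G * D * t powr (real m / 2) * (t powr (- real CARD('n) / 2) * exp (- (B / 2) * (norm z)\<^sup>2 / t))"
      unfolding r2[symmetric] by (simp add: mult_ac)
    finally show "(norm z) ^ m * cmod (heat_kernel \<nu> t z) \<le>
       G * D * t powr (real m / 2) * (t powr (- real CARD('n) / 2) * exp (- (B / 2) * (norm z)\<^sup>2 / t))" .
  qed (use G D B in auto)
qed

text \<open>What the profile at time t integrates against the source at (s, y); the value s = 0
  serves the initial data.\<close>

definition profile_kernel :: "complex \<Rightarrow> nat \<Rightarrow> real \<Rightarrow> real ^ 'n \<Rightarrow> real \<Rightarrow> real ^ 'n \<Rightarrow> complex" where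
  "profile_kernel \<nu> m t x s y = of_real (t powr (- real CARD('n) / 2)) *
     (gauss \<nu> ((t powr (- 1 / 2)) *\<^sub>R x) * heat_taylor \<nu> m ((t powr (- 1 / 2)) *\<^sub>R x) (s / t) ((t powr (- 1 / 2)) *\<^sub>R y))"

lemma profile_kernel_remainder:
  assumes \<nu>: "Re \<nu> > 0"
  obtains C a where "0 < C" "0 < a"
    "\<And>t (x::real^'n) y s w. 0 < t \<Longrightarrow> 0 \<le> s \<Longrightarrow> sqrt s \<le> w \<Longrightarrow> norm y \<le> w \<Longrightarrow> 0 < w \<Longrightarrow>
       cmod ((if s < t / 2 then heat_kernel \<nu> (t - s) (x - y) else 0) - profile_kernel \<nu> m t x s y)
       \<le> C * t powr (- real m / 2) * (w ^ m * min 1 (t powr (- 1 / 2) * w)) *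
         (t powr (- real CARD('n) / 2) * (exp (- a * (norm x)\<^sup>2 / t) + exp (- a * (norm (x - y))\<^sup>2 / t)))"
proof -
  have nz: "\<nu> \<noteq> 0" using \<nu> by auto
  from heat_remainder_bound[OF \<nu>, where 'n = 'n and m = m] obtain C a where Ca: "0 < C" "0 < a"
    and bound: "\<And>(x::real^'n) y s \<rho>. 0 \<le> s \<Longrightarrow> s \<le> \<rho>\<^sup>2 \<Longrightarrow> norm y \<le> \<rho> \<Longrightarrow> 0 < \<rho> \<Longrightarrow>
       cmod ((if s < 1 / 2 then gauss (of_real (1 - s) * \<nu>) (x - y) else 0) - gauss \<nu> x * heat_taylor \<nu> m x s y)
       \<le> C * \<rho> ^ m * min 1 \<rho> * (exp (- a * (norm x)\<^sup>2) + exp (- a * (norm (x - y))\<^sup>2))"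
    by blast
  show ?thesis
  proof (rule that[OF Ca])
    fix t s w :: real and x y :: "real^'n"
    assume t: "0 < t" and s: "0 \<le> s" "sqrt s \<le> w" and y: "norm y \<le> w" and w: "0 < w"
    define \<theta> where "\<theta> = t powr (- 1 / 2)"
    have \<theta>: "0 < \<theta>" using t by (simp add: \<theta>_def)
    have \<theta>2: "\<theta>\<^sup>2 = 1 / t" using t by (simp add: \<theta>_def power2_eq_square powr_add[symmetric] powr_minus_divide)
    have s2: "s / t \<le> (\<theta> * w)\<^sup>2"
    proof -
      have "s \<le> w\<^sup>2" using s power_mono[of "sqrt s" w 2] by simp
      then show ?thesis using t by (simp add: power_mult_distrib \<theta>2 divide_right_mono)
    qed
    have sc: "(norm (\<theta> *\<^sub>R z))\<^sup>2 = (norm z)\<^sup>2 / t" for z :: "real^'n" by (simp add: power_mult_distrib \<theta>2)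
    have k: "heat_kernel \<nu> (t - s) (x - y) = of_real (t powr (- real CARD('n) / 2)) * gauss (of_real (1 - s / t) * \<nu>) (\<theta> *\<^sub>R x - \<theta> *\<^sub>R y)"
      if "s < t / 2"
    proof -
      have nz': "of_real (1 - s / t) * \<nu> \<noteq> 0"
        unfolding mult_eq_0_iff of_real_eq_0_iff using that s t nz by (auto simp: field_simps)
      have "heat_kernel \<nu> (t - s) (x - y) = gauss (of_real (t - s) * \<nu>) (x - y)"
        using that s by (subst gauss_eq_heat_kernel[OF nz]) auto
      also have "of_real (t - s) * \<nu> = of_real t * (of_real (1 - s / t) * \<nu>)"
        using t by (simp add: field_simps)
      also have "gauss \<dots> (x - y) = heat_kernel (of_real (1 - s / t) * \<nu>) t (x - y)"
        by (rule gauss_eq_heat_kernel[OF nz' t])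
      finally show ?thesis by (simp add: heat_kernel_def \<theta>_def scaleR_diff_right)
    qed
    have eq: "(if s < t / 2 then heat_kernel \<nu> (t - s) (x - y) else 0) - profile_kernel \<nu> m t x s y =
      of_real (t powr (- real CARD('n) / 2)) * ((if s / t < 1 / 2 then gauss (of_real (1 - s / t) * \<nu>) (\<theta> *\<^sub>R x - \<theta> *\<^sub>R y) else 0)
         - gauss \<nu> (\<theta> *\<^sub>R x) * heat_taylor \<nu> m (\<theta> *\<^sub>R x) (s / t) (\<theta> *\<^sub>R y))"
    proof -
      have "s < t / 2 \<longleftrightarrow> s / t < 1 / 2" using t by (simp add: field_simps)
      then show ?thesis using k by (simp add: profile_kernel_def \<theta>_def right_diff_distrib)
    qed
    have "cmod ((if s < t / 2 then heat_kernel \<nu> (t - s) (x - y) else 0) - profile_kernel \<nu> m t x s y)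
       \<le> t powr (- real CARD('n) / 2) * (C * (\<theta> * w) ^ m * min 1 (\<theta> * w) *
          (exp (- a * (norm (\<theta> *\<^sub>R x))\<^sup>2) + exp (- a * (norm (\<theta> *\<^sub>R x - \<theta> *\<^sub>R y))\<^sup>2)))"
      unfolding eq norm_mult norm_of_real abs_of_nonneg[OF powr_ge_zero]
      using s s2 y w \<theta> t by (intro mult_left_mono bound) auto
    also have "(\<theta> * w) ^ m = t powr (- real m / 2) * w ^ m"
      using t by (simp add: power_mult_distrib \<theta>_def powr_realpow[symmetric] powr_powr)
    also have "(norm (\<theta> *\<^sub>R x - \<theta> *\<^sub>R y))\<^sup>2 = (norm (x - y))\<^sup>2 / t"
      using sc[of "x - y"] by (simp add: scaleR_diff_right)
    finally show "cmod ((if s < t / 2 then heat_kernel \<nu> (t - s) (x - y) else 0) - profile_kernel \<nu> m t x s y)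
       \<le> C * t powr (- real m / 2) * (w ^ m * min 1 (t powr (- 1 / 2) * w)) *
         (t powr (- real CARD('n) / 2) * (exp (- a * (norm x)\<^sup>2 / t) + exp (- a * (norm (x - y))\<^sup>2 / t)))"
      unfolding sc \<theta>_def[symmetric] by (simp add: mult_ac)
  qed
qed

section \<open>Bochner integrals and jointly measurable representatives\<close>

lemma sigma_finite_lebesgue: "sigma_finite_measure (lebesgue :: 'a::euclidean_space measure)"
proof
  from lborel.sigma_finite_countable[where 'a = 'a] obtain A :: "'a set set" where
    A: "countable A" "A \<subseteq> sets lborel" "\<Union>A = space lborel" "\<forall>a\<in>A. emeasure lborel a \<noteq> \<infinity>"
    by auto
  then show "\<exists>A::'a set set. countable A \<and> A \<subseteq> sets lebesgue \<and> \<Union>A = space lebesgue \<and> (\<forall>a\<in>A. emeasure lebesgue a \<noteq> \<infinity>)"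
    by (intro exI[of _ A]) (auto simp: subset_iff)
qed

interpretation lebesgue: sigma_finite_measure "lebesgue :: 'a::euclidean_space measure"
  by (rule sigma_finite_lebesgue)

lemma sigma_finite_lebesgue_on:
  "S \<in> sets lebesgue \<Longrightarrow> sigma_finite_measure (lebesgue_on (S :: 'a::euclidean_space set))"
  by (rule sigma_finite_measure_restrict_space[OF sigma_finite_lebesgue])

lemma Lq_norm_1: "Lq_norm 1 \<phi> = (\<integral>\<^sup>+ x. ennreal (cmod (\<phi> x)) \<partial>lebesgue)"
  by (simp add: Lq_norm_def Let_def less_top[symmetric] ennreal_enn2real)

lemma in_Lq_1_iff: "\<phi> \<in> Lq 1 \<longleftrightarrow> integrable lebesgue \<phi>"
  by (auto simp: normed_fun_space_def Lq_norm_1 integrable_iff_bounded)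

context
  fixes M :: "'s measure" and \<sigma> :: "'s \<Rightarrow> 'a::euclidean_space \<Rightarrow> complex"
  assumes M: "sigma_finite_measure M"
    and simple: "simple_function M \<sigma>" and range: "\<sigma> ` space M \<subseteq> Lq 1"
    and supp: "emeasure M {s \<in> space M. \<sigma> s \<noteq> (\<lambda>_. 0)} < \<infinity>"
begin

lemma simple_fun_expand:
  assumes "s \<in> space M"
  shows "\<sigma> s x = (\<Sum>\<phi>\<in>\<sigma> ` space M. indicator {s \<in> space M. \<sigma> s = \<phi>} s * \<phi> x)"
proof -
  have "(\<Sum>\<phi>\<in>\<sigma> ` space M. indicator {s \<in> space M. \<sigma> s = \<phi>} s * \<phi> x) =
      (\<Sum>\<phi>\<in>{\<sigma> s}. indicator {s \<in> space M. \<sigma> s = \<phi>} s * \<phi> x)"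
    using assms simple_functionD(1)[OF simple]
    by (intro sum.mono_neutral_right) (auto simp: indicator_def)
  then show ?thesis using assms by simp
qed

lemma simple_fun_level_measurable: "{s \<in> space M. \<sigma> s = \<phi>} \<in> sets M"
proof -
  have "{s \<in> space M. \<sigma> s = \<phi>} = \<sigma> -` {\<phi>} \<inter> space M" by auto
  then show ?thesis using simple_functionD(2)[OF simple, of "{\<phi>}"] by simp
qed

lemma simple_fun_level_finite: "\<phi> \<noteq> (\<lambda>_. 0) \<Longrightarrow> emeasure M {s \<in> space M. \<sigma> s = \<phi>} < \<infinity>"
proof -
  assume "\<phi> \<noteq> (\<lambda>_. 0)"
  have "{s \<in> space M. \<sigma> s \<noteq> (\<lambda>_. 0)} = space M - {s \<in> space M. \<sigma> s = (\<lambda>_. 0)}" by auto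
  then have "{s \<in> space M. \<sigma> s \<noteq> (\<lambda>_. 0)} \<in> sets M" using simple_fun_level_measurable by simp
  then have "emeasure M {s \<in> space M. \<sigma> s = \<phi>} \<le> emeasure M {s \<in> space M. \<sigma> s \<noteq> (\<lambda>_. 0)}"
    using \<open>\<phi> \<noteq> (\<lambda>_. 0)\<close> by (intro emeasure_mono) auto
  then show ?thesis using supp by (rule le_less_trans)
qed

text \<open>The set where \<sigma> is 0 may have infinite measure, so this value is treated apart.
  Every other level set has finite measure and gives the product of an integrable indicator in s and
  an L^1 function of x.\<close>

lemma simple_fun_integrable_pair: "integrable (M \<Otimes>\<^sub>M lebesgue) (\<lambda>(s, x). \<sigma> s x)"
proof -
  interpret M: sigma_finite_measure M by (rule M)
  interpret pair_sigma_finite M "lebesgue :: 'a measure" ..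
  have "integrable (M \<Otimes>\<^sub>M lebesgue) (\<lambda>z. \<Sum>\<phi>\<in>\<sigma> ` space M. indicator {s \<in> space M. \<sigma> s = \<phi>} (fst z) * \<phi> (snd z))"
  proof (rule Bochner_Integration.integrable_sum)
    fix \<phi> assume "\<phi> \<in> \<sigma> ` space M"
    then have "\<phi> \<in> Lq 1" using range by auto
    then have [measurable]: "\<phi> \<in> borel_measurable lebesgue" and fin: "(\<integral>\<^sup>+x. ennreal (cmod (\<phi> x)) \<partial>lebesgue) < \<infinity>"
      by (auto simp: normed_fun_space_def Lq_norm_1)
    note [measurable] = simple_fun_level_measurable[of \<phi>]
    show "integrable (M \<Otimes>\<^sub>M lebesgue) (\<lambda>z. indicator {s \<in> space M. \<sigma> s = \<phi>} (fst z) * \<phi> (snd z))"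
    proof (cases "\<phi> = (\<lambda>_. 0)")
      case False
      show ?thesis
      proof (rule integrableI_bounded)
        have "(\<integral>\<^sup>+z. ennreal (norm (indicator {s \<in> space M. \<sigma> s = \<phi>} (fst z) * \<phi> (snd z))) \<partial>(M \<Otimes>\<^sub>M lebesgue)) =
          (\<integral>\<^sup>+s. \<integral>\<^sup>+x. indicator {s \<in> space M. \<sigma> s = \<phi>} s * ennreal (cmod (\<phi> x)) \<partial>lebesgue \<partial>M)"
          by (subst lebesgue.nn_integral_fst[symmetric])
             (auto intro!: nn_integral_cong simp: norm_mult indicator_def)
        also have "\<dots> = emeasure M {s \<in> space M. \<sigma> s = \<phi>} * (\<integral>\<^sup>+x. ennreal (cmod (\<phi> x)) \<partial>lebesgue)"
          by (simp add: nn_integral_cmult nn_integral_multc)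
        also have "\<dots> < \<infinity>"
          using simple_fun_level_finite[OF False] fin by (simp add: ennreal_mult_less_top)
        finally show "(\<integral>\<^sup>+z. ennreal (norm (indicator {s \<in> space M. \<sigma> s = \<phi>} (fst z) * \<phi> (snd z))) \<partial>(M \<Otimes>\<^sub>M lebesgue)) < \<infinity>" .
      qed measurable
    qed simp
  qed
  moreover have "integrable (M \<Otimes>\<^sub>M lebesgue) (\<lambda>(s, x). \<sigma> s x) \<longleftrightarrow> integrable (M \<Otimes>\<^sub>M lebesgue)
      (\<lambda>z. \<Sum>\<phi>\<in>\<sigma> ` space M. indicator {s \<in> space M. \<sigma> s = \<phi>} (fst z) * \<phi> (snd z))"
    by (rule Bochner_Integration.integrable_cong) (auto simp: space_pair_measure simple_fun_expand)
  ultimately show ?thesis by simp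
qed

lemma simple_fun_integral_eq: "simple_fun_integral M \<sigma> x = (\<integral>s. \<sigma> s x \<partial>M)"
proof -
  have hbi: "has_bochner_integral M (\<lambda>s. indicator {s \<in> space M. \<sigma> s = \<phi>} s * \<phi> x)
      (of_real (measure M {s \<in> space M. \<sigma> s = \<phi>}) * \<phi> x)" for \<phi>
  proof (cases "\<phi> = (\<lambda>_. 0)")
    case False
    have "(\<lambda>s. indicator {s \<in> space M. \<sigma> s = \<phi>} s * \<phi> x) = (\<lambda>s. indicator {s \<in> space M. \<sigma> s = \<phi>} s *\<^sub>R \<phi> x)"
      by (auto simp: indicator_def fun_eq_iff)
    then show ?thesis
      using has_bochner_integral_indicator[OF simple_fun_level_measurable simple_fun_level_finite[OF False], of "\<phi> x"]
      by (simp add: scaleR_conv_of_real)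
  qed (simp add: has_bochner_integral_zero)
  have int: "integrable M (\<lambda>s. indicator {s \<in> space M. \<sigma> s = \<phi>} s * \<phi> x)" for \<phi>
    using hbi[of \<phi>] by (rule integrable.intros)
  have "(\<integral>s. \<sigma> s x \<partial>M) = (\<integral>s. (\<Sum>\<phi>\<in>\<sigma> ` space M. indicator {s \<in> space M. \<sigma> s = \<phi>} s * \<phi> x) \<partial>M)"
    by (intro Bochner_Integration.integral_cong refl simple_fun_expand)
  also have "\<dots> = (\<Sum>\<phi>\<in>\<sigma> ` space M. \<integral>s. indicator {s \<in> space M. \<sigma> s = \<phi>} s * \<phi> x \<partial>M)"
    by (intro Bochner_Integration.integral_sum int)
  also have "\<dots> = simple_fun_integral M \<sigma> x"
    unfolding simple_fun_integral_def
    by (intro sum.cong refl has_bochner_integral_integral_eq hbi)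
  finally show ?thesis by simp
qed

end

lemma nn_integral_norm_integral_le:
  fixes f :: "'a \<Rightarrow> 'b::{banach, second_countable_topology}"
  shows "ennreal (norm (integral\<^sup>L M f)) \<le> (\<integral>\<^sup>+x. ennreal (norm (f x)) \<partial>M)"
  by (cases "integrable M f") (auto intro: integral_norm_bound_ennreal simp: not_integrable_integral_eq)

text \<open>The bridge between the two notions of integral: L^1 distance on the product controls the
  L^1 distance of the partial integrals, because for almost every x both sections are
  integrable.\<close>

lemma (in pair_sigma_finite) nn_integral_norm_integral_diff_le:
  fixes f g :: "'a \<times> 'b \<Rightarrow> 'c::{banach, second_countable_topology}"
  assumes f: "integrable (M1 \<Otimes>\<^sub>M M2) f" and g: "integrable (M1 \<Otimes>\<^sub>M M2) g"
  shows "(\<integral>\<^sup>+x. ennreal (norm ((\<integral>s. g (s, x) \<partial>M1) - (\<integral>s. f (s, x) \<partial>M1))) \<partial>M2)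
    \<le> (\<integral>\<^sup>+z. ennreal (norm (f z - g z)) \<partial>(M1 \<Otimes>\<^sub>M M2))"
proof -
  have [measurable]: "f \<in> borel_measurable (M1 \<Otimes>\<^sub>M M2)" "g \<in> borel_measurable (M1 \<Otimes>\<^sub>M M2)"
    using f g by auto
  have "AE x in M2. integrable M1 (\<lambda>s. f (s, x)) \<and> integrable M1 (\<lambda>s. g (s, x))"
    using AE_integrable_snd[of "\<lambda>s x. f (s, x)"] AE_integrable_snd[of "\<lambda>s x. g (s, x)"] f g by auto
  then have "AE x in M2. ennreal (norm ((\<integral>s. g (s, x) \<partial>M1) - (\<integral>s. f (s, x) \<partial>M1))) \<le>
      (\<integral>\<^sup>+s. ennreal (norm (f (s, x) - g (s, x))) \<partial>M1)"
  proof (rule eventually_mono)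
    fix x assume "integrable M1 (\<lambda>s. f (s, x)) \<and> integrable M1 (\<lambda>s. g (s, x))"
    then have "norm ((\<integral>s. g (s, x) \<partial>M1) - (\<integral>s. f (s, x) \<partial>M1)) = norm (\<integral>s. f (s, x) - g (s, x) \<partial>M1)"
      by (simp add: norm_minus_commute)
    then show "ennreal (norm ((\<integral>s. g (s, x) \<partial>M1) - (\<integral>s. f (s, x) \<partial>M1))) \<le>
        (\<integral>\<^sup>+s. ennreal (norm (f (s, x) - g (s, x))) \<partial>M1)"
      by (simp add: nn_integral_norm_integral_le)
  qed
  then have "(\<integral>\<^sup>+x. ennreal (norm ((\<integral>s. g (s, x) \<partial>M1) - (\<integral>s. f (s, x) \<partial>M1))) \<partial>M2) \<le>
      (\<integral>\<^sup>+x. \<integral>\<^sup>+s. ennreal (norm (f (s, x) - g (s, x))) \<partial>M1 \<partial>M2)"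
    by (rule nn_integral_mono_AE)
  also have "\<dots> = (\<integral>\<^sup>+z. ennreal (norm (f z - g z)) \<partial>(M1 \<Otimes>\<^sub>M M2))"
    by (subst nn_integral_snd) auto
  finally show ?thesis .
qed

text \<open>The approximating simple functions converge to \<open>Fj\<close> in L^1 of the product
  measure, so their time integrals converge in L^1 to the pointwise integral of \<open>Fj\<close>.
  By definition they also converge to the Bochner integral, hence the two agree almost everywhere.
  Asking only that N dominates the L^1 norm covers both L^1 and its intersection with
  L^\<infinity>.\<close>

lemma has_fun_bochner_integral_pair:
  fixes F :: "'s \<Rightarrow> 'a::euclidean_space \<Rightarrow> complex" and Fj :: "'s \<times> 'a \<Rightarrow> complex"
  assumes M: "sigma_finite_measure M" and B: "has_fun_bochner_integral N M F w"
    and N: "\<And>\<phi>. Lq_norm 1 \<phi> \<le> N \<phi>"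
    and [measurable]: "Fj \<in> borel_measurable (M \<Otimes>\<^sub>M lebesgue)"
    and eq: "AE s in M. AE x in lebesgue. F s x = Fj (s, x)"
  shows "integrable (M \<Otimes>\<^sub>M lebesgue) Fj"
    and "AE x in lebesgue. w x = (\<integral>s. Fj (s, x) \<partial>M)"
proof -
  interpret M: sigma_finite_measure M by (rule M)
  interpret pair_sigma_finite M "lebesgue :: 'a measure" ..
  from B obtain \<sigma> where w: "w \<in> normed_fun_space N"
    and simple: "\<And>k. simple_function M (\<sigma> k)" and rg: "\<And>k. \<sigma> k ` space M \<subseteq> normed_fun_space N"
    and supp: "\<And>k. emeasure M {s \<in> space M. \<sigma> k s \<noteq> (\<lambda>_. 0)} < \<infinity>"
    and lim: "(\<lambda>k. \<integral>\<^sup>+ s. N (\<lambda>x. F s x - \<sigma> k s x) \<partial>M) \<longlonglongrightarrow> 0"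
    and limw: "(\<lambda>k. N (\<lambda>x. simple_fun_integral M (\<sigma> k) x - w x)) \<longlonglongrightarrow> 0"
    unfolding has_fun_bochner_integral_def by blast
  have sub: "normed_fun_space N \<subseteq> Lq 1"
    using N by (auto simp: normed_fun_space_def intro: le_less_trans)
  have rg1: "\<sigma> k ` space M \<subseteq> Lq 1" for k using rg sub by blast
  have [measurable]: "w \<in> borel_measurable lebesgue" using w by (simp add: normed_fun_space_def)
  define S where "S k = (\<lambda>(s, x). \<sigma> k s x)" for k
  have S: "integrable (M \<Otimes>\<^sub>M lebesgue) (S k)" for k
    unfolding S_def by (rule simple_fun_integrable_pair[OF M simple rg1 supp])
  then have [measurable]: "S k \<in> borel_measurable (M \<Otimes>\<^sub>M lebesgue)" for k by auto
  have SI: "simple_fun_integral M (\<sigma> k) x = (\<integral>s. S k (s, x) \<partial>M)" for k x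
    unfolding S_def by (simp add: simple_fun_integral_eq[OF M simple rg1 supp])
  define D where "D k = (\<integral>\<^sup>+ s. N (\<lambda>x. F s x - \<sigma> k s x) \<partial>M)" for k
  have D: "(\<integral>\<^sup>+z. ennreal (norm (Fj z - S k z)) \<partial>(M \<Otimes>\<^sub>M lebesgue)) \<le> D k" for k
  proof -
    have "(\<integral>\<^sup>+z. ennreal (norm (Fj z - S k z)) \<partial>(M \<Otimes>\<^sub>M lebesgue)) =
        (\<integral>\<^sup>+s. \<integral>\<^sup>+x. ennreal (norm (Fj (s, x) - S k (s, x))) \<partial>lebesgue \<partial>M)"
      by (subst lebesgue.nn_integral_fst[symmetric]) auto
    also have "\<dots> = (\<integral>\<^sup>+s. Lq_norm 1 (\<lambda>x. F s x - \<sigma> k s x) \<partial>M)"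
      unfolding Lq_norm_1 using eq
      by (intro nn_integral_cong_AE) (auto elim!: eventually_mono intro!: nn_integral_cong_AE simp: S_def)
    also have "\<dots> \<le> D k" unfolding D_def by (intro nn_integral_mono N)
    finally show ?thesis .
  qed
  have "\<forall>\<^sub>F k in sequentially. D k < 1"
    using lim unfolding D_def by (rule order_tendstoD) simp
  \<comment> \<open>One approximation at finite distance already gives integrability, since
    \<open>S k\<close> is integrable.\<close>
  then obtain k where k: "D k < 1" by (auto simp: eventually_sequentially)
  have "integrable (M \<Otimes>\<^sub>M lebesgue) (\<lambda>z. Fj z - S k z)"
    by (rule integrableI_bounded) (use D[of k] k in \<open>auto intro: le_less_trans less_trans[of _ 1]\<close>)
  from Bochner_Integration.integrable_add[OF this S[of k]]
  show int: "integrable (M \<Otimes>\<^sub>M lebesgue) Fj" by simp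
  define W where "W x = (\<integral>s. Fj (s, x) \<partial>M)" for x
  have [measurable]: "W \<in> borel_measurable lebesgue"
    unfolding W_def by measurable
  define I where "I k x = (\<integral>s. S k (s, x) \<partial>M)" for k x
  have [measurable]: "I k \<in> borel_measurable lebesgue" for k
    unfolding I_def by measurable
  have IW: "(\<integral>\<^sup>+x. ennreal (norm (I k x - W x)) \<partial>lebesgue) \<le> D k" for k
    unfolding I_def W_def using nn_integral_norm_integral_diff_le[OF int S[of k]] D[of k] by (rule order_trans)
  have "(\<integral>\<^sup>+x. ennreal (norm (w x - W x)) \<partial>lebesgue) \<le> N (\<lambda>x. simple_fun_integral M (\<sigma> k) x - w x) + D k" for k
  proof -
    have "(\<integral>\<^sup>+x. ennreal (norm (w x - W x)) \<partial>lebesgue) \<le>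
        (\<integral>\<^sup>+x. ennreal (norm (I k x - w x)) + ennreal (norm (I k x - W x)) \<partial>lebesgue)"
    proof (intro nn_integral_mono)
      fix x
      have "norm (w x - W x) \<le> norm (I k x - w x) + norm (I k x - W x)"
        using norm_triangle_ineq4[of "I k x - W x" "I k x - w x"] by simp
      then show "ennreal (norm (w x - W x)) \<le> ennreal (norm (I k x - w x)) + ennreal (norm (I k x - W x))"
        by (simp add: ennreal_plus[symmetric] del: ennreal_plus)
    qed
    also have "\<dots> = Lq_norm 1 (\<lambda>x. simple_fun_integral M (\<sigma> k) x - w x) + (\<integral>\<^sup>+x. ennreal (norm (I k x - W x)) \<partial>lebesgue)"
      unfolding Lq_norm_1 SI I_def[symmetric] by (rule nn_integral_add) auto
    also have "\<dots> \<le> N (\<lambda>x. simple_fun_integral M (\<sigma> k) x - w x) + D k"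
      by (intro add_mono N IW)
    finally show ?thesis .
  qed
  moreover have "(\<lambda>k. N (\<lambda>x. simple_fun_integral M (\<sigma> k) x - w x) + D k) \<longlonglongrightarrow> 0 + 0"
    unfolding D_def by (intro tendsto_add limw lim)
  ultimately have "(\<integral>\<^sup>+x. ennreal (norm (w x - W x)) \<partial>lebesgue) \<le> 0 + 0"
    by (intro LIMSEQ_le_const[of _ "0 + 0"]) auto
  then have "AE x in lebesgue. ennreal (norm (w x - W x)) = 0"
    by (subst nn_integral_0_iff_AE[symmetric]) auto
  then show "AE x in lebesgue. w x = (\<integral>s. Fj (s, x) \<partial>M)"
    by (auto elim!: eventually_mono simp: W_def)
qed

lemma borel_measurable_lebesgue_on_pair:
  fixes f :: "'a::euclidean_space \<times> 'b::euclidean_space \<Rightarrow> 'c::topological_space"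
  assumes "f \<in> borel_measurable borel"
  shows "f \<in> borel_measurable (lebesgue_on S \<Otimes>\<^sub>M lebesgue)"
proof -
  have 1: "(\<lambda>x. x) \<in> lebesgue_on S \<rightarrow>\<^sub>M (borel :: 'a measure)"
    by (intro measurable_restrict_space1 measurable_completion) simp
  have 2: "(\<lambda>x. x) \<in> lebesgue \<rightarrow>\<^sub>M (borel :: 'b measure)"
    by (intro measurable_completion) simp
  have "(\<lambda>z. (fst z, snd z)) \<in> lebesgue_on S \<Otimes>\<^sub>M lebesgue \<rightarrow>\<^sub>M (borel :: 'a measure) \<Otimes>\<^sub>M (borel :: 'b measure)"
    by (intro measurable_Pair measurable_compose[OF measurable_fst 1] measurable_compose[OF measurable_snd 2])
  then have "(\<lambda>z. f (fst z, snd z)) \<in> borel_measurable (lebesgue_on S \<Otimes>\<^sub>M lebesgue)"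
    using assms unfolding borel_prod by (rule measurable_compose)
  then show ?thesis by simp
qed

lemma Lq_norm_1_triangle:
  assumes "\<phi> \<in> borel_measurable lebesgue" "\<psi> \<in> borel_measurable lebesgue"
  shows "Lq_norm 1 (\<lambda>x. \<phi> x - \<psi> x) \<le> Lq_norm 1 \<phi> + Lq_norm 1 \<psi>"
proof -
  have "Lq_norm 1 (\<lambda>x. \<phi> x - \<psi> x) \<le> (\<integral>\<^sup>+x. ennreal (cmod (\<phi> x)) + ennreal (cmod (\<psi> x)) \<partial>lebesgue)"
    unfolding Lq_norm_1
    by (intro nn_integral_mono) (simp add: norm_triangle_ineq4 ennreal_plus[symmetric] del: ennreal_plus)
  also have "\<dots> = Lq_norm 1 \<phi> + Lq_norm 1 \<psi>"
    unfolding Lq_norm_1 using assms by (intro nn_integral_add) auto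
  finally show ?thesis .
qed

lemma Lq_norm_1_minus_commute: "Lq_norm 1 (\<lambda>x. \<phi> x - \<psi> x) = Lq_norm 1 (\<lambda>x. \<psi> x - \<phi> x)"
  by (simp add: Lq_norm_1 norm_minus_commute)

lemma emeasure_lebesgue_on_Ioc_finite: "emeasure (lebesgue_on {0::real..}) {0<..c} < \<infinity>"
  by (cases "0 \<le> c") (simp_all add: emeasure_restrict_space subset_iff)

text \<open>The approximants are step functions that sample H at the right end of each cell of
  length 1/(k+1) in (0, k+1]. Continuity gives convergence for each s > 0, and the majorant g gives
  dominated convergence. The sample lies up to one cell to the right of s, which is why g(s) has to
  bound H on all of [s, s + 1]. The limit is the pointwise integral of the Borel
  representative.\<close>

lemma has_fun_bochner_integral_L1_exists:
  fixes H :: "real \<Rightarrow> 'a::euclidean_space \<Rightarrow> complex" and Hj :: "real \<times> 'a \<Rightarrow> complex" and g :: "real \<Rightarrow> ennreal"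
  assumes Hj: "Hj \<in> borel_measurable borel"
    and eq: "\<And>s. 0 < s \<Longrightarrow> AE x in lebesgue. H s x = Hj (s, x)"
    and L1: "\<And>s. 0 < s \<Longrightarrow> H s \<in> Lq 1"
    and cont: "\<And>s. 0 < s \<Longrightarrow> ((\<lambda>r. Lq_norm 1 (\<lambda>x. H r x - H s x)) \<longlongrightarrow> 0) (at s)"
    and g: "\<And>s r. 0 < s \<Longrightarrow> s \<le> r \<Longrightarrow> r \<le> s + 1 \<Longrightarrow> Lq_norm 1 (H r) \<le> g s"
    and gm: "g \<in> borel_measurable borel" and gfin: "(\<integral>\<^sup>+s. g s \<partial>lebesgue_on {0..}) < \<infinity>"
  shows "\<exists>w. has_fun_bochner_integral (Lq_norm 1) (lebesgue_on {0..}) H w"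
proof -
  define M where "M = lebesgue_on {0::real..}"
  have sfM: "sigma_finite_measure M" unfolding M_def by (rule sigma_finite_lebesgue_on) simp
  interpret M: sigma_finite_measure M by (rule sfM)
  interpret pair_sigma_finite M "lebesgue :: 'a measure" ..
  have spM: "space M = {0..}" by (simp add: M_def)
  have idM: "(\<lambda>x. x) \<in> M \<rightarrow>\<^sub>M (borel :: real measure)"
    unfolding M_def by (intro measurable_restrict_space1 measurable_completion) simp
  have Hj'[measurable]: "Hj \<in> borel_measurable (M \<Otimes>\<^sub>M lebesgue)"
    unfolding M_def by (rule borel_measurable_lebesgue_on_pair[OF Hj])
  have gm'[measurable]: "g \<in> borel_measurable M" using measurable_compose[OF idM gm] by simp
  have pos: "AE s in M. 0 < s"
  proof -
    have "AE s in lebesgue. (s::real) \<noteq> 0" by (intro AE_completion AE_lborel_singleton)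
    then show ?thesis unfolding M_def
      by (subst AE_restrict_space_iff) (auto elim!: eventually_mono)
  qed
  \<comment> \<open>Index 0 marks the times outside (0, k + 1], where the step function is zero;
    inside, the ceiling is at least 1, so H is sampled at positive times only.\<close>
  define idx where "idx k s = (if 0 < s \<and> s \<le> real (Suc k) then nat \<lceil>real (Suc k) * s\<rceil> else 0)" for k :: nat and s :: real
  define \<sigma> where "\<sigma> k s = (if idx k s = 0 then (\<lambda>_. 0) else H (real (idx k s) / real (Suc k)))" for k s
  have idx_range: "idx k s \<le> Suc k * Suc k" for k s
  proof (cases "0 < s \<and> s \<le> real (Suc k)")
    case True
    then have "real (Suc k) * s \<le> real (Suc k * Suc k)"
      unfolding of_nat_mult by (intro mult_left_mono) auto
    then show ?thesis unfolding idx_def if_P[OF True] by (simp only: nat_ceiling_le_eq)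
  next
    case False
    show ?thesis unfolding idx_def if_not_P[OF False] by simp
  qed
  have idx_pos: "0 < idx k s" "s \<le> real (idx k s) / real (Suc k)" "real (idx k s) / real (Suc k) \<le> s + 1 / real (Suc k)"
    if "0 < s" "s \<le> real (Suc k)" for k s
  proof -
    have p: "0 < real (Suc k) * s" using that by simp
    have i: "real (idx k s) = of_int \<lceil>real (Suc k) * s\<rceil>" using that p by (simp add: idx_def)
    have "real (Suc k) * s \<le> real (idx k s)" unfolding i by (rule le_of_int_ceiling)
    moreover have "real (idx k s) \<le> real (Suc k) * s + 1" unfolding i by (rule of_int_ceiling_le_add_one)
    moreover have "(real (Suc k) * s + 1) / real (Suc k) = s + 1 / real (Suc k)"
      by (simp add: add_divide_distrib del: of_nat_Suc)
    moreover have "real (idx k s) / real (Suc k) \<le> (real (Suc k) * s + 1) / real (Suc k)"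
      using \<open>real (idx k s) \<le> real (Suc k) * s + 1\<close> by (intro divide_right_mono) auto
    ultimately show "0 < idx k s" "s \<le> real (idx k s) / real (Suc k)" "real (idx k s) / real (Suc k) \<le> s + 1 / real (Suc k)"
      using p by (auto simp: le_divide_eq mult.commute simp del: of_nat_Suc)
  qed
  have simple: "simple_function M (\<sigma> k)" for k
  proof -
    have "idx k \<in> borel \<rightarrow>\<^sub>M count_space UNIV" unfolding idx_def by measurable
    from measurable_compose[OF idM this] have m: "idx k \<in> M \<rightarrow>\<^sub>M count_space UNIV" .
    have "simple_function M (idx k)"
      unfolding simple_function_def
    proof (intro conjI ballI)
      show "finite (idx k ` space M)"
        by (rule finite_subset[of _ "{..Suc k * Suc k}"]) (use idx_range in auto)
      show "idx k -` {x} \<inter> space M \<in> sets M" for x by (rule measurable_sets[OF m]) simp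
    qed
    then show ?thesis unfolding \<sigma>_def by (rule simple_function_compose1)
  qed
  have \<sigma>L1: "\<sigma> k s \<in> Lq 1" for k s
    unfolding \<sigma>_def using L1[of "real (idx k s) / real (Suc k)"] by (auto simp: in_Lq_1_iff)
  then have range: "\<sigma> k ` space M \<subseteq> Lq 1" for k by auto
  have supp: "emeasure M {s \<in> space M. \<sigma> k s \<noteq> (\<lambda>_. 0)} < \<infinity>" for k
  proof -
    have "emeasure M {s \<in> space M. \<sigma> k s \<noteq> (\<lambda>_. 0)} \<le> emeasure M {0<..real (Suc k)}"
      by (rule emeasure_mono) (auto simp: \<sigma>_def idx_def M_def sets_restrict_space split: if_splits)
    then show ?thesis unfolding M_def using emeasure_lebesgue_on_Ioc_finite by (rule le_less_trans)
  qed
  define S where "S k = (\<lambda>(s, x). \<sigma> k s x)" for k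
  have S: "integrable (M \<Otimes>\<^sub>M lebesgue) (S k)" for k
    unfolding S_def by (rule simple_fun_integrable_pair[OF sfM simple range supp])
  then have [measurable]: "S k \<in> borel_measurable (M \<Otimes>\<^sub>M lebesgue)" for k by auto
  have meas: "H s \<in> borel_measurable lebesgue" if "0 < s" for s
    using L1[OF that] by (simp add: normed_fun_space_def)
  have N_eq: "Lq_norm 1 (\<lambda>x. H s x - \<sigma> k s x) = (\<integral>\<^sup>+x. ennreal (norm (Hj (s, x) - S k (s, x))) \<partial>lebesgue)"
    if "0 < s" for s k
    unfolding Lq_norm_1 S_def using eq[OF that]
    by (intro nn_integral_cong_AE) (auto elim!: eventually_mono)
  have N_lim: "(\<lambda>k. Lq_norm 1 (\<lambda>x. H s x - \<sigma> k s x)) \<longlonglongrightarrow> 0" if s: "0 < s" for s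
  proof -
    have "((\<lambda>r. Lq_norm 1 (\<lambda>x. H r x - H s x)) \<longlongrightarrow> Lq_norm 1 (\<lambda>x. H s x - H s x)) (nhds s)"
      using cont[OF s] by (subst tendsto_at_iff_tendsto_nhds[symmetric]) (simp add: Lq_norm_1)
    moreover have "(\<lambda>k. real (idx k s) / real (Suc k)) \<longlonglongrightarrow> s"
    proof (rule tendsto_sandwich)
      have ev: "\<forall>\<^sub>F k in sequentially. s \<le> real (Suc k)"
        by (rule eventually_sequentiallyI[of "nat \<lceil>s\<rceil>"]) (auto simp: nat_le_iff ceiling_le_iff)
      show "\<forall>\<^sub>F k in sequentially. s \<le> real (idx k s) / real (Suc k)"
        using ev by (rule eventually_mono) (use idx_pos s in auto)
      show "\<forall>\<^sub>F k in sequentially. real (idx k s) / real (Suc k) \<le> s + 1 / real (Suc k)"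
        using ev by (rule eventually_mono) (use idx_pos s in auto)
      have "(\<lambda>k. s + 1 / real (Suc k)) \<longlonglongrightarrow> s + 0"
        using LIMSEQ_inverse_real_of_nat by (intro tendsto_intros) (simp add: inverse_eq_divide)
      then show "(\<lambda>k. s + 1 / real (Suc k)) \<longlonglongrightarrow> s" by simp
    qed simp
    ultimately have "(\<lambda>k. Lq_norm 1 (\<lambda>x. H (real (idx k s) / real (Suc k)) x - H s x)) \<longlonglongrightarrow> Lq_norm 1 (\<lambda>x. H s x - H s x)"
      by (rule filterlim_compose)
    then have "(\<lambda>k. Lq_norm 1 (\<lambda>x. H s x - H (real (idx k s) / real (Suc k)) x)) \<longlonglongrightarrow> 0"
      by (subst Lq_norm_1_minus_commute) (simp add: Lq_norm_1)
    moreover have "\<forall>\<^sub>F k in sequentially. Lq_norm 1 (\<lambda>x. H s x - H (real (idx k s) / real (Suc k)) x) = Lq_norm 1 (\<lambda>x. H s x - \<sigma> k s x)"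
    proof (rule eventually_sequentiallyI[of "nat \<lceil>s\<rceil>"])
      fix k assume "nat \<lceil>s\<rceil> \<le> k"
      then have "s \<le> real (Suc k)" by (auto simp: nat_le_iff ceiling_le_iff)
      then have "idx k s \<noteq> 0" using idx_pos(1)[OF s, of k] by simp
      then show "Lq_norm 1 (\<lambda>x. H s x - H (real (idx k s) / real (Suc k)) x) = Lq_norm 1 (\<lambda>x. H s x - \<sigma> k s x)"
        by (simp add: \<sigma>_def)
    qed
    ultimately show ?thesis by (rule Lim_transform_eventually)
  qed
  have N_bound: "Lq_norm 1 (\<lambda>x. H s x - \<sigma> k s x) \<le> g s + g s" if s: "0 < s" for s k
  proof -
    have "Lq_norm 1 (\<lambda>x. H s x - \<sigma> k s x) \<le> Lq_norm 1 (H s) + Lq_norm 1 (\<sigma> k s)"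
      using meas[OF s] \<sigma>L1[of k s] by (intro Lq_norm_1_triangle) (auto simp: normed_fun_space_def)
    also have "Lq_norm 1 (\<sigma> k s) \<le> g s"
    proof (cases "idx k s = 0")
      case False
      then have "s \<le> real (Suc k)" by (auto simp: idx_def split: if_splits)
      note i = idx_pos[OF s this]
      have "real (idx k s) / real (Suc k) \<le> s + 1" using i(3) by (rule order_trans) simp
      then show ?thesis unfolding \<sigma>_def using False g[OF s i(2)] by simp
    qed (simp add: \<sigma>_def Lq_norm_1)
    finally show ?thesis using g[OF s, of s] by (auto intro: order_trans add_right_mono)
  qed
  have lim_int: "(\<lambda>k. \<integral>\<^sup>+s. Lq_norm 1 (\<lambda>x. H s x - \<sigma> k s x) \<partial>M) \<longlonglongrightarrow> 0"
  proof -
    let ?\<phi> = "\<lambda>k s. \<integral>\<^sup>+x. ennreal (norm (Hj (s, x) - S k (s, x))) \<partial>lebesgue"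
    have "(\<lambda>k. \<integral>\<^sup>+s. ?\<phi> k s \<partial>M) \<longlonglongrightarrow> (\<integral>\<^sup>+s. 0 \<partial>M)"
    proof (rule nn_integral_dominated_convergence[where w = "\<lambda>s. g s + g s"])
      show "AE s in M. ?\<phi> k s \<le> g s + g s" for k
        using pos by (rule eventually_mono) (use N_bound N_eq in auto)
      show "AE s in M. (\<lambda>k. ?\<phi> k s) \<longlonglongrightarrow> 0"
        using pos by (rule eventually_mono) (use N_lim N_eq in auto)
      show "(\<integral>\<^sup>+s. g s + g s \<partial>M) < \<infinity>"
        using gfin by (subst nn_integral_add) (auto simp: M_def[symmetric])
    qed measurable
    moreover have "(\<integral>\<^sup>+s. Lq_norm 1 (\<lambda>x. H s x - \<sigma> k s x) \<partial>M) = (\<integral>\<^sup>+s. ?\<phi> k s \<partial>M)" for k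
      using pos by (intro nn_integral_cong_AE) (auto elim!: eventually_mono simp: N_eq)
    ultimately show ?thesis by simp
  qed
  have int: "integrable (M \<Otimes>\<^sub>M lebesgue) Hj"
  proof (rule integrableI_bounded)
    have "(\<integral>\<^sup>+z. ennreal (norm (Hj z)) \<partial>(M \<Otimes>\<^sub>M lebesgue)) = (\<integral>\<^sup>+s. \<integral>\<^sup>+x. ennreal (norm (Hj (s, x))) \<partial>lebesgue \<partial>M)"
      by (subst lebesgue.nn_integral_fst[symmetric]) auto
    also have "\<dots> \<le> (\<integral>\<^sup>+s. g s \<partial>M)"
    proof (rule nn_integral_mono_AE, use pos in \<open>rule eventually_mono\<close>)
      fix s :: real assume s: "0 < s"
      have "(\<integral>\<^sup>+x. ennreal (norm (Hj (s, x))) \<partial>lebesgue) = Lq_norm 1 (H s)"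
        unfolding Lq_norm_1 using eq[OF s] by (intro nn_integral_cong_AE) (auto elim!: eventually_mono)
      then show "(\<integral>\<^sup>+x. ennreal (norm (Hj (s, x))) \<partial>lebesgue) \<le> g s" using g[OF s, of s] by simp
    qed
    finally show "(\<integral>\<^sup>+z. ennreal (norm (Hj z)) \<partial>(M \<Otimes>\<^sub>M lebesgue)) < \<infinity>"
      using gfin by (simp add: M_def[symmetric])
  qed measurable
  define w where "w x = (\<integral>s. Hj (s, x) \<partial>M)" for x
  have "w \<in> Lq 1"
    unfolding in_Lq_1_iff w_def using integrable_snd[of "\<lambda>s x. Hj (s, x)"] int by simp
  moreover have "(\<lambda>k. Lq_norm 1 (\<lambda>x. simple_fun_integral M (\<sigma> k) x - w x)) \<longlonglongrightarrow> 0"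
  proof (rule tendsto_sandwich[OF _ _ tendsto_const lim_int])
    show "\<forall>\<^sub>F k in sequentially. Lq_norm 1 (\<lambda>x. simple_fun_integral M (\<sigma> k) x - w x) \<le>
        (\<integral>\<^sup>+s. Lq_norm 1 (\<lambda>x. H s x - \<sigma> k s x) \<partial>M)"
    proof (rule always_eventually, rule allI)
      fix k
      have "Lq_norm 1 (\<lambda>x. simple_fun_integral M (\<sigma> k) x - w x) \<le> (\<integral>\<^sup>+z. ennreal (norm (Hj z - S k z)) \<partial>(M \<Otimes>\<^sub>M lebesgue))"
        using nn_integral_norm_integral_diff_le[OF int S[of k]]
        by (simp add: Lq_norm_1 w_def simple_fun_integral_eq[OF sfM simple range supp] S_def)
      also have "\<dots> = (\<integral>\<^sup>+s. \<integral>\<^sup>+x. ennreal (norm (Hj (s, x) - S k (s, x))) \<partial>lebesgue \<partial>M)"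
        by (subst lebesgue.nn_integral_fst[symmetric]) auto
      also have "\<dots> = (\<integral>\<^sup>+s. Lq_norm 1 (\<lambda>x. H s x - \<sigma> k s x) \<partial>M)"
        using pos by (intro nn_integral_cong_AE) (auto elim!: eventually_mono simp: N_eq)
      finally show "Lq_norm 1 (\<lambda>x. simple_fun_integral M (\<sigma> k) x - w x) \<le> (\<integral>\<^sup>+s. Lq_norm 1 (\<lambda>x. H s x - \<sigma> k s x) \<partial>M)" .
    qed
  qed auto
  moreover have "AE s in M. H s \<in> Lq 1" using pos by (rule eventually_mono) (rule L1)
  moreover have "AE s in M. (\<lambda>k. Lq_norm 1 (\<lambda>x. H s x - \<sigma> k s x)) \<longlonglongrightarrow> 0"
    using pos by (rule eventually_mono) (rule N_lim)
  ultimately show ?thesis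
    unfolding has_fun_bochner_integral_def M_def[symmetric]
    using simple range supp lim_int by blast
qed

section \<open>Borel representatives of curves in L^1\<close>

lemma complex_borel_representative:
  fixes \<phi> :: "'a::euclidean_space \<Rightarrow> complex"
  assumes "\<phi> \<in> borel_measurable lebesgue"
  obtains \<psi> where "\<psi> \<in> borel_measurable borel" "AE x in lebesgue. \<psi> x = \<phi> x"
proof -
  have "(\<lambda>x. Re (\<phi> x)) \<in> borel_measurable lebesgue" "(\<lambda>x. Im (\<phi> x)) \<in> borel_measurable lebesgue"
    using assms by measurable
  then obtain r i where [measurable]: "r \<in> borel_measurable lborel" "i \<in> borel_measurable lborel"
    and ae: "AE x in lborel. Re (\<phi> x) = r x" "AE x in lborel. Im (\<phi> x) = i x"
    using completion_ex_borel_measurable_real[of "\<lambda>x. Re (\<phi> x)" lborel]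
      completion_ex_borel_measurable_real[of "\<lambda>x. Im (\<phi> x)" lborel] by blast
  show ?thesis
  proof (rule that[of "\<lambda>x. of_real (r x) + \<i> * of_real (i x)"])
    have "AE x in lborel. of_real (r x) + \<i> * of_real (i x) = \<phi> x"
      using ae by eventually_elim (simp add: complex_eq_iff)
    then show "AE x in lebesgue. of_real (r x) + \<i> * of_real (i x) = \<phi> x" by (rule AE_completion)
  qed (use measurable_lborel1 in measurable)
qed

text \<open>For each accuracy 2^{-j} take the first positive rational time, in a fixed enumeration,
  whose value of u is that close to u(s). The choice depends measurably on s because the sets of
  admissible s are open, and it has countably many values, so a Borel representative of each of them
  suffices. The errors are summable in j; hence for every s > 0, and not merely for almost every s,
  the approximations converge almost everywhere to u(s).\<close>

lemma L1_continuous_borel_representative: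
  fixes u :: "real \<Rightarrow> 'a::euclidean_space \<Rightarrow> complex"
  assumes L1: "\<And>s. 0 < s \<Longrightarrow> u s \<in> Lq 1"
    and cont: "\<And>s. 0 < s \<Longrightarrow> ((\<lambda>r. Lq_norm 1 (\<lambda>x. u r x - u s x)) \<longlongrightarrow> 0) (at s)"
  obtains V where "V \<in> borel_measurable borel" "\<And>s. 0 < s \<Longrightarrow> AE x in lebesgue. V (s, x) = u s x"
proof -
  have meas: "u s \<in> borel_measurable lebesgue" if "0 < s" for s
    using L1[OF that] by (simp add: normed_fun_space_def)
  define q where "q = from_nat_into (\<rat> \<inter> {0::real<..})"
  have ne: "\<rat> \<inter> {0::real<..} \<noteq> {}" using Rats_1 by force
  have q: "0 < q i" for i
    using from_nat_into[OF ne, of i] by (simp add: q_def)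
  have q_surj: "\<exists>i. q i = r" if "r \<in> \<rat>" "0 < r" for r
    unfolding q_def using that by (intro from_nat_into_surj) (auto simp: countable_rat)
  define d where "d i s = Lq_norm 1 (\<lambda>x. u (q i) x - u s x)" for i s
  \<comment> \<open>The slack left in d i s < e absorbs a small move of s, by the triangle
    inequality.\<close>
  have op: "open {s. 0 < s \<and> d i s < e}" for i and e :: ennreal
    unfolding open_contains_ball
  proof (rule ballI)
    fix s assume "s \<in> {s. 0 < s \<and> d i s < e}"
    then have s: "0 < s" "d i s < e" by auto
    obtain \<delta> where \<delta>: "0 < \<delta>" "d i s + \<delta> < e"
    proof -
      have dtop: "d i s < top" using s(2) by (rule less_le_trans) simp
      obtain c where c: "d i s < c" "c < e" using dense[OF s(2)] by blast
      have "0 < c - d i s" using c(1) by (simp add: diff_gr0_ennreal)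
      moreover have "d i s + (c - d i s) = c" using c(1) dtop by (simp add: add_diff_inverse_ennreal)
      ultimately show ?thesis using that c(2) by metis
    qed
    have "\<forall>\<^sub>F r in at s. Lq_norm 1 (\<lambda>x. u r x - u s x) < \<delta>"
      using cont[OF s(1)] \<delta>(1) by (rule order_tendstoD)
    then obtain \<epsilon> where \<epsilon>: "0 < \<epsilon>" "\<And>r. r \<noteq> s \<Longrightarrow> dist r s < \<epsilon> \<Longrightarrow> Lq_norm 1 (\<lambda>x. u r x - u s x) < \<delta>"
      unfolding eventually_at by blast
    show "\<exists>\<epsilon>>0. ball s \<epsilon> \<subseteq> {s. 0 < s \<and> d i s < e}"
    proof (intro exI[of _ "min \<epsilon> s"] conjI subsetI)
      fix r assume "r \<in> ball s (min \<epsilon> s)"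
      then have r: "dist r s < \<epsilon>" "0 < r" by (auto simp: dist_real_def)
      have "Lq_norm 1 (\<lambda>x. u r x - u s x) \<le> \<delta>"
        using \<epsilon>(2)[OF _ r(1)] by (cases "r = s") (auto simp: Lq_norm_1)
      moreover have "d i r \<le> d i s + Lq_norm 1 (\<lambda>x. u r x - u s x)"
        using Lq_norm_1_triangle[of "\<lambda>x. u (q i) x - u s x" "\<lambda>x. u r x - u s x"] meas[OF s(1)] meas[OF r(2)] meas[OF q]
        by (simp add: d_def)
      ultimately have "d i r \<le> d i s + \<delta>" by (meson add_left_mono order_trans)
      then show "r \<in> {s. 0 < s \<and> d i s < e}" using r \<delta>(2) by auto
    qed (use \<epsilon>(1) s(1) in auto)
  qed
  have ex: "\<exists>i. d i s < e" if "0 < s" "0 < e" for s and e :: ennreal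
  proof -
    have "\<forall>\<^sub>F r in at s. Lq_norm 1 (\<lambda>x. u r x - u s x) < e"
      using cont[OF that(1)] that(2) by (rule order_tendstoD)
    then obtain \<epsilon> where \<epsilon>: "0 < \<epsilon>" "\<And>r. r \<noteq> s \<Longrightarrow> dist r s < \<epsilon> \<Longrightarrow> Lq_norm 1 (\<lambda>x. u r x - u s x) < e"
      unfolding eventually_at by blast
    obtain r where r: "r \<in> \<rat>" "s < r" "r < s + \<epsilon>"
      using Rats_dense_in_real[of s "s + \<epsilon>"] \<epsilon>(1) by auto
    obtain i where "q i = r" using q_surj[OF r(1)] order.strict_trans[OF \<open>0 < s\<close> r(2)] by auto
    then show ?thesis using \<epsilon>(2)[of r] r by (intro exI[of _ i]) (auto simp: d_def dist_real_def)
  qed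
  define e where "e j = ennreal ((1 / 2) ^ j)" for j :: nat
  have e: "0 < e j" for j by (simp add: e_def)
  define idx where "idx j s = (LEAST i. 0 < s \<and> d i s < e j)" for j s
  have idx: "d (idx j s) s < e j" if "0 < s" for j s
    using LeastI_ex[of "\<lambda>i. 0 < s \<and> d i s < e j"] ex[OF that e] that by (auto simp: idx_def)
  have idx_m[measurable]: "idx j \<in> borel \<rightarrow>\<^sub>M count_space UNIV" for j
  proof -
    have [measurable]: "Measurable.pred borel (\<lambda>s. 0 < s \<and> d i s < e j)" for i
      using borel_open[OF op[of i "e j"]] by (simp add: pred_def)
    show ?thesis unfolding idx_def by measurable
  qed
  have "\<exists>\<psi>. \<psi> \<in> borel_measurable borel \<and> (AE x in lebesgue. \<psi> x = u (q i) x)" for i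
    using complex_borel_representative[OF meas[OF q[of i]]] by blast
  then obtain v where v[measurable]: "\<And>i. v i \<in> borel_measurable borel" and v_eq: "\<And>i. AE x in lebesgue. v i x = u (q i) x"
    by metis
  define Vj where "Vj j z = v (idx j (fst z)) (snd z)" for j and z :: "real \<times> 'a"
  have Vj[measurable]: "Vj j \<in> borel_measurable borel" for j
  proof -
    have "Vj j \<in> borel_measurable (borel \<Otimes>\<^sub>M borel)"
      unfolding Vj_def by (rule measurable_compose_countable) measurable
    then show ?thesis by (simp add: borel_prod)
  qed
  show ?thesis
  proof (rule that[of "\<lambda>z. lim (\<lambda>j. Vj j z)"])
    show "(\<lambda>z. lim (\<lambda>j. Vj j z)) \<in> borel_measurable borel" by measurable
    fix s :: real assume s: "0 < s"
    have [measurable]: "u s \<in> borel_measurable lebesgue" by (rule meas[OF s])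
    have vm: "v i \<in> borel_measurable lebesgue" for i using v[of i] by (simp add: measurable_completion)
    have "(\<integral>\<^sup>+x. (\<Sum>j. ennreal (norm (Vj j (s, x) - u s x))) \<partial>lebesgue) = (\<Sum>j. \<integral>\<^sup>+x. ennreal (norm (Vj j (s, x) - u s x)) \<partial>lebesgue)"
      unfolding Vj_def using vm by (intro nn_integral_suminf) auto
    also have "\<dots> \<le> (\<Sum>j. e j)"
    proof (intro suminf_le)
      fix j
      have "(\<integral>\<^sup>+x. ennreal (norm (Vj j (s, x) - u s x)) \<partial>lebesgue) = d (idx j s) s"
        unfolding d_def Lq_norm_1 Vj_def using v_eq[of "idx j s"]
        by (intro nn_integral_cong_AE) (auto elim!: eventually_mono)
      then show "(\<integral>\<^sup>+x. ennreal (norm (Vj j (s, x) - u s x)) \<partial>lebesgue) \<le> e j"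
        using idx[OF s, of j] by simp
    qed auto
    also have "\<dots> = ennreal 2"
      unfolding e_def by (rule suminf_ennreal_eq) (use geometric_sums[of "1/2::real"] in auto)
    finally have "(\<integral>\<^sup>+x. (\<Sum>j. ennreal (norm (Vj j (s, x) - u s x))) \<partial>lebesgue) \<noteq> \<infinity>"
      by (auto simp: top_unique)
    \<comment> \<open>A finite L^1 sum of the errors makes the series of errors finite for almost
      every x, so its terms tend to 0 there.\<close>
    then have "AE x in lebesgue. (\<Sum>j. ennreal (norm (Vj j (s, x) - u s x))) \<noteq> \<infinity>"
      unfolding Vj_def using vm by (intro nn_integral_PInf_AE) auto
    then show "AE x in lebesgue. lim (\<lambda>j. Vj j (s, x)) = u s x"
    proof (rule eventually_mono)
      fix x assume "(\<Sum>j. ennreal (norm (Vj j (s, x) - u s x))) \<noteq> \<infinity>"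
      then have "summable (\<lambda>j. norm (Vj j (s, x) - u s x))"
        by (intro summable_suminf_not_top) auto
      then have "(\<lambda>j. Vj j (s, x) - u s x) \<longlonglongrightarrow> 0"
        using summable_LIMSEQ_zero tendsto_norm_zero_iff by blast
      then have "(\<lambda>j. Vj j (s, x)) \<longlonglongrightarrow> u s x" by (simp add: LIM_zero_iff)
      then show "lim (\<lambda>j. Vj j (s, x)) = u s x" by (rule limI)
    qed
  qed
qed

section \<open>Growth of weighted moments\<close>

text \<open>H is the primitive of \<beta> (1 + s)^{-a} that vanishes at 0. For Y = exp(-2H) W the
  integral term contributes at most half of the supremum S of Y, because the integral of H' exp(2H)
  over (0, t) stays below exp(2H(t)) / 2. The a priori bound makes S finite, so that S/2 can be
  absorbed, and H \<le> \<beta> / (a - 1) leads back to W.\<close>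

lemma gronwall_decay:
  fixes W :: "real \<Rightarrow> ennreal"
  assumes a: "1 < a" and \<beta>: "0 \<le> \<beta>" and A: "0 \<le> A" and T: "0 < T"
    and bdd: "\<And>t. 0 < t \<Longrightarrow> t \<le> T \<Longrightarrow> W t \<le> ennreal B"
    and ineq: "\<And>t. 0 < t \<Longrightarrow> t \<le> T \<Longrightarrow>
       W t \<le> ennreal A + (\<integral>\<^sup>+s. indicator {0<..<t} s * ennreal (\<beta> * (1 + s) powr (- a)) * W s \<partial>lborel)"
  shows "W T \<le> ennreal (2 * A * exp (2 * \<beta> / (a - 1)))"
proof -
  define H where "H t = \<beta> / (a - 1) * (1 - (1 + t) powr (1 - a))" for t
  have H: "(H has_real_derivative \<beta> * (1 + t) powr (- a)) (at t)" if "0 \<le> t" for t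
  proof -
    have "((\<lambda>t. (1 + t) powr (1 - a)) has_real_derivative (1 - a) * (1 + t) powr (- a)) (at t)"
      using that by (auto intro!: derivative_eq_intros)
    then have "((\<lambda>t. \<beta> / (a - 1) * (1 - (1 + t) powr (1 - a))) has_real_derivative
        \<beta> / (a - 1) * (0 - (1 - a) * (1 + t) powr (- a))) (at t)"
      by (intro DERIV_cmult DERIV_diff DERIV_const)
    moreover have "\<beta> / (a - 1) * (0 - (1 - a) * (1 + t) powr (- a)) = \<beta> * (1 + t) powr (- a)"
      using a by (simp add: divide_simps) (simp add: algebra_simps)
    ultimately show ?thesis unfolding H_def by (simp only:)
  qed
  have H0: "0 \<le> H t" if "0 \<le> t" for t
    unfolding H_def using that a \<beta> powr_mono[of "1 - a" 0 "1 + t"] by (intro mult_nonneg_nonneg) auto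
  have Hle: "H t \<le> \<beta> / (a - 1)" for t
    unfolding H_def using a \<beta> by (intro mult_left_le) auto
  define Y where "Y t = ennreal (exp (- 2 * H t)) * W t" for t
  have WY: "W t = ennreal (exp (2 * H t)) * Y t" for t
    by (simp add: Y_def mult.assoc[symmetric] ennreal_mult[symmetric] exp_add[symmetric])
  define S where "S = (SUP t\<in>{0<..T}. Y t)"
  have "Y t \<le> ennreal B" if "0 < t" "t \<le> T" for t
  proof -
    have "Y t \<le> 1 * W t" unfolding Y_def
      using H0[of t] that by (intro mult_right_mono) (auto simp: ennreal_le_1)
    then show ?thesis using bdd[OF that] by simp
  qed
  then have "S \<le> ennreal B" unfolding S_def by (intro SUP_least) auto
  then have Sfin: "S < top" by (auto simp: less_top[symmetric] top_unique)
  have Yle: "Y t \<le> ennreal A + S / 2" if t: "0 < t" "t \<le> T" for t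
  proof -
    have YS: "Y s \<le> S" if "0 < s" "s < t" for s
      unfolding S_def by (rule SUP_upper) (use that t in auto)
    have "(\<integral>\<^sup>+s. indicator {0<..<t} s * ennreal (\<beta> * (1 + s) powr (- a)) * W s \<partial>lborel)
        \<le> (\<integral>\<^sup>+s. S * (ennreal (\<beta> * (1 + s) powr (- a) * exp (2 * H s)) * indicator {0..t} s) \<partial>lborel)"
    proof (intro nn_integral_mono)
      fix s
      show "indicator {0<..<t} s * ennreal (\<beta> * (1 + s) powr (- a)) * W s \<le>
          S * (ennreal (\<beta> * (1 + s) powr (- a) * exp (2 * H s)) * indicator {0..t} s)"
      proof (cases "0 < s \<and> s < t")
        case True
        then have "ennreal (\<beta> * (1 + s) powr (- a)) * W s \<le> ennreal (\<beta> * (1 + s) powr (- a)) * (ennreal (exp (2 * H s)) * S)"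
          unfolding WY using YS by (intro mult_left_mono) auto
        also have "\<dots> = S * ennreal (\<beta> * (1 + s) powr (- a) * exp (2 * H s))"
          using \<beta> by (simp add: ennreal_mult mult_ac)
        finally show ?thesis using True by (simp add: indicator_def)
      qed (auto simp: indicator_def)
    qed
    also have "\<dots> = S * (\<integral>\<^sup>+s. ennreal (\<beta> * (1 + s) powr (- a) * exp (2 * H s)) * indicator {0..t} s \<partial>lborel)"
      unfolding H_def by (rule nn_integral_cmult) measurable
    also have "(\<integral>\<^sup>+s. ennreal (\<beta> * (1 + s) powr (- a) * exp (2 * H s)) * indicator {0..t} s \<partial>lborel) =
        ennreal (exp (2 * H t) / 2 - exp (2 * H 0) / 2)"
    proof (rule nn_integral_FTC_Icc[where F = "\<lambda>s. exp (2 * H s) / 2"])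
      show "(\<lambda>s. \<beta> * (1 + s) powr (- a) * exp (2 * H s)) \<in> borel_measurable borel"
        unfolding H_def by measurable
      show "((\<lambda>s. exp (2 * H s) / 2) has_real_derivative \<beta> * (1 + s) powr (- a) * exp (2 * H s)) (at s)"
        if "s \<in> {0..t}" for s
      proof -
        have "((\<lambda>s. exp (2 * H s) / 2) has_real_derivative exp (2 * H s) * (2 * (\<beta> * (1 + s) powr (- a))) / 2) (at s)"
          by (intro DERIV_cdivide DERIV_fun_exp DERIV_cmult H) (use that in auto)
        then show ?thesis by (rule DERIV_cong) simp
      qed
    qed (use t \<beta> in auto)
    also have "\<dots> \<le> ennreal (exp (2 * H t) / 2)" by (intro ennreal_leI) simp
    finally have I: "(\<integral>\<^sup>+s. indicator {0<..<t} s * ennreal (\<beta> * (1 + s) powr (- a)) * W s \<partial>lborel)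
       \<le> S * ennreal (exp (2 * H t) / 2)" by (simp add: mult_left_mono)
    have "Y t \<le> ennreal (exp (- 2 * H t)) * (ennreal A + S * ennreal (exp (2 * H t) / 2))"
      unfolding Y_def using order_trans[OF ineq[OF t] add_left_mono[OF I]] by (rule mult_left_mono) simp
    also have "\<dots> = ennreal (exp (- 2 * H t)) * ennreal A + S * ennreal (exp (- 2 * H t) * (exp (2 * H t) / 2))"
    proof -
      have "ennreal (exp (- 2 * H t) * (exp (2 * H t) / 2)) = ennreal (exp (- 2 * H t)) * ennreal (exp (2 * H t) / 2)"
        by (rule ennreal_mult) auto
      then show ?thesis by (simp only: distrib_left mult.left_commute)
    qed
    also have "exp (- 2 * H t) * (exp (2 * H t) / 2) = 1 / 2" by (simp add: exp_add[symmetric] mult.assoc[symmetric])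
    also have "S * ennreal (1 / 2) = S / 2"
    proof -
      have "inverse (2::ennreal) = ennreal (1 / 2)" using inverse_ennreal[of 2] by simp
      then show ?thesis unfolding divide_ennreal_def by (simp only:)
    qed
    also have "ennreal (exp (- 2 * H t)) * ennreal A \<le> 1 * ennreal A"
      using H0[of t] t by (intro mult_right_mono) (auto simp: ennreal_le_1)
    finally show ?thesis by (simp add: add_right_mono)
  qed
  then have "(SUP t\<in>{0<..T}. Y t) \<le> ennreal A + S / 2" by (intro SUP_least) simp
  then have S2: "S \<le> ennreal A + S / 2" by (simp only: S_def[symmetric])
  obtain r where r: "S = ennreal r" "0 \<le> r" using Sfin by (cases S) auto
  have "ennreal r \<le> ennreal (A + r / 2)"
  proof -
    have "ennreal r / 2 = ennreal (r / 2)" using divide_ennreal[of r 2] r by simp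
    then show ?thesis using S2 r A by (simp add: ennreal_plus)
  qed
  then have "r \<le> 2 * A" using A r by (subst (asm) ennreal_le_iff) auto
  then have S: "S \<le> ennreal (2 * A)" using r by (simp add: ennreal_leI)
  have "W T \<le> ennreal (exp (2 * (\<beta> / (a - 1)))) * S"
    unfolding WY
  proof (intro mult_mono)
    show "Y T \<le> S" unfolding S_def by (rule SUP_upper) (use T in auto)
  qed (use Hle[of T] in auto)
  also have "\<dots> \<le> ennreal (exp (2 * (\<beta> / (a - 1)))) * ennreal (2 * A)" using S by (intro mult_left_mono) auto
  finally show ?thesis using A by (simp add: ennreal_mult[symmetric] mult_ac)
qed

lemma nn_integral_decay_finite:
  assumes "1 < (b :: real)"
  shows "(\<integral>\<^sup>+s. ennreal ((1 + s) powr (- b)) * indicator {0..} s \<partial>lborel) = ennreal (1 / (b - 1))"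
proof -
  have "(\<integral>\<^sup>+s. ennreal ((1 + s) powr (- b)) * indicator {0..} s \<partial>lborel) = ennreal (0 - (- 1 / (b - 1) * (1 + 0) powr (1 - b)))"
  proof (rule nn_integral_FTC_atLeast)
    show "((\<lambda>s. - 1 / (b - 1) * (1 + s) powr (1 - b)) has_real_derivative (1 + s) powr (- b)) (at s)" if "0 \<le> s" for s
    proof -
      have "((\<lambda>s. (1 + s) powr (1 - b)) has_real_derivative (1 - b) * (1 + s) powr (- b)) (at s)"
        using that by (auto intro!: derivative_eq_intros)
      then have "((\<lambda>s. - 1 / (b - 1) * (1 + s) powr (1 - b)) has_real_derivative
          - 1 / (b - 1) * ((1 - b) * (1 + s) powr (- b))) (at s)"
        by (rule DERIV_cmult)
      moreover have "- 1 / (b - 1) * ((1 - b) * (1 + s) powr (- b)) = (1 + s) powr (- b)"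
        using assms by (simp add: divide_simps) (simp add: algebra_simps)
      ultimately show ?thesis by (simp only:)
    qed
    have "((\<lambda>s. - 1 / (b - 1) * (1 + s) powr (1 - b)) \<longlongrightarrow> - 1 / (b - 1) * 0) at_top"
      using assms by (intro tendsto_mult tendsto_const tendsto_neg_powr filterlim_tendsto_add_at_top[OF tendsto_const filterlim_ident]) auto
    then show "((\<lambda>s. - 1 / (b - 1) * (1 + s) powr (1 - b)) \<longlongrightarrow> 0) at_top" by simp
  qed auto
  then show ?thesis by simp
qed

text \<open>A quasi-triangle inequality for the truncated weight. Its constant does not see R; the
  increment x - y may stay untruncated because the Gaussian controls its powers.\<close>

lemma min_norm_power_le:
  fixes x y :: "'a::real_normed_vector"
  assumes "0 \<le> R"
  shows "min (norm x) R ^ m \<le> 2 ^ m * (min (norm y) R ^ m + norm (x - y) ^ m)"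
proof -
  define p q where "p = min (norm y) R" and "q = norm (x - y)"
  have pq: "0 \<le> p" "0 \<le> q" using assms by (auto simp: p_def q_def)
  have "min (norm x) R \<le> p + q"
    using norm_triangle_sub[of x y] pq(2) by (auto simp: p_def min_def q_def[symmetric])
  also have "\<dots> \<le> 2 * max p q" by auto
  finally have "min (norm x) R ^ m \<le> (2 * max p q) ^ m"
    using assms by (intro power_mono) auto
  also have "\<dots> = 2 ^ m * max p q ^ m" by (rule power_mult_distrib)
  also have "max p q ^ m \<le> p ^ m + q ^ m" using pq by (auto simp: max_def)
  finally show ?thesis by (simp add: p_def q_def)
qed

text \<open>The weight at x is exchanged for the weight at y plus |x - y|^m; integrated against the
  kernel, the latter yields t^{m/2}, the spread caused by diffusion.\<close>

lemma heat_kernel_weighted_integral: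
  assumes "Re \<nu> > 0"
  obtains B where "0 < B"
    "\<And>t (y::real^'n). 0 < t \<Longrightarrow> (\<integral>\<^sup>+x. ennreal (cmod (heat_kernel \<nu> t (x - y))) \<partial>lborel) \<le> ennreal B"
    "\<And>t (y::real^'n) R. 0 < t \<Longrightarrow> 0 \<le> R \<Longrightarrow>
       (\<integral>\<^sup>+x. ennreal (min (norm x) R ^ m * cmod (heat_kernel \<nu> t (x - y))) \<partial>lborel) \<le>
       ennreal (B * (min (norm y) R ^ m + t powr (real m / 2)))"
proof -
  from heat_kernel_bound[OF assms, where 'n = 'n and m = m] obtain C b where Cb: "0 < C" "0 < b"
    and bd: "\<And>t (z :: real^'n). 0 < t \<Longrightarrow> cmod (heat_kernel \<nu> t z) \<le> C * (t powr (- real CARD('n) / 2) * exp (- b * (norm z)\<^sup>2 / t))"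
    and bdm: "\<And>t (z :: real^'n). 0 < t \<Longrightarrow> (norm z) ^ m * cmod (heat_kernel \<nu> t z) \<le>
       C * t powr (real m / 2) * (t powr (- real CARD('n) / 2) * exp (- b * (norm z)\<^sup>2 / t))"
    by metis
  define c where "c = (pi / b) powr (real CARD('n) / 2)"
  have c: "0 < c" using Cb by (simp add: c_def)
  have I: "(\<integral>\<^sup>+x. ennreal (r * (t powr (- real CARD('n) / 2) * exp (- b * (norm (x - y))\<^sup>2 / t))) \<partial>lborel) = ennreal (r * c)"
    if "0 < t" "0 \<le> r" for t r and y :: "real^'n"
  proof -
    have "(\<integral>\<^sup>+x. ennreal (r * (t powr (- real CARD('n) / 2) * exp (- b * (norm (x - y))\<^sup>2 / t))) \<partial>lborel) =
      ennreal r * (\<integral>\<^sup>+x. ennreal (t powr (- real CARD('n) / 2) * exp (- b * (norm (x - y))\<^sup>2 / t)) \<partial>lborel)"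
      using that by (subst nn_integral_cmult[symmetric]) (auto simp: ennreal_mult)
    also have "\<dots> = ennreal (r * c)"
      unfolding nn_integral_gaussian[OF Cb(2) that(1)] c_def[symmetric] using that c by (simp add: ennreal_mult)
    finally show ?thesis .
  qed
  show ?thesis
  proof (rule that[of "2 ^ m * C * c"])
    fix t :: real and y :: "real^'n" assume t: "0 < t"
    have "(\<integral>\<^sup>+x. ennreal (cmod (heat_kernel \<nu> t (x - y))) \<partial>lborel) \<le>
        (\<integral>\<^sup>+x. ennreal (C * (t powr (- real CARD('n) / 2) * exp (- b * (norm (x - y))\<^sup>2 / t))) \<partial>lborel)"
      by (intro nn_integral_mono ennreal_leI bd t)
    also have "\<dots> = ennreal (C * c)" using I[OF t, of C] Cb by simp
    also have "\<dots> \<le> ennreal (2 ^ m * C * c)"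
      using mult_right_mono[of 1 "2 ^ m" "C * c"] Cb c by (intro ennreal_leI) (simp add: mult.assoc)
    finally show "(\<integral>\<^sup>+x. ennreal (cmod (heat_kernel \<nu> t (x - y))) \<partial>lborel) \<le> ennreal (2 ^ m * C * c)" .
    fix R :: real assume R: "0 \<le> R"
    define r where "r = 2 ^ m * (min (norm y) R ^ m + t powr (real m / 2)) * C"
    have r: "0 \<le> r" using Cb R by (simp add: r_def)
    have "(\<integral>\<^sup>+x. ennreal (min (norm x) R ^ m * cmod (heat_kernel \<nu> t (x - y))) \<partial>lborel) \<le>
        (\<integral>\<^sup>+x. ennreal (r * (t powr (- real CARD('n) / 2) * exp (- b * (norm (x - y))\<^sup>2 / t))) \<partial>lborel)"
    proof (intro nn_integral_mono ennreal_leI)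
      fix x :: "real^'n"
      let ?E = "t powr (- real CARD('n) / 2) * exp (- b * (norm (x - y))\<^sup>2 / t)"
      have "min (norm x) R ^ m * cmod (heat_kernel \<nu> t (x - y)) \<le>
          2 ^ m * (min (norm y) R ^ m + norm (x - y) ^ m) * cmod (heat_kernel \<nu> t (x - y))"
        by (intro mult_right_mono min_norm_power_le R) auto
      also have "\<dots> = 2 ^ m * (min (norm y) R ^ m * cmod (heat_kernel \<nu> t (x - y)) + norm (x - y) ^ m * cmod (heat_kernel \<nu> t (x - y)))"
        by (simp add: algebra_simps)
      also have "\<dots> \<le> 2 ^ m * (min (norm y) R ^ m * (C * ?E) + C * t powr (real m / 2) * ?E)"
        using R t by (intro mult_left_mono add_mono bd bdm) auto
      also have "\<dots> = r * ?E" by (simp add: r_def algebra_simps)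
      finally show "min (norm x) R ^ m * cmod (heat_kernel \<nu> t (x - y)) \<le> r * ?E" .
    qed
    also have "\<dots> = ennreal (r * c)" by (rule I[OF t r])
    finally show "(\<integral>\<^sup>+x. ennreal (min (norm x) R ^ m * cmod (heat_kernel \<nu> t (x - y))) \<partial>lborel) \<le>
       ennreal (2 ^ m * C * c * (min (norm y) R ^ m + t powr (real m / 2)))"
      by (simp add: r_def mult_ac)
  qed (use Cb c in auto)
qed

section \<open>Duhamel's formula for Borel representatives\<close>

lemma borel_measurable_fst_snd [measurable (raw)]:
  fixes f :: "'c \<Rightarrow> 'a::second_countable_topology \<times> 'b::second_countable_topology"
  assumes "f \<in> borel_measurable M"
  shows "(\<lambda>x. fst (f x)) \<in> borel_measurable M" "(\<lambda>x. snd (f x)) \<in> borel_measurable M"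
  by (rule measurable_compose[OF assms], intro borel_measurable_continuous_onI continuous_intros)+

lemma nn_integral_lborel_pair:
  fixes f :: "'a::euclidean_space \<times> 'b::euclidean_space \<Rightarrow> ennreal"
  assumes "f \<in> borel_measurable borel"
  shows "(\<integral>\<^sup>+z. f z \<partial>lborel) = (\<integral>\<^sup>+x. \<integral>\<^sup>+y. f (x, y) \<partial>lborel \<partial>lborel)"
  using assms lborel.nn_integral_fst[of f lborel] by (simp add: lborel_prod borel_prod)

lemma nn_integral_lborel_swap:
  fixes f :: "'a::euclidean_space \<Rightarrow> 'b::euclidean_space \<Rightarrow> ennreal"
  assumes "(\<lambda>z. f (fst z) (snd z)) \<in> borel_measurable borel"
  shows "(\<integral>\<^sup>+x. \<integral>\<^sup>+y. f x y \<partial>lborel \<partial>lborel) = (\<integral>\<^sup>+y. \<integral>\<^sup>+x. f x y \<partial>lborel \<partial>lborel)"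
proof -
  have "(\<lambda>(x, y). f x y) \<in> borel_measurable (lborel \<Otimes>\<^sub>M lborel)"
    using assms by (simp add: lborel_prod case_prod_beta')
  then show ?thesis by (rule lborel_pair.Fubini'[symmetric])
qed

text \<open>What remains of the problem once u, f(u) and the initial data are replaced by the Borel
  functions \<open>V\<close>, \<open>U\<close> and \<open>u0\<close>: a Duhamel formula whose source
  is smaller than \<open>V\<close> by the factor (1 + s)^{-a}. The nonlinearity survives only in a =
  (n/2)(p - 1), and p > 1 + (m + 2)/n becomes 1 + m/2 < a. Integrability in s is part of
  \<open>duhamel\<close> because the time integral is split at t/2 later.\<close>

locale duhamel_data =
  fixes \<nu> :: complex and m :: nat and u0 :: "real ^ 'n \<Rightarrow> complex"
    and V U :: "real \<times> (real ^ 'n) \<Rightarrow> complex" and a h M :: real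
  assumes nu: "0 < Re \<nu>"
    and u0_meas [measurable]: "u0 \<in> borel_measurable borel"
    and u0_int: "(\<integral>\<^sup>+y. ennreal (cmod (u0 y)) \<partial>lborel) < \<infinity>"
    and u0_mom: "(\<integral>\<^sup>+y. ennreal (norm y ^ m * cmod (u0 y)) \<partial>lborel) < \<infinity>"
    and V_meas [measurable]: "V \<in> borel_measurable borel"
    and U_meas [measurable]: "U \<in> borel_measurable borel"
    and h: "0 \<le> h" and M: "0 \<le> M" and a: "1 + real m / 2 < a"
    and V_L1: "\<And>s. 0 < s \<Longrightarrow> (\<integral>\<^sup>+y. ennreal (cmod (V (s, y))) \<partial>lborel) \<le> ennreal M"
    and V_Linf: "\<And>s y. 0 < s \<Longrightarrow> cmod (V (s, y)) \<le> M * (1 + s) powr (- real CARD('n) / 2)"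
    and U_V: "\<And>s y. 0 < s \<Longrightarrow> cmod (U (s, y)) \<le> h * (1 + s) powr (- a) * cmod (V (s, y))"
    and U_0: "\<And>s y. s \<le> 0 \<Longrightarrow> U (s, y) = 0"
    and duhamel: "\<And>t. 0 < t \<Longrightarrow> AE x in lborel.
       integrable lborel (\<lambda>s. indicator {0<..<t} s *\<^sub>R (\<integral>y. heat_kernel \<nu> (t - s) (x - y) * U (s, y) \<partial>lborel)) \<and>
       V (t, x) = (\<integral>y. heat_kernel \<nu> t (x - y) * u0 y \<partial>lborel) +
         (\<integral>s. indicator {0<..<t} s *\<^sub>R (\<integral>y. heat_kernel \<nu> (t - s) (x - y) * U (s, y) \<partial>lborel) \<partial>lborel)"
begin

lemma a_gt: "1 < a" using a by (simp add: field_simps)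

text \<open>Absolute values are taken inside both integrals, after which Tonelli's theorem on the
  product suffices and no integrability is at stake.\<close>

lemma duhamel_source_norm_le:
  "(\<integral>\<^sup>+s. ennreal (norm (indicator A s *\<^sub>R (\<integral>y. heat_kernel \<nu> (t - s) (x - y) * U (s, y) \<partial>lborel))) \<partial>lborel)
    \<le> (\<integral>\<^sup>+z. indicator A (fst z) * ennreal (cmod (heat_kernel \<nu> (t - fst z) (x - snd z)) * cmod (U z)) \<partial>lborel)"
  if [measurable]: "A \<in> sets borel"
proof -
  have "(\<integral>\<^sup>+s. ennreal (norm (indicator A s *\<^sub>R (\<integral>y. heat_kernel \<nu> (t - s) (x - y) * U (s, y) \<partial>lborel))) \<partial>lborel)
      \<le> (\<integral>\<^sup>+s. \<integral>\<^sup>+y. indicator A s * ennreal (cmod (heat_kernel \<nu> (t - s) (x - y)) * cmod (U (s, y))) \<partial>lborel \<partial>lborel)"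
  proof (intro nn_integral_mono)
    fix s
    show "ennreal (norm (indicator A s *\<^sub>R (\<integral>y. heat_kernel \<nu> (t - s) (x - y) * U (s, y) \<partial>lborel)))
      \<le> (\<integral>\<^sup>+y. indicator A s * ennreal (cmod (heat_kernel \<nu> (t - s) (x - y)) * cmod (U (s, y))) \<partial>lborel)"
      using nn_integral_norm_integral_le[of lborel "\<lambda>y. heat_kernel \<nu> (t - s) (x - y) * U (s, y)"]
      by (cases "s \<in> A") (simp_all add: norm_mult)
  qed
  also have "\<dots> = (\<integral>\<^sup>+z. indicator A (fst z) * ennreal (cmod (heat_kernel \<nu> (t - fst z) (x - snd z)) * cmod (U z)) \<partial>lborel)"
    apply (subst nn_integral_lborel_pair)
    subgoal by measurable
    subgoal by simp
    done
  finally show ?thesis .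
qed

lemma duhamel_norm_le:
  assumes "0 < t"
  shows "AE x in lborel. ennreal (cmod (V (t, x))) \<le>
    (\<integral>\<^sup>+y. ennreal (cmod (heat_kernel \<nu> t (x - y)) * cmod (u0 y)) \<partial>lborel) +
    (\<integral>\<^sup>+z. indicator {0<..<t} (fst z) * ennreal (cmod (heat_kernel \<nu> (t - fst z) (x - snd z)) * cmod (U z)) \<partial>lborel)"
  using duhamel[OF assms]
proof (rule eventually_mono, elim conjE)
  fix x
  let ?A = "\<integral>y. heat_kernel \<nu> t (x - y) * u0 y \<partial>lborel"
  let ?B = "\<integral>s. indicator {0<..<t} s *\<^sub>R (\<integral>y. heat_kernel \<nu> (t - s) (x - y) * U (s, y) \<partial>lborel) \<partial>lborel"
  assume "V (t, x) = ?A + ?B"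
  then have "ennreal (cmod (V (t, x))) \<le> ennreal (norm ?A) + ennreal (norm ?B)"
    by (simp add: norm_triangle_ineq ennreal_plus[symmetric] del: ennreal_plus)
  also have "\<dots> \<le> (\<integral>\<^sup>+y. ennreal (cmod (heat_kernel \<nu> t (x - y)) * cmod (u0 y)) \<partial>lborel) +
    (\<integral>\<^sup>+z. indicator {0<..<t} (fst z) * ennreal (cmod (heat_kernel \<nu> (t - fst z) (x - snd z)) * cmod (U z)) \<partial>lborel)"
    using nn_integral_norm_integral_le[of lborel "\<lambda>y. heat_kernel \<nu> t (x - y) * u0 y"]
      order_trans[OF nn_integral_norm_integral_le duhamel_source_norm_le[of "{0<..<t}" t x]]
    by (intro add_mono) (simp_all add: norm_mult)
  finally show "ennreal (cmod (V (t, x))) \<le>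
    (\<integral>\<^sup>+y. ennreal (cmod (heat_kernel \<nu> t (x - y)) * cmod (u0 y)) \<partial>lborel) +
    (\<integral>\<^sup>+z. indicator {0<..<t} (fst z) * ennreal (cmod (heat_kernel \<nu> (t - fst z) (x - snd z)) * cmod (U z)) \<partial>lborel)" .
qed

text \<open>The truncation \<open>min |x| R\<close> makes the moments finite a priori, as Gronwall's inequality requires;
  the constants do not depend on \<open>R\<close>.\<close>

lemma truncated_moment_ineq:
  obtains B A where "0 < B" "0 \<le> A"
    "\<And>t R. 0 < t \<Longrightarrow> 0 \<le> R \<Longrightarrow>
      (\<integral>\<^sup>+x. ennreal (min (norm x) R ^ m * cmod (V (t, x))) \<partial>lborel) \<le> ennreal (A * (1 + t) powr (real m / 2)) +
      (\<integral>\<^sup>+s. indicator {0<..<t} s * ennreal (B * (1 + s) powr (- a)) *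
         (\<integral>\<^sup>+x. ennreal (min (norm x) R ^ m * cmod (V (s, x))) \<partial>lborel) \<partial>lborel)"
proof -
  from heat_kernel_weighted_integral[OF nu, where 'n = 'n and m = m] obtain B where B: "0 < B"
    and k0: "\<And>t (y::real^'n). 0 < t \<Longrightarrow> (\<integral>\<^sup>+x. ennreal (cmod (heat_kernel \<nu> t (x - y))) \<partial>lborel) \<le> ennreal B"
    and km: "\<And>t (y::real^'n) R. 0 < t \<Longrightarrow> 0 \<le> R \<Longrightarrow>
       (\<integral>\<^sup>+x. ennreal (min (norm x) R ^ m * cmod (heat_kernel \<nu> t (x - y))) \<partial>lborel) \<le>
       ennreal (B * (min (norm y) R ^ m + t powr (real m / 2)))"
    by blast
  define l0 where "l0 = enn2real (\<integral>\<^sup>+y. ennreal (cmod (u0 y)) \<partial>lborel)"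
  define m0 where "m0 = enn2real (\<integral>\<^sup>+y. ennreal (norm y ^ m * cmod (u0 y)) \<partial>lborel)"
  have l0: "(\<integral>\<^sup>+y. ennreal (cmod (u0 y)) \<partial>lborel) = ennreal l0" "0 \<le> l0"
    using u0_int by (simp_all add: l0_def ennreal_enn2real)
  have m0: "(\<integral>\<^sup>+y. ennreal (norm y ^ m * cmod (u0 y)) \<partial>lborel) = ennreal m0" "0 \<le> m0"
    using u0_mom by (simp_all add: m0_def ennreal_enn2real)
  \<comment> \<open>Three origins of growth: the moment of the initial data, the spreading of its
    mass by diffusion, and the spreading of the source, whose total mass is at most h M / (a -
    1).\<close>
  define A where "A = B * m0 + B * l0 + B * h * M / (a - 1)"
  have A: "0 \<le> A" unfolding A_def using B m0(2) l0(2) h M a_gt by simp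
  show ?thesis
  \<comment> \<open>The summand 1 keeps the constant positive when h = 0.\<close>
  proof (rule that[of "B * h + 1" A])
    fix t R :: real assume t: "0 < t" and R: "0 \<le> R"
    define \<rho> where "\<rho> x = min (norm x) R ^ m" for x :: "real^'n"
    have \<rho>[measurable]: "\<rho> \<in> borel_measurable borel" unfolding \<rho>_def by measurable
    have \<rho>0: "0 \<le> \<rho> x" for x using R by (simp add: \<rho>_def)
    define \<tau> where "\<tau> = t powr (real m / 2)"
    have \<tau>: "0 \<le> \<tau>" "\<tau> \<le> (1 + t) powr (real m / 2)" "1 \<le> (1 + t) powr (real m / 2)"
      using t by (auto simp: \<tau>_def powr_mono2 ge_one_powr_ge_zero)
    let ?I0 = "\<integral>\<^sup>+x. ennreal (\<rho> x) * (\<integral>\<^sup>+y. ennreal (cmod (heat_kernel \<nu> t (x - y)) * cmod (u0 y)) \<partial>lborel) \<partial>lborel"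
    let ?I1 = "\<integral>\<^sup>+x. ennreal (\<rho> x) * (\<integral>\<^sup>+z. indicator {0<..<t} (fst z) * ennreal (cmod (heat_kernel \<nu> (t - fst z) (x - snd z)) * cmod (U z)) \<partial>lborel) \<partial>lborel"
    have m1: "(\<lambda>x. \<integral>\<^sup>+y. ennreal (cmod (heat_kernel \<nu> t (x - y)) * cmod (u0 y)) \<partial>lborel) \<in> borel_measurable lborel"
      by measurable
    have m2: "(\<lambda>x. \<integral>\<^sup>+z. indicator {0<..<t} (fst z) * ennreal (cmod (heat_kernel \<nu> (t - fst z) (x - snd z)) * cmod (U z)) \<partial>lborel) \<in> borel_measurable lborel"
      by measurable
    have "(\<integral>\<^sup>+x. ennreal (\<rho> x * cmod (V (t, x))) \<partial>lborel) \<le>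
       (\<integral>\<^sup>+x. ennreal (\<rho> x) * (\<integral>\<^sup>+y. ennreal (cmod (heat_kernel \<nu> t (x - y)) * cmod (u0 y)) \<partial>lborel) +
         ennreal (\<rho> x) * (\<integral>\<^sup>+z. indicator {0<..<t} (fst z) * ennreal (cmod (heat_kernel \<nu> (t - fst z) (x - snd z)) * cmod (U z)) \<partial>lborel) \<partial>lborel)"
      using duhamel_norm_le[OF t]
      by (intro nn_integral_mono_AE)
         (auto elim!: eventually_mono simp: ennreal_mult \<rho>0 distrib_left[symmetric] intro!: mult_left_mono)
    also have "\<dots> = ?I0 + ?I1"
      using m1 m2 by (intro nn_integral_add) auto
    also have "?I0 \<le> ennreal (B * m0 + B * l0 * \<tau>)"
    proof -
      have "?I0 = (\<integral>\<^sup>+x. \<integral>\<^sup>+y. ennreal (\<rho> x * cmod (heat_kernel \<nu> t (x - y))) * ennreal (cmod (u0 y)) \<partial>lborel \<partial>lborel)"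
        by (simp add: nn_integral_cmult[symmetric] ennreal_mult \<rho>0 mult.assoc)
      also have "\<dots> = (\<integral>\<^sup>+y. \<integral>\<^sup>+x. ennreal (\<rho> x * cmod (heat_kernel \<nu> t (x - y))) * ennreal (cmod (u0 y)) \<partial>lborel \<partial>lborel)"
        by (rule nn_integral_lborel_swap) measurable
      also have "\<dots> = (\<integral>\<^sup>+y. (\<integral>\<^sup>+x. ennreal (\<rho> x * cmod (heat_kernel \<nu> t (x - y))) \<partial>lborel) * ennreal (cmod (u0 y)) \<partial>lborel)"
        by (simp add: nn_integral_multc)
      also have "\<dots> \<le> (\<integral>\<^sup>+y. ennreal B * (ennreal (norm y ^ m * cmod (u0 y)) + ennreal \<tau> * ennreal (cmod (u0 y))) \<partial>lborel)"
      proof (intro nn_integral_mono)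
        fix y :: "real^'n"
        have "(\<integral>\<^sup>+x. ennreal (\<rho> x * cmod (heat_kernel \<nu> t (x - y))) \<partial>lborel) \<le> ennreal (B * (\<rho> y + \<tau>))"
          using km[OF t R, of y] by (simp add: \<rho>_def \<tau>_def)
        also have "\<dots> \<le> ennreal (B * (norm y ^ m + \<tau>))"
          using B R by (intro ennreal_leI mult_left_mono add_right_mono) (auto simp: \<rho>_def intro!: power_mono)
        finally have "(\<integral>\<^sup>+x. ennreal (\<rho> x * cmod (heat_kernel \<nu> t (x - y))) \<partial>lborel) * ennreal (cmod (u0 y)) \<le>
            ennreal (B * (norm y ^ m + \<tau>)) * ennreal (cmod (u0 y))" by (rule mult_right_mono) simp
        also have "\<dots> = ennreal B * (ennreal (norm y ^ m * cmod (u0 y)) + ennreal \<tau> * ennreal (cmod (u0 y)))"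
          using B \<tau> by (simp add: ennreal_mult[symmetric] ennreal_plus[symmetric] algebra_simps del: ennreal_plus)
        finally show "(\<integral>\<^sup>+x. ennreal (\<rho> x * cmod (heat_kernel \<nu> t (x - y))) \<partial>lborel) * ennreal (cmod (u0 y)) \<le>
            ennreal B * (ennreal (norm y ^ m * cmod (u0 y)) + ennreal \<tau> * ennreal (cmod (u0 y)))" .
      qed
      also have "\<dots> = ennreal B * (ennreal m0 + ennreal \<tau> * ennreal l0)"
        by (simp add: nn_integral_cmult nn_integral_add l0 m0)
      also have "\<dots> = ennreal (B * m0 + B * l0 * \<tau>)"
        using B \<tau> l0(2) m0(2) by (simp add: ennreal_mult[symmetric] ennreal_plus[symmetric] algebra_simps del: ennreal_plus)
      finally show ?thesis .
    qed
    \<comment> \<open>After Tonelli the weight sits on the kernel. Of the two terms that result, the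
      one with the weight at y becomes the integral for Gronwall's inequality, and the one with (t -
      s)^{m/2} \<le> t^{m/2} is paid for by the mass bound M.\<close>
    also have "?I1 \<le> (\<integral>\<^sup>+s. indicator {0<..<t} s * ennreal ((B * h + 1) * (1 + s) powr (- a)) *
         (\<integral>\<^sup>+x. ennreal (\<rho> x * cmod (V (s, x))) \<partial>lborel) \<partial>lborel) + ennreal (B * h * M / (a - 1) * \<tau>)"
    proof -
      let ?k = "\<lambda>x z. ennreal (\<rho> x * cmod (heat_kernel \<nu> (t - fst z) (x - snd z)))"
      let ?u = "\<lambda>z. indicator {0<..<t} (fst z) * ennreal (cmod (U z))"
      have "?I1 = (\<integral>\<^sup>+x. \<integral>\<^sup>+z. ?k x z * ?u z \<partial>lborel \<partial>lborel)"
        by (intro nn_integral_cong, subst nn_integral_cmult[symmetric], measurable)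
           (intro nn_integral_cong, simp add: ennreal_mult \<rho>0 mult_ac)
      also have "\<dots> = (\<integral>\<^sup>+z. \<integral>\<^sup>+x. ?k x z * ?u z \<partial>lborel \<partial>lborel)"
        by (rule nn_integral_lborel_swap) measurable
      also have "\<dots> = (\<integral>\<^sup>+z. (\<integral>\<^sup>+x. ?k x z \<partial>lborel) * ?u z \<partial>lborel)"
        by (simp add: nn_integral_multc)
      also have "\<dots> \<le> (\<integral>\<^sup>+z. indicator {0<..<t} (fst z) * ennreal (B * h * (1 + fst z) powr (- a)) *
          (ennreal (\<rho> (snd z) * cmod (V z)) + ennreal \<tau> * ennreal (cmod (V z))) \<partial>lborel)"
      proof (intro nn_integral_mono)
        fix z :: "real \<times> (real^'n)"
        obtain s y where z: "z = (s, y)" by (cases z)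
        show "(\<integral>\<^sup>+x. ?k x z \<partial>lborel) * ?u z \<le> indicator {0<..<t} (fst z) * ennreal (B * h * (1 + fst z) powr (- a)) *
          (ennreal (\<rho> (snd z) * cmod (V z)) + ennreal \<tau> * ennreal (cmod (V z)))"
        proof (cases "0 < s \<and> s < t")
          case True
          have "(\<integral>\<^sup>+x. ?k x z \<partial>lborel) \<le> ennreal (B * (\<rho> y + (t - s) powr (real m / 2)))"
            using km[of "t - s" R y] True R by (simp add: \<rho>_def z)
          also have "\<dots> \<le> ennreal (B * (\<rho> y + \<tau>))"
            using True B unfolding \<tau>_def by (intro ennreal_leI mult_left_mono add_left_mono powr_mono2) auto
          finally have "(\<integral>\<^sup>+x. ?k x z \<partial>lborel) * ennreal (cmod (U z)) \<le>
             ennreal (B * (\<rho> y + \<tau>)) * ennreal (h * (1 + s) powr (- a) * cmod (V z))"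
            using U_V[of s y] True by (intro mult_mono) (auto simp: z intro!: ennreal_leI)
          also have "\<dots> = ennreal (B * h * (1 + s) powr (- a)) * (ennreal (\<rho> y * cmod (V z)) + ennreal \<tau> * ennreal (cmod (V z)))"
            using B h \<tau>(1) \<rho>0[of y] by (simp add: ennreal_mult[symmetric] ennreal_plus[symmetric] algebra_simps del: ennreal_plus)
          finally show ?thesis using True by (simp add: z)
        qed (auto simp: z indicator_def)
      qed
      also have "\<dots> = (\<integral>\<^sup>+s. \<integral>\<^sup>+y. indicator {0<..<t} s * ennreal (B * h * (1 + s) powr (- a)) *
          (ennreal (\<rho> y * cmod (V (s, y))) + ennreal \<tau> * ennreal (cmod (V (s, y)))) \<partial>lborel \<partial>lborel)"
        apply (subst nn_integral_lborel_pair)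
    subgoal by measurable
    subgoal by simp
    done
      also have "\<dots> = (\<integral>\<^sup>+s. indicator {0<..<t} s * ennreal (B * h * (1 + s) powr (- a)) *
          ((\<integral>\<^sup>+y. ennreal (\<rho> y * cmod (V (s, y))) \<partial>lborel) + ennreal \<tau> * (\<integral>\<^sup>+y. ennreal (cmod (V (s, y))) \<partial>lborel)) \<partial>lborel)"
        by (simp add: nn_integral_cmult nn_integral_add)
      also have "\<dots> \<le> (\<integral>\<^sup>+s. indicator {0<..<t} s * ennreal ((B * h + 1) * (1 + s) powr (- a)) *
         (\<integral>\<^sup>+x. ennreal (\<rho> x * cmod (V (s, x))) \<partial>lborel) +
           ennreal (B * h * \<tau> * M) * (ennreal ((1 + s) powr (- a)) * indicator {0..} s) \<partial>lborel)"
      proof (intro nn_integral_mono)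
        fix s :: real
        let ?W = "\<integral>\<^sup>+x. ennreal (\<rho> x * cmod (V (s, x))) \<partial>lborel"
        show "indicator {0<..<t} s * ennreal (B * h * (1 + s) powr (- a)) *
          (?W + ennreal \<tau> * (\<integral>\<^sup>+y. ennreal (cmod (V (s, y))) \<partial>lborel)) \<le>
          indicator {0<..<t} s * ennreal ((B * h + 1) * (1 + s) powr (- a)) * ?W +
           ennreal (B * h * \<tau> * M) * (ennreal ((1 + s) powr (- a)) * indicator {0..} s)"
        proof (cases "0 < s \<and> s < t")
          case True
          have "ennreal (B * h * (1 + s) powr (- a)) * (?W + ennreal \<tau> * (\<integral>\<^sup>+y. ennreal (cmod (V (s, y))) \<partial>lborel)) \<le>
             ennreal (B * h * (1 + s) powr (- a)) * (?W + ennreal \<tau> * ennreal M)"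
            using V_L1[of s] True by (intro mult_left_mono add_left_mono) auto
          also have "\<dots> = ennreal (B * h * (1 + s) powr (- a)) * ?W + ennreal (B * h * \<tau> * M) * ennreal ((1 + s) powr (- a))"
            using B h \<tau>(1) M by (simp add: distrib_left ennreal_mult[symmetric] mult_ac)
          also have "\<dots> \<le> ennreal ((B * h + 1) * (1 + s) powr (- a)) * ?W + ennreal (B * h * \<tau> * M) * ennreal ((1 + s) powr (- a))"
            by (intro add_right_mono mult_right_mono ennreal_leI) auto
          finally show ?thesis using True by simp
        qed (auto simp: indicator_def)
      qed
      also have "\<dots> = (\<integral>\<^sup>+s. indicator {0<..<t} s * ennreal ((B * h + 1) * (1 + s) powr (- a)) *
         (\<integral>\<^sup>+x. ennreal (\<rho> x * cmod (V (s, x))) \<partial>lborel) \<partial>lborel) +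
           ennreal (B * h * \<tau> * M) * (\<integral>\<^sup>+s. ennreal ((1 + s) powr (- a)) * indicator {0..} s \<partial>lborel)"
        by (subst nn_integral_add) (auto simp: nn_integral_cmult)
      also have "ennreal (B * h * \<tau> * M) * (\<integral>\<^sup>+s. ennreal ((1 + s) powr (- a)) * indicator {0..} s \<partial>lborel) =
          ennreal (B * h * M / (a - 1) * \<tau>)"
        unfolding nn_integral_decay_finite[OF a_gt] using B h M \<tau>(1) a_gt
        by (subst ennreal_mult[symmetric]) (auto simp: mult_ac)
      finally show ?thesis .
    qed
    finally have "(\<integral>\<^sup>+x. ennreal (\<rho> x * cmod (V (t, x))) \<partial>lborel) \<le> ennreal (B * m0 + B * l0 * \<tau>) +
      ((\<integral>\<^sup>+s. indicator {0<..<t} s * ennreal ((B * h + 1) * (1 + s) powr (- a)) *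
         (\<integral>\<^sup>+x. ennreal (\<rho> x * cmod (V (s, x))) \<partial>lborel) \<partial>lborel) + ennreal (B * h * M / (a - 1) * \<tau>))"
      by (simp add: add_mono)
    also have "\<dots> = ennreal (B * m0 + B * l0 * \<tau> + B * h * M / (a - 1) * \<tau>) + (\<integral>\<^sup>+s. indicator {0<..<t} s * ennreal ((B * h + 1) * (1 + s) powr (- a)) *
         (\<integral>\<^sup>+x. ennreal (\<rho> x * cmod (V (s, x))) \<partial>lborel) \<partial>lborel)"
      using B h M \<tau>(1) l0(2) m0(2) a_gt by (subst ennreal_plus) (auto simp: add_ac)
    also have "ennreal (B * m0 + B * l0 * \<tau> + B * h * M / (a - 1) * \<tau>) \<le> ennreal (A * (1 + t) powr (real m / 2))"
    proof (rule ennreal_leI)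
      have "B * m0 * 1 + B * l0 * \<tau> + B * h * M / (a - 1) * \<tau> \<le>
         B * m0 * (1 + t) powr (real m / 2) + B * l0 * (1 + t) powr (real m / 2) + B * h * M / (a - 1) * (1 + t) powr (real m / 2)"
        using B h M \<tau> l0(2) m0(2) a_gt by (intro add_mono mult_left_mono) auto
      then show "B * m0 + B * l0 * \<tau> + B * h * M / (a - 1) * \<tau> \<le> A * (1 + t) powr (real m / 2)"
        by (simp add: A_def distrib_right)
    qed
    finally show "(\<integral>\<^sup>+x. ennreal (min (norm x) R ^ m * cmod (V (t, x))) \<partial>lborel) \<le> ennreal (A * (1 + t) powr (real m / 2)) +
      (\<integral>\<^sup>+s. indicator {0<..<t} s * ennreal ((B * h + 1) * (1 + s) powr (- a)) *
         (\<integral>\<^sup>+x. ennreal (min (norm x) R ^ m * cmod (V (s, x))) \<partial>lborel) \<partial>lborel)"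
      by (simp add: \<rho>_def add_right_mono)
  qed (use B h A in \<open>auto simp: add_nonneg_pos\<close>)
qed

text \<open>Gronwall's inequality is run on (0, T] with the constant A (1 + T)^{m/2}, which
  dominates the growing inhomogeneity there, so the moment at time T inherits exactly this growth.
  Letting R run through the integers removes the truncation by monotone convergence.\<close>

lemma moment_bound:
  obtains C where "0 \<le> C"
    "\<And>t. 0 < t \<Longrightarrow> (\<integral>\<^sup>+x. ennreal (norm x ^ m * cmod (V (t, x))) \<partial>lborel) \<le> ennreal (C * (1 + t) powr (real m / 2))"
proof -
  from truncated_moment_ineq obtain B A where B: "0 < B" and A: "0 \<le> A"
    and ineq: "\<And>t R. 0 < t \<Longrightarrow> 0 \<le> R \<Longrightarrow>
      (\<integral>\<^sup>+x. ennreal (min (norm x) R ^ m * cmod (V (t, x))) \<partial>lborel) \<le> ennreal (A * (1 + t) powr (real m / 2)) +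
      (\<integral>\<^sup>+s. indicator {0<..<t} s * ennreal (B * (1 + s) powr (- a)) *
         (\<integral>\<^sup>+x. ennreal (min (norm x) R ^ m * cmod (V (s, x))) \<partial>lborel) \<partial>lborel)"
    by blast
  define C where "C = 2 * A * exp (2 * B / (a - 1))"
  show ?thesis
  proof (rule that[of C])
    fix T :: real assume T: "0 < T"
    have trunc: "(\<integral>\<^sup>+x. ennreal (min (norm x) R ^ m * cmod (V (T, x))) \<partial>lborel) \<le> ennreal (C * (1 + T) powr (real m / 2))"
      if R: "0 \<le> R" for R
    proof -
      have "(\<integral>\<^sup>+x. ennreal (min (norm x) R ^ m * cmod (V (T, x))) \<partial>lborel) \<le>
          ennreal (2 * (A * (1 + T) powr (real m / 2)) * exp (2 * B / (a - 1)))"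
      proof (rule gronwall_decay[where W = "\<lambda>t. \<integral>\<^sup>+x. ennreal (min (norm x) R ^ m * cmod (V (t, x))) \<partial>lborel" and B = "R ^ m * M"])
        fix t :: real assume t: "0 < t" "t \<le> T"
        have "(\<integral>\<^sup>+x. ennreal (min (norm x) R ^ m * cmod (V (t, x))) \<partial>lborel) \<le> (\<integral>\<^sup>+x. ennreal (R ^ m) * ennreal (cmod (V (t, x))) \<partial>lborel)"
          using R by (intro nn_integral_mono) (auto simp: ennreal_mult[symmetric] intro!: ennreal_leI mult_right_mono power_mono)
        also have "\<dots> = ennreal (R ^ m) * (\<integral>\<^sup>+x. ennreal (cmod (V (t, x))) \<partial>lborel)" by (simp add: nn_integral_cmult)
        also have "\<dots> \<le> ennreal (R ^ m) * ennreal M" using V_L1[OF t(1)] by (rule mult_left_mono) simp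
        finally show "(\<integral>\<^sup>+x. ennreal (min (norm x) R ^ m * cmod (V (t, x))) \<partial>lborel) \<le> ennreal (R ^ m * M)"
          using R M by (simp add: ennreal_mult)
        have "A * (1 + t) powr (real m / 2) \<le> A * (1 + T) powr (real m / 2)"
          using A t by (intro mult_left_mono powr_mono2) auto
        then show "(\<integral>\<^sup>+x. ennreal (min (norm x) R ^ m * cmod (V (t, x))) \<partial>lborel) \<le> ennreal (A * (1 + T) powr (real m / 2)) +
          (\<integral>\<^sup>+s. indicator {0<..<t} s * ennreal (B * (1 + s) powr (- a)) *
             (\<integral>\<^sup>+x. ennreal (min (norm x) R ^ m * cmod (V (s, x))) \<partial>lborel) \<partial>lborel)"
          using order_trans[OF ineq[OF t(1) R] add_right_mono[OF ennreal_leI]] by blast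
      qed (use a_gt B A T in auto)
      then show ?thesis by (simp add: C_def mult_ac)
    qed
    have "(\<lambda>k. \<integral>\<^sup>+x. ennreal (min (norm x) (real k) ^ m * cmod (V (T, x))) \<partial>lborel) \<longlonglongrightarrow>
        (\<integral>\<^sup>+x. ennreal (norm x ^ m * cmod (V (T, x))) \<partial>lborel)"
    proof (rule nn_integral_LIMSEQ)
      show "incseq (\<lambda>k x. ennreal (min (norm x) (real k) ^ m * cmod (V (T, x))))"
        by (auto simp: incseq_def le_fun_def intro!: ennreal_leI mult_right_mono power_mono)
      show "(\<lambda>k. ennreal (min (norm x) (real k) ^ m * cmod (V (T, x)))) \<longlonglongrightarrow> ennreal (norm x ^ m * cmod (V (T, x)))" for x
      proof (rule tendsto_eventually, rule eventually_sequentiallyI[of "nat \<lceil>norm x\<rceil>"])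
        fix k assume "nat \<lceil>norm x\<rceil> \<le> k"
        then have "norm x \<le> real k" by (simp add: nat_ceiling_le_eq)
        then show "ennreal (min (norm x) (real k) ^ m * cmod (V (T, x))) = ennreal (norm x ^ m * cmod (V (T, x)))"
          by (simp add: min_def)
      qed
    qed measurable
    then show "(\<integral>\<^sup>+x. ennreal (norm x ^ m * cmod (V (T, x))) \<partial>lborel) \<le> ennreal (C * (1 + T) powr (real m / 2))"
      by (rule LIMSEQ_le_const2) (use trunc in auto)
  qed (use A in \<open>simp add: C_def\<close>)
qed

end

section \<open>Weighted integrability of the data\<close>

lemma heat_kernel_minus_commute: "heat_kernel \<nu> t (x - y) = heat_kernel \<nu> t (y - x)"
  by (simp add: heat_kernel_def gauss_def norm_minus_commute)

lemma borel_measurable_vec_nth_raw [measurable (raw)]: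
  fixes f :: "'a \<Rightarrow> real ^ 'n"
  assumes "f \<in> borel_measurable M"
  shows "(\<lambda>w. f w $ j) \<in> borel_measurable M"
  by (rule measurable_compose[OF assms]) (intro borel_measurable_continuous_onI continuous_intros)

lemma borel_measurable_gauss [measurable (raw)]:
  fixes f :: "'a \<Rightarrow> real ^ 'n"
  assumes "f \<in> borel_measurable M"
  shows "(\<lambda>w. gauss \<nu> (f w)) \<in> borel_measurable M"
proof -
  have "(\<lambda>w. heat_kernel \<nu> 1 (f w)) \<in> borel_measurable M" using assms by measurable
  then show ?thesis by (simp add: heat_kernel_def)
qed

lemma borel_measurable_mi_power [measurable (raw)]:
  fixes f :: "'a \<Rightarrow> real ^ 'n"
  assumes [measurable]: "f \<in> borel_measurable M"
  shows "(\<lambda>w. mi_power (f w) \<alpha>) \<in> borel_measurable M"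
  unfolding mi_power_def by measurable

lemma borel_measurable_hermite [measurable (raw)]:
  fixes f :: "'a \<Rightarrow> real ^ 'n"
  assumes [measurable]: "f \<in> borel_measurable M"
  shows "(\<lambda>w. hermite \<nu> \<alpha> (f w)) \<in> borel_measurable M"
  unfolding hermite_def by measurable

lemma borel_measurable_profile_kernel [measurable (raw)]:
  fixes f h :: "'a \<Rightarrow> real ^ 'n"
  assumes [measurable]: "f \<in> borel_measurable M" "g \<in> borel_measurable M" "h \<in> borel_measurable M"
  shows "(\<lambda>w. profile_kernel \<nu> m t (f w) (g w) (h w)) \<in> borel_measurable M"
  unfolding profile_kernel_def heat_taylor_def by measurable

text \<open>Dominated convergence: the extra factor is at most 1 and tends to 0 pointwise, so the
  moment of order m is the majorant. A moment of order m + 1, which may be infinite, never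
  enters.\<close>

lemma tendsto_weighted_nn_integral_0:
  fixes w g :: "'a \<Rightarrow> real"
  assumes [measurable]: "w \<in> borel_measurable N" "g \<in> borel_measurable N"
    and w: "\<And>z. 0 \<le> w z" and g: "\<And>z. 0 \<le> g z"
    and fin: "(\<integral>\<^sup>+z. ennreal (w z ^ m * g z) \<partial>N) < \<infinity>"
  shows "((\<lambda>t. \<integral>\<^sup>+z. ennreal (w z ^ m * min 1 (t powr (- 1 / 2) * w z) * g z) \<partial>N) \<longlongrightarrow> 0) at_top"
proof (rule tendsto_at_topI_sequentially)
  fix X :: "nat \<Rightarrow> real" assume X: "filterlim X at_top sequentially"
  have "(\<lambda>k. \<integral>\<^sup>+z. ennreal (w z ^ m * min 1 (X k powr (- 1 / 2) * w z) * g z) \<partial>N) \<longlonglongrightarrow> (\<integral>\<^sup>+z. 0 \<partial>N)"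
  proof (rule nn_integral_dominated_convergence[where w = "\<lambda>z. ennreal (w z ^ m * g z)"])
    show "AE z in N. ennreal (w z ^ m * min 1 (X k powr (- 1 / 2) * w z) * g z) \<le> ennreal (w z ^ m * g z)" for k
      using w g by (intro AE_I2 ennreal_leI mult_right_mono) (auto intro!: mult_left_le)
    show "AE z in N. (\<lambda>k. ennreal (w z ^ m * min 1 (X k powr (- 1 / 2) * w z) * g z)) \<longlonglongrightarrow> 0"
    proof (rule AE_I2)
      fix z
      have "(\<lambda>k. X k powr (- 1 / 2)) \<longlonglongrightarrow> 0"
        using X by (intro tendsto_neg_powr) auto
      then have "(\<lambda>k. w z ^ m * min 1 (X k powr (- 1 / 2) * w z) * g z) \<longlonglongrightarrow> w z ^ m * min 1 (0 * w z) * g z"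
        by (intro tendsto_intros)
      then have "(\<lambda>k. ennreal (w z ^ m * min 1 (X k powr (- 1 / 2) * w z) * g z)) \<longlonglongrightarrow> ennreal (w z ^ m * min 1 (0 * w z) * g z)"
        by (rule tendsto_ennrealI)
      then show "(\<lambda>k. ennreal (w z ^ m * min 1 (X k powr (- 1 / 2) * w z) * g z)) \<longlonglongrightarrow> 0" by simp
    qed
  qed (use fin in measurable)
  then show "(\<lambda>k. \<integral>\<^sup>+z. ennreal (w z ^ m * min 1 (X k powr (- 1 / 2) * w z) * g z) \<partial>N) \<longlonglongrightarrow> 0" by simp
qed

lemma power_add_le: "0 \<le> p \<Longrightarrow> 0 \<le> q \<Longrightarrow> (p + q) ^ m \<le> 2 ^ m * (p ^ m + (q::real) ^ m)"
proof -
  assume pq: "0 \<le> p" "0 \<le> q"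
  have "(p + q) ^ m \<le> (2 * max p q) ^ m" using pq by (intro power_mono) auto
  also have "\<dots> = 2 ^ m * max p q ^ m" by (rule power_mult_distrib)
  also have "max p q ^ m \<le> p ^ m + q ^ m" using pq by (auto simp: max_def)
  finally show ?thesis by simp
qed

text \<open>Dominates |y| and, for s \<ge> 0, s^{1/2}. The summand 1 lets the moment of order m
  control all lower ones; the absolute value keeps the weight at least 1 for negative times
  too.\<close>

definition parabolic_weight :: "real \<times> (real ^ 'n) \<Rightarrow> real" where
  "parabolic_weight z = 1 + sqrt \<bar>fst z\<bar> + norm (snd z)"

lemma parabolic_weight_ge_1: "1 \<le> parabolic_weight z"
  by (simp add: parabolic_weight_def)

lemma borel_measurable_parabolic_weight [measurable]: "parabolic_weight \<in> borel_measurable borel"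
  unfolding parabolic_weight_def[abs_def] by measurable

context duhamel_data
begin

lemma u0_weight_finite: "(\<integral>\<^sup>+y. ennreal (parabolic_weight (0, y) ^ m * cmod (u0 y)) \<partial>lborel) < \<infinity>"
proof -
  have "(\<integral>\<^sup>+y. ennreal (parabolic_weight (0, y) ^ m * cmod (u0 y)) \<partial>lborel) \<le>
      (\<integral>\<^sup>+y. ennreal (2 ^ m) * (ennreal (cmod (u0 y)) + ennreal (norm y ^ m * cmod (u0 y))) \<partial>lborel)"
  proof (intro nn_integral_mono)
    fix y :: "real ^ 'n"
    have "parabolic_weight (0, y) ^ m * cmod (u0 y) \<le> 2 ^ m * (1 ^ m + norm y ^ m) * cmod (u0 y)"
      using power_add_le[of 1 "norm y" m] by (intro mult_right_mono) (auto simp: parabolic_weight_def)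
    then have "ennreal (parabolic_weight (0, y) ^ m * cmod (u0 y)) \<le> ennreal (2 ^ m * (1 + norm y ^ m) * cmod (u0 y))"
      by (intro ennreal_leI) simp
    also have "\<dots> = ennreal (2 ^ m) * (ennreal (cmod (u0 y)) + ennreal (norm y ^ m * cmod (u0 y)))"
      by (simp add: ennreal_mult[symmetric] ennreal_plus[symmetric] algebra_simps del: ennreal_plus)
    finally show "ennreal (parabolic_weight (0, y) ^ m * cmod (u0 y)) \<le>
        ennreal (2 ^ m) * (ennreal (cmod (u0 y)) + ennreal (norm y ^ m * cmod (u0 y)))" .
  qed
  also have "\<dots> = ennreal (2 ^ m) * ((\<integral>\<^sup>+y. ennreal (cmod (u0 y)) \<partial>lborel) + (\<integral>\<^sup>+y. ennreal (norm y ^ m * cmod (u0 y)) \<partial>lborel))"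
    by (simp add: nn_integral_cmult nn_integral_add)
  also have "\<dots> < \<infinity>" using u0_int u0_mom by (simp add: ennreal_mult_less_top)
  finally show ?thesis .
qed

text \<open>Both s^{m/2} times the mass of \<open>V\<close> and its spatial moment grow at most like
  (1 + s)^{m/2}, while the source carries (1 + s)^{-a}. The condition 1 + m/2 < a is integrability
  in time of the product of these powers.\<close>

lemma U_weight_finite: "(\<integral>\<^sup>+z. ennreal (parabolic_weight z ^ m * cmod (U z)) \<partial>lborel) < \<infinity>"
proof -
  obtain C where C: "0 \<le> C" and mom: "\<And>t. 0 < t \<Longrightarrow>
      (\<integral>\<^sup>+x. ennreal (norm x ^ m * cmod (V (t, x))) \<partial>lborel) \<le> ennreal (C * (1 + t) powr (real m / 2))"
    using moment_bound by blast
  define D where "D = h * 2 ^ m * (2 ^ m * M + C)"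
  have D: "0 \<le> D" using C h M by (simp add: D_def)
  have "(\<integral>\<^sup>+z. ennreal (parabolic_weight z ^ m * cmod (U z)) \<partial>lborel) =
      (\<integral>\<^sup>+s. \<integral>\<^sup>+y. ennreal (parabolic_weight (s, y) ^ m * cmod (U (s, y))) \<partial>lborel \<partial>lborel)"
    apply (subst nn_integral_lborel_pair)
    subgoal by measurable
    subgoal by simp
    done
  also have "\<dots> \<le> (\<integral>\<^sup>+s. ennreal D * (ennreal ((1 + s) powr (- (a - real m / 2))) * indicator {0..} s) \<partial>lborel)"
  proof (intro nn_integral_mono)
    fix s :: real
    show "(\<integral>\<^sup>+y. ennreal (parabolic_weight (s, y) ^ m * cmod (U (s, y))) \<partial>lborel) \<le>
        ennreal D * (ennreal ((1 + s) powr (- (a - real m / 2))) * indicator {0..} s)"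
    proof (cases "0 < s")
      case s: True
      define p where "p = (1 + s) powr (real m / 2)"
      have p: "0 \<le> p" by (simp add: p_def)
      have sq: "(1 + sqrt s) ^ m \<le> 2 ^ m * p"
      proof -
        have q: "1 \<le> sqrt (1 + s)" "sqrt s \<le> sqrt (1 + s)" using s by auto
        have "1 + sqrt s \<le> 2 * sqrt (1 + s)" using q by linarith
        then have "(1 + sqrt s) ^ m \<le> (2 * sqrt (1 + s)) ^ m" using s by (intro power_mono) auto
        also have "\<dots> = 2 ^ m * p"
          using s by (simp add: p_def power_mult_distrib powr_half_sqrt[symmetric] powr_realpow[symmetric] powr_powr)
        finally show ?thesis .
      qed
      define k where "k = h * (1 + s) powr (- a) * 2 ^ m"
      have k: "0 \<le> k" using h by (simp add: k_def)
      have "(\<integral>\<^sup>+y. ennreal (parabolic_weight (s, y) ^ m * cmod (U (s, y))) \<partial>lborel) \<le>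
        (\<integral>\<^sup>+y. ennreal k * (ennreal (2 ^ m * p) * ennreal (cmod (V (s, y))) + ennreal (norm y ^ m * cmod (V (s, y)))) \<partial>lborel)"
      proof (intro nn_integral_mono)
        fix y :: "real ^ 'n"
        have "parabolic_weight (s, y) ^ m \<le> 2 ^ m * ((1 + sqrt s) ^ m + norm y ^ m)"
          using power_add_le[of "1 + sqrt s" "norm y" m] s by (simp add: parabolic_weight_def)
        also have "\<dots> \<le> 2 ^ m * (2 ^ m * p + norm y ^ m)"
          using sq by (intro mult_left_mono add_right_mono) auto
        finally have "parabolic_weight (s, y) ^ m * cmod (U (s, y)) \<le>
            (2 ^ m * (2 ^ m * p + norm y ^ m)) * (h * (1 + s) powr (- a) * cmod (V (s, y)))"
          using U_V[OF s, of y] p by (intro mult_mono) auto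
        also have "\<dots> = k * ((2 ^ m * p) * cmod (V (s, y)) + norm y ^ m * cmod (V (s, y)))"
          by (simp add: k_def algebra_simps)
        finally have "ennreal (parabolic_weight (s, y) ^ m * cmod (U (s, y))) \<le>
            ennreal (k * ((2 ^ m * p) * cmod (V (s, y)) + norm y ^ m * cmod (V (s, y))))" by (rule ennreal_leI)
        then show "ennreal (parabolic_weight (s, y) ^ m * cmod (U (s, y))) \<le>
           ennreal k * (ennreal (2 ^ m * p) * ennreal (cmod (V (s, y))) + ennreal (norm y ^ m * cmod (V (s, y))))"
          using k p by (simp add: ennreal_mult ennreal_plus)
      qed
      also have "\<dots> = ennreal k * (ennreal (2 ^ m * p) * (\<integral>\<^sup>+y. ennreal (cmod (V (s, y))) \<partial>lborel) +
          (\<integral>\<^sup>+y. ennreal (norm y ^ m * cmod (V (s, y))) \<partial>lborel))"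
        by (simp add: nn_integral_cmult nn_integral_add)
      also have "\<dots> \<le> ennreal k * (ennreal (2 ^ m * p) * ennreal M + ennreal (C * p))"
        using V_L1[OF s] mom[OF s] by (intro mult_left_mono add_mono) (auto simp: p_def)
      also have "\<dots> = ennreal (k * (2 ^ m * p * M + C * p))"
        using k p M C by (simp add: ennreal_mult ennreal_plus)
      also have "k * (2 ^ m * p * M + C * p) = D * ((1 + s) powr (- a) * p)"
        by (simp add: D_def k_def algebra_simps)
      also have "(1 + s) powr (- a) * p = (1 + s) powr (- (a - real m / 2))"
        by (simp add: p_def powr_add[symmetric])
      finally show ?thesis using s D by (simp add: ennreal_mult)
    qed (simp add: U_0)
  qed
  also have "\<dots> = ennreal D * ennreal (1 / (a - real m / 2 - 1))"
    using a nn_integral_decay_finite[of "a - real m / 2"] by (subst nn_integral_cmult) auto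
  also have "\<dots> < \<infinity>" by (simp add: ennreal_mult_less_top)
  finally show ?thesis .
qed

section \<open>Error of the Taylor approximation in Duhamel's formula\<close>

definition approx :: "real \<Rightarrow> real ^ 'n \<Rightarrow> complex" where
  "approx t x = (\<integral>y. profile_kernel \<nu> m t x 0 y * u0 y \<partial>lborel) +
     (\<integral>z. profile_kernel \<nu> m t x (fst z) (snd z) * U z \<partial>lborel)"

text \<open>For s \<ge> t/2 this is minus the polynomial alone: the profile integrates over all s,
  while the kernel on [t/2, t) is accounted for separately.\<close>

definition remainder :: "real \<Rightarrow> real ^ 'n \<Rightarrow> real \<times> (real ^ 'n) \<Rightarrow> complex" where
  "remainder t x z = (if fst z < t / 2 then heat_kernel \<nu> (t - fst z) (x - snd z) else 0) - profile_kernel \<nu> m t x (fst z) (snd z)"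

lemma borel_measurable_remainder [measurable (raw)]:
  assumes [measurable]: "f \<in> borel_measurable N" "g \<in> borel_measurable N"
  shows "(\<lambda>w. remainder t (f w) (g w)) \<in> borel_measurable N"
  unfolding remainder_def by measurable

lemma integrable_weight_bound:
  assumes [measurable]: "k \<in> borel_measurable borel"
    and bd: "\<And>z. 0 \<le> fst z \<Longrightarrow> cmod (k z) \<le> c * parabolic_weight z ^ m"
  shows "integrable lborel (\<lambda>z. k z * U z)" "integrable lborel (\<lambda>y. k (0, y) * u0 y)"
proof -
  have c: "0 \<le> c"
  proof -
    have "cmod (k (0, 0)) \<le> c * parabolic_weight (0, 0 :: real ^ 'n) ^ m" by (rule bd) simp
    then have "cmod (k (0, 0)) \<le> c" by (simp add: parabolic_weight_def)
    then show ?thesis using norm_ge_zero order_trans by blast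
  qed
  show "integrable lborel (\<lambda>z. k z * U z)"
  proof (rule integrableI_bounded)
    have "(\<integral>\<^sup>+z. ennreal (norm (k z * U z)) \<partial>lborel) \<le> (\<integral>\<^sup>+z. ennreal c * ennreal (parabolic_weight z ^ m * cmod (U z)) \<partial>lborel)"
    proof (intro nn_integral_mono)
      fix z :: "real \<times> (real ^ 'n)"
      have "cmod (k z) * cmod (U z) \<le> c * parabolic_weight z ^ m * cmod (U z)"
      proof (cases "0 \<le> fst z")
        case True
        then show ?thesis by (intro mult_right_mono bd) auto
      next
        case False
        then have "U z = 0" using U_0[of "fst z" "snd z"] by simp
        then show ?thesis by simp
      qed
      then show "ennreal (norm (k z * U z)) \<le> ennreal c * ennreal (parabolic_weight z ^ m * cmod (U z))"
        using c by (simp add: norm_mult ennreal_mult'[symmetric] mult.assoc ennreal_leI)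
    qed
    also have "\<dots> = ennreal c * (\<integral>\<^sup>+z. ennreal (parabolic_weight z ^ m * cmod (U z)) \<partial>lborel)"
      by (rule nn_integral_cmult) measurable
    also have "\<dots> < \<infinity>" using U_weight_finite by (simp add: ennreal_mult_less_top)
    finally show "(\<integral>\<^sup>+z. ennreal (norm (k z * U z)) \<partial>lborel) < \<infinity>" .
  qed measurable
  show "integrable lborel (\<lambda>y. k (0, y) * u0 y)"
  proof (rule integrableI_bounded)
    have "(\<integral>\<^sup>+y. ennreal (norm (k (0, y) * u0 y)) \<partial>lborel) \<le> (\<integral>\<^sup>+y. ennreal c * ennreal (parabolic_weight (0, y) ^ m * cmod (u0 y)) \<partial>lborel)"
    proof (intro nn_integral_mono)
      fix y :: "real ^ 'n"
      have "cmod (k (0, y)) * cmod (u0 y) \<le> c * parabolic_weight (0, y) ^ m * cmod (u0 y)"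
        by (intro mult_right_mono bd) auto
      then show "ennreal (norm (k (0, y) * u0 y)) \<le> ennreal c * ennreal (parabolic_weight (0, y) ^ m * cmod (u0 y))"
        using c by (simp add: norm_mult ennreal_mult'[symmetric] mult.assoc ennreal_leI)
    qed
    also have "\<dots> = ennreal c * (\<integral>\<^sup>+y. ennreal (parabolic_weight (0, y) ^ m * cmod (u0 y)) \<partial>lborel)"
      by (rule nn_integral_cmult) measurable
    also have "\<dots> < \<infinity>" using u0_weight_finite by (simp add: ennreal_mult_less_top)
    finally show "(\<integral>\<^sup>+y. ennreal (norm (k (0, y) * u0 y)) \<partial>lborel) < \<infinity>" .
  qed measurable
qed


lemma remainder_bound:
  obtains C b where "0 < C" "0 < b"
    "\<And>t x z. 0 < t \<Longrightarrow> 0 \<le> fst z \<Longrightarrow> cmod (remainder t x z) \<le>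
       C * t powr (- real m / 2) * (parabolic_weight z ^ m * min 1 (t powr (- 1 / 2) * parabolic_weight z)) *
         (t powr (- real CARD('n) / 2) * (exp (- b * (norm x)\<^sup>2 / t) + exp (- b * (norm (x - snd z))\<^sup>2 / t)))"
proof -
  from profile_kernel_remainder[OF nu, where 'n = 'n and m = m] obtain C b where Cb: "0 < C" "0 < b"
    and bd: "\<And>t (x::real^'n) y s w. 0 < t \<Longrightarrow> 0 \<le> s \<Longrightarrow> sqrt s \<le> w \<Longrightarrow> norm y \<le> w \<Longrightarrow> 0 < w \<Longrightarrow>
       cmod ((if s < t / 2 then heat_kernel \<nu> (t - s) (x - y) else 0) - profile_kernel \<nu> m t x s y)
       \<le> C * t powr (- real m / 2) * (w ^ m * min 1 (t powr (- 1 / 2) * w)) *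
         (t powr (- real CARD('n) / 2) * (exp (- b * (norm x)\<^sup>2 / t) + exp (- b * (norm (x - y))\<^sup>2 / t)))"
    by blast
  show ?thesis
  proof (rule that[OF Cb])
    fix t :: real and x and z :: "real \<times> (real ^ 'n)" assume t: "0 < t" and z: "0 \<le> fst z"
    have w: "sqrt (fst z) \<le> parabolic_weight z" "norm (snd z) \<le> parabolic_weight z" "0 < parabolic_weight z"
      using real_sqrt_ge_zero[OF z] norm_ge_zero[of "snd z"]
      unfolding parabolic_weight_def abs_of_nonneg[OF z] by linarith+
    show "cmod (remainder t x z) \<le>
       C * t powr (- real m / 2) * (parabolic_weight z ^ m * min 1 (t powr (- 1 / 2) * parabolic_weight z)) *
         (t powr (- real CARD('n) / 2) * (exp (- b * (norm x)\<^sup>2 / t) + exp (- b * (norm (x - snd z))\<^sup>2 / t)))"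
      unfolding remainder_def by (rule bd[OF t z w])
  qed
qed

text \<open>The constant depends on t. This bound and the next one only make the integrals below
  converge, so that they may be split and subtracted.\<close>

lemma near_kernel_bound:
  assumes t: "0 < t"
  shows "\<exists>c. \<forall>x z. 0 \<le> fst z \<longrightarrow>
    cmod (if fst z < t / 2 then heat_kernel \<nu> (t - fst z) (x - snd z :: real ^ 'n) else 0) \<le> c * parabolic_weight z ^ m"
proof -
  from heat_kernel_bound[OF nu, where 'n = 'n and m = m] obtain C b where C: "0 < C" "0 < b"
    and bd: "\<And>t (z :: real^'n). 0 < t \<Longrightarrow> cmod (heat_kernel \<nu> t z) \<le> C * (t powr (- real CARD('n) / 2) * exp (- b * (norm z)\<^sup>2 / t))"
    and "\<And>t (z :: real^'n). 0 < t \<Longrightarrow> (norm z) ^ m * cmod (heat_kernel \<nu> t z) \<le>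
       C * t powr (real m / 2) * (t powr (- real CARD('n) / 2) * exp (- b * (norm z)\<^sup>2 / t))"
    by metis
  show ?thesis
  proof (intro exI[of _ "C * (t / 2) powr (- real CARD('n) / 2)"] allI impI)
    fix x :: "real ^ 'n" and z :: "real \<times> (real ^ 'n)" assume z: "0 \<le> fst z"
    have "cmod (if fst z < t / 2 then heat_kernel \<nu> (t - fst z) (x - snd z) else 0) \<le> C * (t / 2) powr (- real CARD('n) / 2)"
    proof (cases "fst z < t / 2")
      case True
      then have "cmod (heat_kernel \<nu> (t - fst z) (x - snd z)) \<le>
          C * ((t - fst z) powr (- real CARD('n) / 2) * exp (- b * (norm (x - snd z))\<^sup>2 / (t - fst z)))"
        using t by (intro bd) auto
      also have "\<dots> \<le> C * ((t / 2) powr (- real CARD('n) / 2) * 1)"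
      proof -
        have 1: "(t - fst z) powr (- real CARD('n) / 2) \<le> (t / 2) powr (- real CARD('n) / 2)"
          using True t by (intro powr_mono2') auto
        have 2: "exp (- b * (norm (x - snd z))\<^sup>2 / (t - fst z)) \<le> 1"
          using True t C by simp
        show ?thesis by (rule mult_left_mono[OF mult_mono[OF 1 2]]) (use C in auto)
      qed
      finally show ?thesis using True by simp
    qed (use C in auto)
    also have "\<dots> \<le> C * (t / 2) powr (- real CARD('n) / 2) * parabolic_weight z ^ m"
      using mult_left_mono[OF one_le_power[OF parabolic_weight_ge_1[of z], of m], of "C * (t / 2) powr (- real CARD('n) / 2)"] C
      by simp
    finally show "cmod (if fst z < t / 2 then heat_kernel \<nu> (t - fst z) (x - snd z) else 0) \<le>
        C * (t / 2) powr (- real CARD('n) / 2) * parabolic_weight z ^ m" .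
  qed
qed

lemma remainder_weight_bound:
  assumes t: "0 < t"
  shows "\<exists>c. \<forall>x z. 0 \<le> fst z \<longrightarrow> cmod (remainder t x z) \<le> c * parabolic_weight z ^ m"
proof -
  obtain C b where C: "0 < C" "0 < b" and bd: "\<And>t x z. 0 < t \<Longrightarrow> 0 \<le> fst z \<Longrightarrow> cmod (remainder t x z) \<le>
       C * t powr (- real m / 2) * (parabolic_weight z ^ m * min 1 (t powr (- 1 / 2) * parabolic_weight z)) *
         (t powr (- real CARD('n) / 2) * (exp (- b * (norm x)\<^sup>2 / t) + exp (- b * (norm (x - snd z))\<^sup>2 / t)))"
    using remainder_bound by blast
  show ?thesis
  proof (intro exI[of _ "C * t powr (- real m / 2) * (t powr (- real CARD('n) / 2) * 2)"] allI impI)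
    fix x and z :: "real \<times> (real ^ 'n)" assume z: "0 \<le> fst z"
    have w: "0 \<le> parabolic_weight z" using parabolic_weight_ge_1[of z] by linarith
    have "exp (- b * (norm x)\<^sup>2 / t) + exp (- b * (norm (x - snd z))\<^sup>2 / t) \<le> 1 + 1"
      using C t by (intro add_mono) auto
    then have "C * t powr (- real m / 2) * (parabolic_weight z ^ m * min 1 (t powr (- 1 / 2) * parabolic_weight z)) *
         (t powr (- real CARD('n) / 2) * (exp (- b * (norm x)\<^sup>2 / t) + exp (- b * (norm (x - snd z))\<^sup>2 / t))) \<le>
       C * t powr (- real m / 2) * (parabolic_weight z ^ m * 1) * (t powr (- real CARD('n) / 2) * 2)"
    proof -
      assume E: "exp (- b * (norm x)\<^sup>2 / t) + exp (- b * (norm (x - snd z))\<^sup>2 / t) \<le> 1 + 1"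
      have 1: "parabolic_weight z ^ m * min 1 (t powr (- 1 / 2) * parabolic_weight z) \<le> parabolic_weight z ^ m * 1"
        using w by (intro mult_left_mono) auto
      have 2: "t powr (- real CARD('n) / 2) * (exp (- b * (norm x)\<^sup>2 / t) + exp (- b * (norm (x - snd z))\<^sup>2 / t)) \<le>
          t powr (- real CARD('n) / 2) * 2"
        using E by (intro mult_left_mono) auto
      show ?thesis
        by (rule mult_mono[OF mult_left_mono[OF 1] 2]) (use C w in auto)
    qed
    with bd[OF t z, of x] show "cmod (remainder t x z) \<le> C * t powr (- real m / 2) * (t powr (- real CARD('n) / 2) * 2) * parabolic_weight z ^ m"
      by (simp add: mult_ac)
  qed
qed

text \<open>Duhamel's integral is cut at t/2. Before t/2 the kernel is bounded, the time integral
  becomes a joint integral over (s, y), and subtracting the profile leaves the remainder. From t/2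
  on the kernel is kept as it is.\<close>

lemma duhamel_error_le:
  assumes t: "0 < t"
  shows "AE x in lborel. ennreal (cmod (V (t, x) - approx t x)) \<le>
    (\<integral>\<^sup>+y. ennreal (cmod (remainder t x (0, y)) * cmod (u0 y)) \<partial>lborel) +
    (\<integral>\<^sup>+z. ennreal (cmod (remainder t x z) * cmod (U z)) \<partial>lborel) +
    (\<integral>\<^sup>+z. indicator {t / 2..<t} (fst z) * ennreal (cmod (heat_kernel \<nu> (t - fst z) (x - snd z)) * cmod (U z)) \<partial>lborel)"
  using duhamel[OF t]
proof (rule eventually_mono, elim conjE)
  fix x
  define I where "I s = (\<integral>y. heat_kernel \<nu> (t - s) (x - y) * U (s, y) \<partial>lborel)" for s
  assume D: "integrable lborel (\<lambda>s. indicator {0<..<t} s *\<^sub>R (\<integral>y. heat_kernel \<nu> (t - s) (x - y) * U (s, y) \<partial>lborel))"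
    and eq: "V (t, x) = (\<integral>y. heat_kernel \<nu> t (x - y) * u0 y \<partial>lborel) +
         (\<integral>s. indicator {0<..<t} s *\<^sub>R (\<integral>y. heat_kernel \<nu> (t - s) (x - y) * U (s, y) \<partial>lborel) \<partial>lborel)"
  define G where "G z = (if fst z < t / 2 then heat_kernel \<nu> (t - fst z) (x - snd z) else 0)" for z
  define P where "P z = profile_kernel \<nu> m t x (fst z) (snd z)" for z
  have [measurable]: "G \<in> borel_measurable borel" "P \<in> borel_measurable borel"
    unfolding G_def P_def by measurable
  have GP: "G z - P z = remainder t x z" for z by (simp add: G_def P_def remainder_def)
  from near_kernel_bound[OF t] obtain c1 where c1': "\<forall>x z. 0 \<le> fst z \<longrightarrow>
      cmod (if fst z < t / 2 then heat_kernel \<nu> (t - fst z) (x - snd z :: real ^ 'n) else 0) \<le> c1 * parabolic_weight z ^ m" ..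
  have c1: "cmod (G z) \<le> c1 * parabolic_weight z ^ m" if "0 \<le> fst z" for z
    unfolding G_def by (rule c1'[rule_format, OF that])
  from remainder_weight_bound[OF t] obtain c2 where
    c2': "\<forall>x z. 0 \<le> fst z \<longrightarrow> cmod (remainder t x z) \<le> c2 * parabolic_weight z ^ m" ..
  note c2 = c2'[rule_format, of _ x]
  have "(\<lambda>z. remainder t x z) \<in> borel_measurable borel" by measurable
  note intG = integrable_weight_bound[of G, OF _ c1, simplified]
    and intR = integrable_weight_bound[of "remainder t x", OF this c2, simplified]
  \<comment> \<open>Integrability against the polynomial is inherited: P is the difference of the
    truncated kernel G and the remainder.\<close>
  have intP: "integrable lborel (\<lambda>z. P z * U z)" "integrable lborel (\<lambda>y. P (0, y) * u0 y)"
  proof -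
    have "(\<lambda>z. P z * U z) = (\<lambda>z. G z * U z - remainder t x z * U z)"
      unfolding GP[symmetric] left_diff_distrib by simp
    then show "integrable lborel (\<lambda>z. P z * U z)" using intG intR by simp
    have "(\<lambda>y. P (0, y) * u0 y) = (\<lambda>y. G (0, y) * u0 y - remainder t x (0, y) * u0 y)"
      unfolding GP[symmetric] left_diff_distrib by simp
    then show "integrable lborel (\<lambda>y. P (0, y) * u0 y)" using intG intR by simp
  qed
  have e0: "(\<integral>y. heat_kernel \<nu> t (x - y) * u0 y \<partial>lborel) - (\<integral>y. P (0, y) * u0 y \<partial>lborel) = (\<integral>y. remainder t x (0, y) * u0 y \<partial>lborel)"
  proof -
    have G0: "G (0, y) = heat_kernel \<nu> t (x - y)" for y using t by (simp add: G_def)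
    have "(\<integral>y. remainder t x (0, y) * u0 y \<partial>lborel) = (\<integral>y. G (0, y) * u0 y - P (0, y) * u0 y \<partial>lborel)"
      by (simp only: GP[symmetric] left_diff_distrib)
    also have "\<dots> = (\<integral>y. G (0, y) * u0 y \<partial>lborel) - (\<integral>y. P (0, y) * u0 y \<partial>lborel)"
      by (rule Bochner_Integration.integral_diff[OF intG(2) intP(2)])
    finally show ?thesis by (simp only: G0)
  qed
  have e1: "(\<integral>z. G z * U z \<partial>lborel) - (\<integral>z. P z * U z \<partial>lborel) = (\<integral>z. remainder t x z * U z \<partial>lborel)"
    unfolding GP[symmetric] left_diff_distrib
    by (rule Bochner_Integration.integral_diff[OF intG(1) intP(1), symmetric])
  have intGpair: "integrable (lborel \<Otimes>\<^sub>M lborel) (\<lambda>(s, y). G (s, y) * U (s, y))"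
    using intG by (simp add: lborel_prod case_prod_beta')
  \<comment> \<open>U vanishes for s \<le> 0 and G for s \<ge> t/2, so the inner integral is
    Duhamel's integrand restricted to (0, t/2).\<close>
  have Gs: "(\<integral>y. G (s, y) * U (s, y) \<partial>lborel) = indicator {0<..<t / 2} s *\<^sub>R I s" for s
    using t U_0[of s] by (auto simp: G_def I_def indicator_def)
  have near: "(\<integral>s. indicator {0<..<t / 2} s *\<^sub>R I s \<partial>lborel) = (\<integral>z. G z * U z \<partial>lborel)"
    using lborel_pair.integral_fst'[OF intGpair] by (simp add: Gs lborel_prod case_prod_beta')
  have near_int: "integrable lborel (\<lambda>s. indicator {0<..<t / 2} s *\<^sub>R I s)"
    using lborel_pair.integrable_fst'[OF intGpair] by (simp add: Gs)
  have split: "indicator {0<..<t} s *\<^sub>R I s - indicator {0<..<t / 2} s *\<^sub>R I s = indicator {t / 2..<t} s *\<^sub>R I s" for s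
    using t by (auto simp: indicator_def)
  have "(\<integral>s. indicator {0<..<t} s *\<^sub>R I s \<partial>lborel) - (\<integral>s. indicator {0<..<t / 2} s *\<^sub>R I s \<partial>lborel) = (\<integral>s. indicator {t / 2..<t} s *\<^sub>R I s \<partial>lborel)"
    using Bochner_Integration.integral_diff[OF D[folded I_def] near_int] unfolding split by simp
  then have "V (t, x) - approx t x = (\<integral>y. remainder t x (0, y) * u0 y \<partial>lborel) + (\<integral>z. remainder t x z * U z \<partial>lborel) +
      (\<integral>s. indicator {t / 2..<t} s *\<^sub>R I s \<partial>lborel)"
    using e0 e1 unfolding eq near approx_def I_def[symmetric] by (simp add: P_def algebra_simps)
  then have "cmod (V (t, x) - approx t x) \<le> norm (\<integral>y. remainder t x (0, y) * u0 y \<partial>lborel) +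
      norm (\<integral>z. remainder t x z * U z \<partial>lborel) + norm (\<integral>s. indicator {t / 2..<t} s *\<^sub>R I s \<partial>lborel)"
    by (simp only: order_trans[OF norm_triangle_ineq add_right_mono[OF norm_triangle_ineq]])
  then have "ennreal (cmod (V (t, x) - approx t x)) \<le> ennreal (norm (\<integral>y. remainder t x (0, y) * u0 y \<partial>lborel)) +
      ennreal (norm (\<integral>z. remainder t x z * U z \<partial>lborel)) + ennreal (norm (\<integral>s. indicator {t / 2..<t} s *\<^sub>R I s \<partial>lborel))"
    by (simp add: ennreal_plus[symmetric] ennreal_leI del: ennreal_plus)
  also have "\<dots> \<le> (\<integral>\<^sup>+y. ennreal (cmod (remainder t x (0, y)) * cmod (u0 y)) \<partial>lborel) +
    (\<integral>\<^sup>+z. ennreal (cmod (remainder t x z) * cmod (U z)) \<partial>lborel) +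
    (\<integral>\<^sup>+z. indicator {t / 2..<t} (fst z) * ennreal (cmod (heat_kernel \<nu> (t - fst z) (x - snd z)) * cmod (U z)) \<partial>lborel)"
    using nn_integral_norm_integral_le[of lborel "\<lambda>y. remainder t x (0, y) * u0 y"]
      nn_integral_norm_integral_le[of lborel "\<lambda>z. remainder t x z * U z"]
      order_trans[OF nn_integral_norm_integral_le duhamel_source_norm_le[of "{t / 2..<t}" t x]]
    by (intro add_mono) (simp_all add: norm_mult I_def)
  finally show "ennreal (cmod (V (t, x) - approx t x)) \<le>
    (\<integral>\<^sup>+y. ennreal (cmod (remainder t x (0, y)) * cmod (u0 y)) \<partial>lborel) +
    (\<integral>\<^sup>+z. ennreal (cmod (remainder t x z) * cmod (U z)) \<partial>lborel) +
    (\<integral>\<^sup>+z. indicator {t / 2..<t} (fst z) * ennreal (cmod (heat_kernel \<nu> (t - fst z) (x - snd z)) * cmod (U z)) \<partial>lborel)" .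
qed


lemma remainder_L1_bound:
  assumes b: "0 < b" and t: "0 < t" and k: "0 \<le> k"
    and bd: "\<And>x. cmod (remainder t x z) \<le>
       k * (t powr (- real CARD('n) / 2) * (exp (- b * (norm x)\<^sup>2 / t) + exp (- b * (norm (x - snd z))\<^sup>2 / t)))"
  shows "(\<integral>\<^sup>+x. ennreal (cmod (remainder t x z)) \<partial>lborel) \<le> ennreal (2 * (pi / b) powr (real CARD('n) / 2) * k)"
proof -
  let ?g = "\<lambda>y x. t powr (- real CARD('n) / 2) * exp (- b * (norm (x - y :: real ^ 'n))\<^sup>2 / t)"
  have "(\<integral>\<^sup>+x. ennreal (cmod (remainder t x z)) \<partial>lborel) \<le>
      (\<integral>\<^sup>+x. ennreal k * (ennreal (?g 0 x) + ennreal (?g (snd z) x)) \<partial>lborel)"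
  proof (intro nn_integral_mono)
    fix x
    have "ennreal (cmod (remainder t x z)) \<le> ennreal (k * (?g 0 x + ?g (snd z) x))"
      using bd[of x] by (intro ennreal_leI) (simp add: distrib_left)
    also have "\<dots> = ennreal k * (ennreal (?g 0 x) + ennreal (?g (snd z) x))"
      using k by (subst ennreal_mult) (auto simp: ennreal_plus)
    finally show "ennreal (cmod (remainder t x z)) \<le> ennreal k * (ennreal (?g 0 x) + ennreal (?g (snd z) x))" .
  qed
  also have "\<dots> = ennreal k * ((\<integral>\<^sup>+x. ennreal (?g 0 x) \<partial>lborel) + (\<integral>\<^sup>+x. ennreal (?g (snd z) x) \<partial>lborel))"
    by (subst nn_integral_cmult, measurable) (subst nn_integral_add, auto)
  also have "\<dots> = ennreal (2 * (pi / b) powr (real CARD('n) / 2) * k)"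
    unfolding nn_integral_gaussian[OF b t] using k
    by (simp add: ennreal_mult[symmetric] ennreal_plus[symmetric] mult_ac del: ennreal_plus)
  finally show ?thesis .
qed

text \<open>The kernel enters only through its L^1 norm, in x for the first estimate and, since it
  is even, in y for the second; its singularity at s = t is therefore harmless. On [t/2, t) the
  source is of size (1 + s)^{-a} in L^1 and (1 + s)^{-a - n/2} pointwise, and the length t/2 of the
  interval adds one power of t.\<close>

lemma far_source_bounds:
  obtains B where "0 < B"
    "\<And>t. 0 < t \<Longrightarrow> (\<integral>\<^sup>+x. \<integral>\<^sup>+z. indicator {t / 2..<t} (fst z) * ennreal (cmod (heat_kernel \<nu> (t - fst z) (x - snd z)) * cmod (U z)) \<partial>lborel \<partial>lborel)
       \<le> ennreal (B * t powr (1 - a))"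
    "\<And>t x. 0 < t \<Longrightarrow> (\<integral>\<^sup>+z. indicator {t / 2..<t} (fst z) * ennreal (cmod (heat_kernel \<nu> (t - fst z) (x - snd z)) * cmod (U z)) \<partial>lborel)
       \<le> ennreal (B * t powr (1 - a - real CARD('n) / 2))"
proof -
  from heat_kernel_weighted_integral[OF nu, where 'n = 'n and m = m] obtain B where B: "0 < B"
    and k0: "\<And>t (y::real^'n). 0 < t \<Longrightarrow> (\<integral>\<^sup>+x. ennreal (cmod (heat_kernel \<nu> t (x - y))) \<partial>lborel) \<le> ennreal B"
    and "\<And>t (y::real^'n) R. 0 < t \<Longrightarrow> 0 \<le> R \<Longrightarrow>
       (\<integral>\<^sup>+x. ennreal (min (norm x) R ^ m * cmod (heat_kernel \<nu> t (x - y))) \<partial>lborel) \<le>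
       ennreal (B * (min (norm y) R ^ m + t powr (real m / 2)))"
    by blast
  define N where "N = real CARD('n) / 2"
  have N: "0 \<le> N" by (simp add: N_def)
  \<comment> \<open>The factor \<open>2 powr (a + N)\<close> pays for replacing t/2 by t in both
    estimates; the summand 1 makes D positive when h or M is 0.\<close>
  define D where "D = B * h * M * 2 powr (a + N) + 1"
  \<comment> \<open>The case e = 0 serves the L^1 estimate, the case e = N the pointwise
    one.\<close>
  have far: "(\<integral>\<^sup>+s. indicator {t / 2..<t} s * ennreal (B * h * M * (1 + s) powr (- (a + e))) \<partial>lborel) \<le> ennreal (D * t powr (1 - a - e))"
    if t: "0 < t" and e: "0 \<le> e" "e \<le> N" for t e
  proof -
    have "(\<integral>\<^sup>+s. indicator {t / 2..<t} s * ennreal (B * h * M * (1 + s) powr (- (a + e))) \<partial>lborel) \<le>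
        (\<integral>\<^sup>+s. ennreal (B * h * M * (t / 2) powr (- (a + e))) * indicator {t / 2..<t} s \<partial>lborel)"
    proof (intro nn_integral_mono)
      fix s :: real
      have "(1 + s) powr (- (a + e)) \<le> (t / 2) powr (- (a + e))" if "t / 2 \<le> s"
        using that t e a_gt by (intro powr_mono2') auto
      then show "indicator {t / 2..<t} s * ennreal (B * h * M * (1 + s) powr (- (a + e))) \<le>
          ennreal (B * h * M * (t / 2) powr (- (a + e))) * indicator {t / 2..<t} s"
        using B h M by (auto simp: indicator_def intro!: ennreal_leI mult_left_mono)
    qed
    also have "\<dots> = ennreal (B * h * M * (t / 2) powr (- (a + e)) * (t / 2))"
      using t B h M by (subst nn_integral_cmult_indicator) (auto simp: ennreal_mult'[symmetric])
    also have "\<dots> \<le> ennreal (D * t powr (1 - a - e))"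
    proof (rule ennreal_leI)
      have "(t / 2) powr (- (a + e)) * (t / 2) = (t / 2) powr (1 - a - e)"
        using t powr_add[of "t / 2" "- (a + e)" 1] by (simp add: algebra_simps)
      also have "\<dots> = t powr (1 - a - e) * 2 powr (a + e - 1)"
      proof -
        have e': "- (1 - a - e) = a + e - 1" by simp
        have 1: "2 powr (a + e - 1) = inverse (2 powr (1 - a - e))" using powr_minus[of 2 "1 - a - e"] unfolding e' .
        have 2: "(t / 2) powr (1 - a - e) = t powr (1 - a - e) / 2 powr (1 - a - e)" by (rule powr_divide)
        show ?thesis unfolding 1 2 by (rule divide_inverse)
      qed
      also have "\<dots> \<le> t powr (1 - a - e) * 2 powr (a + N)"
        using e by (intro mult_left_mono powr_mono) auto
      finally have "(t / 2) powr (- (a + e)) * (t / 2) \<le> t powr (1 - a - e) * 2 powr (a + N)" .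
      then have "B * h * M * ((t / 2) powr (- (a + e)) * (t / 2)) \<le> B * h * M * (t powr (1 - a - e) * 2 powr (a + N))"
        using B h M by (intro mult_left_mono) auto
      also have "\<dots> \<le> D * t powr (1 - a - e)" unfolding D_def by (simp add: algebra_simps)
      finally show "B * h * M * (t / 2) powr (- (a + e)) * (t / 2) \<le> D * t powr (1 - a - e)" by (simp add: mult.assoc)
    qed
    finally show ?thesis .
  qed
  show ?thesis
  proof (rule that[of D])
    show "0 < D" using B h M by (simp add: D_def add_nonneg_pos)
  next
    fix t :: real assume t: "0 < t"
    have "(\<integral>\<^sup>+x. \<integral>\<^sup>+z. indicator {t / 2..<t} (fst z) * ennreal (cmod (heat_kernel \<nu> (t - fst z) (x - snd z)) * cmod (U z)) \<partial>lborel \<partial>lborel)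
       = (\<integral>\<^sup>+z. \<integral>\<^sup>+x. indicator {t / 2..<t} (fst z) * ennreal (cmod (heat_kernel \<nu> (t - fst z) (x - snd z)) * cmod (U z)) \<partial>lborel \<partial>lborel)"
      by (rule nn_integral_lborel_swap) measurable
    also have "\<dots> \<le> (\<integral>\<^sup>+z. indicator {t / 2..<t} (fst z) * (ennreal B * ennreal (cmod (U z))) \<partial>lborel)"
    proof (intro nn_integral_mono)
      fix z :: "real \<times> (real ^ 'n)"
      have "(\<integral>\<^sup>+x. indicator {t / 2..<t} (fst z) * ennreal (cmod (heat_kernel \<nu> (t - fst z) (x - snd z)) * cmod (U z)) \<partial>lborel)
          = indicator {t / 2..<t} (fst z) * ((\<integral>\<^sup>+x. ennreal (cmod (heat_kernel \<nu> (t - fst z) (x - snd z))) \<partial>lborel) * ennreal (cmod (U z)))"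
        by (simp add: ennreal_mult nn_integral_cmult nn_integral_multc)
      also have "\<dots> \<le> indicator {t / 2..<t} (fst z) * (ennreal B * ennreal (cmod (U z)))"
        using k0[of "t - fst z" "snd z"] by (auto simp: indicator_def intro!: mult_right_mono)
      finally show "(\<integral>\<^sup>+x. indicator {t / 2..<t} (fst z) * ennreal (cmod (heat_kernel \<nu> (t - fst z) (x - snd z)) * cmod (U z)) \<partial>lborel)
          \<le> indicator {t / 2..<t} (fst z) * (ennreal B * ennreal (cmod (U z)))" .
    qed
    also have "\<dots> = (\<integral>\<^sup>+s. \<integral>\<^sup>+y. indicator {t / 2..<t} s * (ennreal B * ennreal (cmod (U (s, y)))) \<partial>lborel \<partial>lborel)"
      apply (subst nn_integral_lborel_pair)
      subgoal by measurable
      subgoal by simp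
      done
    also have "\<dots> \<le> (\<integral>\<^sup>+s. indicator {t / 2..<t} s * ennreal (B * h * M * (1 + s) powr (- (a + 0))) \<partial>lborel)"
    proof (intro nn_integral_mono)
      fix s :: real
      show "(\<integral>\<^sup>+y. indicator {t / 2..<t} s * (ennreal B * ennreal (cmod (U (s, y)))) \<partial>lborel) \<le>
          indicator {t / 2..<t} s * ennreal (B * h * M * (1 + s) powr (- (a + 0)))"
      proof (cases "s \<in> {t / 2..<t}")
        case True
        then have s: "0 < s" using t by auto
        have "(\<integral>\<^sup>+y. ennreal B * ennreal (cmod (U (s, y))) \<partial>lborel) \<le> (\<integral>\<^sup>+y. ennreal (B * (h * (1 + s) powr (- a))) * ennreal (cmod (V (s, y))) \<partial>lborel)"
          using U_V[OF s] B h by (intro nn_integral_mono) (simp add: ennreal_mult[symmetric] ennreal_leI mult.assoc)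
        also have "\<dots> = ennreal (B * (h * (1 + s) powr (- a))) * (\<integral>\<^sup>+y. ennreal (cmod (V (s, y))) \<partial>lborel)"
          by (rule nn_integral_cmult) measurable
        also have "\<dots> \<le> ennreal (B * (h * (1 + s) powr (- a))) * ennreal M" using V_L1[OF s] by (intro mult_left_mono) auto
        also have "\<dots> = ennreal (B * h * M * (1 + s) powr (- (a + 0)))" using B h M by (simp add: ennreal_mult[symmetric] mult_ac)
        finally show ?thesis using True by simp
      qed simp
    qed
    also have "\<dots> \<le> ennreal (D * t powr (1 - a - 0))" using t N by (intro far) auto
    finally show "(\<integral>\<^sup>+x. \<integral>\<^sup>+z. indicator {t / 2..<t} (fst z) * ennreal (cmod (heat_kernel \<nu> (t - fst z) (x - snd z)) * cmod (U z)) \<partial>lborel \<partial>lborel)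
       \<le> ennreal (D * t powr (1 - a))" by simp
  next
    fix t :: real and x assume t: "0 < t"
    have "(\<integral>\<^sup>+z. indicator {t / 2..<t} (fst z) * ennreal (cmod (heat_kernel \<nu> (t - fst z) (x - snd z)) * cmod (U z)) \<partial>lborel)
      = (\<integral>\<^sup>+s. \<integral>\<^sup>+y. indicator {t / 2..<t} s * ennreal (cmod (heat_kernel \<nu> (t - s) (x - y)) * cmod (U (s, y))) \<partial>lborel \<partial>lborel)"
      apply (subst nn_integral_lborel_pair)
      subgoal by measurable
      subgoal by simp
      done
    also have "\<dots> \<le> (\<integral>\<^sup>+s. indicator {t / 2..<t} s * ennreal (B * h * M * (1 + s) powr (- (a + N))) \<partial>lborel)"
    proof (intro nn_integral_mono)
      fix s :: real
      show "(\<integral>\<^sup>+y. indicator {t / 2..<t} s * ennreal (cmod (heat_kernel \<nu> (t - s) (x - y)) * cmod (U (s, y))) \<partial>lborel) \<le>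
          indicator {t / 2..<t} s * ennreal (B * h * M * (1 + s) powr (- (a + N)))"
      proof (cases "s \<in> {t / 2..<t}")
        case True
        then have s: "0 < s" "0 < t - s" using t by auto
        define k where "k = h * M * (1 + s) powr (- (a + N))"
        have k: "0 \<le> k" using h M by (simp add: k_def)
        have U: "cmod (U (s, y)) \<le> k" for y
        proof -
          have "cmod (U (s, y)) \<le> h * (1 + s) powr (- a) * (M * (1 + s) powr (- N))"
            using order_trans[OF U_V[OF s(1), of y] mult_left_mono[OF V_Linf[OF s(1), of y]]] h by (simp add: N_def)
          also have "\<dots> = k" using powr_add[of "1 + s" "- a" "- N"] by (simp add: k_def)
          finally show ?thesis .
        qed
        have "(\<integral>\<^sup>+y. ennreal (cmod (heat_kernel \<nu> (t - s) (x - y)) * cmod (U (s, y))) \<partial>lborel) \<le>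
            (\<integral>\<^sup>+y. ennreal (cmod (heat_kernel \<nu> (t - s) (y - x))) * ennreal k \<partial>lborel)"
          using U k by (intro nn_integral_mono)
            (simp add: ennreal_mult[symmetric] heat_kernel_minus_commute[of \<nu> "t - s" x] ennreal_leI mult_left_mono)
        also have "\<dots> = (\<integral>\<^sup>+y. ennreal (cmod (heat_kernel \<nu> (t - s) (y - x))) \<partial>lborel) * ennreal k"
          by (rule nn_integral_multc) measurable
        also have "\<dots> \<le> ennreal B * ennreal k" using k0[OF s(2), of x] by (intro mult_right_mono) auto
        also have "\<dots> = ennreal (B * h * M * (1 + s) powr (- (a + N)))" using B k by (simp add: ennreal_mult[symmetric] k_def mult.assoc)
        finally show ?thesis using True by simp
      qed simp
    qed
    also have "\<dots> \<le> ennreal (D * t powr (1 - a - N))" using t N by (intro far) auto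
    finally show "(\<integral>\<^sup>+z. indicator {t / 2..<t} (fst z) * ennreal (cmod (heat_kernel \<nu> (t - fst z) (x - snd z)) * cmod (U z)) \<partial>lborel)
       \<le> ennreal (D * t powr (1 - a - real CARD('n) / 2))" by (simp add: N_def)
  qed
qed

text \<open>One function E serves both norms, so that the intermediate exponents can be interpolated
  at each fixed t. It adds the weighted integrals over the initial data and the source, which vanish
  by dominated convergence, and the far part t^{m/2 + 1 - a}, whose exponent is negative.\<close>

theorem asymptotics:
  "\<exists>E. (E \<longlongrightarrow> 0) at_top \<and> (\<forall>t>0.
     (\<integral>\<^sup>+x. ennreal (cmod (V (t, x) - approx t x)) \<partial>lborel) \<le> ennreal (t powr (- real m / 2)) * E t \<and>
     (AE x in lborel. ennreal (cmod (V (t, x) - approx t x)) \<le> ennreal (t powr (- real m / 2 - real CARD('n) / 2)) * E t))"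
proof -
  obtain C b where C: "0 < C" and b: "0 < b" and bd: "\<And>t x z. 0 < t \<Longrightarrow> 0 \<le> fst z \<Longrightarrow> cmod (remainder t x z) \<le>
       C * t powr (- real m / 2) * (parabolic_weight z ^ m * min 1 (t powr (- 1 / 2) * parabolic_weight z)) *
         (t powr (- real CARD('n) / 2) * (exp (- b * (norm x)\<^sup>2 / t) + exp (- b * (norm (x - snd z))\<^sup>2 / t)))"
    using remainder_bound by blast
  obtain B where B: "0 < B"
    and far1: "\<And>t. 0 < t \<Longrightarrow> (\<integral>\<^sup>+x. \<integral>\<^sup>+z. indicator {t / 2..<t} (fst z) * ennreal (cmod (heat_kernel \<nu> (t - fst z) (x - snd z)) * cmod (U z)) \<partial>lborel \<partial>lborel)
       \<le> ennreal (B * t powr (1 - a))"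
    and far2: "\<And>t x. 0 < t \<Longrightarrow> (\<integral>\<^sup>+z. indicator {t / 2..<t} (fst z) * ennreal (cmod (heat_kernel \<nu> (t - fst z) (x - snd z)) * cmod (U z)) \<partial>lborel)
       \<le> ennreal (B * t powr (1 - a - real CARD('n) / 2))"
    using far_source_bounds by blast
  define \<Omega> where "\<Omega> t z = parabolic_weight z ^ m * min 1 (t powr (- 1 / 2) * parabolic_weight z)" for t and z :: "real \<times> (real ^ 'n)"
  have W: "0 \<le> parabolic_weight z" for z :: "real \<times> (real ^ 'n)" using parabolic_weight_ge_1[of z] by linarith
  have \<Omega>0: "0 \<le> \<Omega> t z" for t z using W[of z] by (simp add: \<Omega>_def)
  have [measurable]: "\<Omega> t \<in> borel_measurable borel" for t unfolding \<Omega>_def[abs_def] by measurable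
  define c where "c = (pi / b) powr (real CARD('n) / 2)"
  have c: "0 \<le> c" by (simp add: c_def)
  \<comment> \<open>A common bound for the constants of the pointwise estimate, of the L^1 estimate
    and of the far part.\<close>
  define K where "K = 2 * C + 2 * c * C + B"
  have K: "0 \<le> K" "2 * C \<le> K" "2 * c * C \<le> K" "B \<le> K" using C c B by (auto simp: K_def)
  define J where "J t = (\<integral>\<^sup>+y. ennreal (\<Omega> t (0, y) * cmod (u0 y)) \<partial>lborel) + (\<integral>\<^sup>+z. ennreal (\<Omega> t z * cmod (U z)) \<partial>lborel)" for t
  define E where "E t = ennreal K * J t + ennreal (K * t powr (real m / 2 + 1 - a))" for t
  have "(E \<longlongrightarrow> 0) at_top"
  proof -
    have "((\<lambda>t. \<integral>\<^sup>+y. ennreal (\<Omega> t (0, y) * cmod (u0 y)) \<partial>lborel) \<longlongrightarrow> 0) at_top"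
      unfolding \<Omega>_def by (rule tendsto_weighted_nn_integral_0) (use W u0_weight_finite in auto)
    moreover have "((\<lambda>t. \<integral>\<^sup>+z. ennreal (\<Omega> t z * cmod (U z)) \<partial>lborel) \<longlongrightarrow> 0) at_top"
      unfolding \<Omega>_def by (rule tendsto_weighted_nn_integral_0) (use W U_weight_finite in auto)
    ultimately have "(J \<longlongrightarrow> 0 + 0) at_top" unfolding J_def by (rule tendsto_add)
    then have "((\<lambda>t. ennreal K * J t) \<longlongrightarrow> ennreal K * 0) at_top"
      by (intro ennreal_tendsto_cmult) auto
    moreover have "((\<lambda>t. t powr (real m / 2 + 1 - a)) \<longlongrightarrow> 0) at_top"
      using a by (intro tendsto_neg_powr filterlim_ident) auto
    then have "((\<lambda>t. ennreal (K * t powr (real m / 2 + 1 - a))) \<longlongrightarrow> ennreal (K * 0)) at_top"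
      by (intro tendsto_ennrealI tendsto_mult tendsto_const)
    ultimately have "(E \<longlongrightarrow> ennreal K * 0 + ennreal (K * 0)) at_top" unfolding E_def by (rule tendsto_add)
    then show ?thesis by simp
  qed
  moreover have "(\<integral>\<^sup>+x. ennreal (cmod (V (t, x) - approx t x)) \<partial>lborel) \<le> ennreal (t powr (- real m / 2)) * E t"
    if t: "0 < t" for t
  proof -
    define \<tau> where "\<tau> = t powr (- real m / 2)"
    have \<tau>: "0 \<le> \<tau>" by (simp add: \<tau>_def)
    have R1: "(\<integral>\<^sup>+x. ennreal (cmod (remainder t x z)) \<partial>lborel) \<le> ennreal (K * \<tau>) * ennreal (\<Omega> t z)" if "0 \<le> fst z" for z
    proof -
      have "(\<integral>\<^sup>+x. ennreal (cmod (remainder t x z)) \<partial>lborel) \<le> ennreal (2 * c * (C * \<tau> * \<Omega> t z))"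
        unfolding c_def using bd[OF t that] C \<tau> \<Omega>0[of t z]
        by (intro remainder_L1_bound[OF b t]) (auto simp: \<tau>_def \<Omega>_def)
      also have "\<dots> \<le> ennreal (K * (\<tau> * \<Omega> t z))"
        using mult_right_mono[OF K(3), of "\<tau> * \<Omega> t z"] \<tau> \<Omega>0[of t z] by (intro ennreal_leI) (simp add: mult.assoc)
      finally show ?thesis using K(1) \<tau> \<Omega>0[of t z] by (simp add: ennreal_mult[symmetric] mult.assoc)
    qed
    let ?f = "\<lambda>x z. indicator {t / 2..<t} (fst z) * ennreal (cmod (heat_kernel \<nu> (t - fst z) (x - snd z)) * cmod (U z))"
    have "(\<integral>\<^sup>+x. ennreal (cmod (V (t, x) - approx t x)) \<partial>lborel) \<le>
       (\<integral>\<^sup>+x. (\<integral>\<^sup>+y. ennreal (cmod (remainder t x (0, y)) * cmod (u0 y)) \<partial>lborel) +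
         (\<integral>\<^sup>+z. ennreal (cmod (remainder t x z) * cmod (U z)) \<partial>lborel) + (\<integral>\<^sup>+z. ?f x z \<partial>lborel) \<partial>lborel)"
      by (rule nn_integral_mono_AE[OF duhamel_error_le[OF t]])
    also have "\<dots> = (\<integral>\<^sup>+x. \<integral>\<^sup>+y. ennreal (cmod (remainder t x (0, y)) * cmod (u0 y)) \<partial>lborel \<partial>lborel) +
        (\<integral>\<^sup>+x. \<integral>\<^sup>+z. ennreal (cmod (remainder t x z) * cmod (U z)) \<partial>lborel \<partial>lborel) + (\<integral>\<^sup>+x. \<integral>\<^sup>+z. ?f x z \<partial>lborel \<partial>lborel)"
    proof -
      have m1: "(\<lambda>x. \<integral>\<^sup>+y. ennreal (cmod (remainder t x (0, y)) * cmod (u0 y)) \<partial>lborel) \<in> borel_measurable lborel"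
        by measurable
      have m2: "(\<lambda>x. \<integral>\<^sup>+z. ennreal (cmod (remainder t x z) * cmod (U z)) \<partial>lborel) \<in> borel_measurable lborel"
        by measurable
      have m3: "(\<lambda>x. \<integral>\<^sup>+z. ?f x z \<partial>lborel) \<in> borel_measurable lborel"
        by measurable
      show ?thesis
        by (subst nn_integral_add[OF borel_measurable_add[OF m1 m2] m3], subst nn_integral_add[OF m1 m2]) (rule refl)
    qed
    also have "(\<integral>\<^sup>+x. \<integral>\<^sup>+y. ennreal (cmod (remainder t x (0, y)) * cmod (u0 y)) \<partial>lborel \<partial>lborel) \<le>
        ennreal (K * \<tau>) * (\<integral>\<^sup>+y. ennreal (\<Omega> t (0, y) * cmod (u0 y)) \<partial>lborel)"
    proof -
      have "(\<integral>\<^sup>+x. \<integral>\<^sup>+y. ennreal (cmod (remainder t x (0, y)) * cmod (u0 y)) \<partial>lborel \<partial>lborel) =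
          (\<integral>\<^sup>+y. \<integral>\<^sup>+x. ennreal (cmod (remainder t x (0, y)) * cmod (u0 y)) \<partial>lborel \<partial>lborel)"
        by (rule nn_integral_lborel_swap) measurable
      also have "\<dots> = (\<integral>\<^sup>+y. (\<integral>\<^sup>+x. ennreal (cmod (remainder t x (0, y))) \<partial>lborel) * ennreal (cmod (u0 y)) \<partial>lborel)"
        by (simp add: ennreal_mult nn_integral_multc)
      also have "\<dots> \<le> (\<integral>\<^sup>+y. ennreal (K * \<tau>) * ennreal (\<Omega> t (0, y) * cmod (u0 y)) \<partial>lborel)"
      proof (intro nn_integral_mono)
        fix y :: "real ^ 'n"
        show "(\<integral>\<^sup>+x. ennreal (cmod (remainder t x (0, y))) \<partial>lborel) * ennreal (cmod (u0 y)) \<le> ennreal (K * \<tau>) * ennreal (\<Omega> t (0, y) * cmod (u0 y))"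
          using mult_right_mono[OF R1[of "(0, y)"], of "ennreal (cmod (u0 y))"] \<Omega>0[of t "(0, y)"] by (simp add: ennreal_mult mult.assoc)
      qed
      also have "\<dots> = ennreal (K * \<tau>) * (\<integral>\<^sup>+y. ennreal (\<Omega> t (0, y) * cmod (u0 y)) \<partial>lborel)"
        by (rule nn_integral_cmult) measurable
      finally show ?thesis .
    qed
    also have "(\<integral>\<^sup>+x. \<integral>\<^sup>+z. ennreal (cmod (remainder t x z) * cmod (U z)) \<partial>lborel \<partial>lborel) \<le>
        ennreal (K * \<tau>) * (\<integral>\<^sup>+z. ennreal (\<Omega> t z * cmod (U z)) \<partial>lborel)"
    proof -
      have "(\<integral>\<^sup>+x. \<integral>\<^sup>+z. ennreal (cmod (remainder t x z) * cmod (U z)) \<partial>lborel \<partial>lborel) =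
          (\<integral>\<^sup>+z. \<integral>\<^sup>+x. ennreal (cmod (remainder t x z) * cmod (U z)) \<partial>lborel \<partial>lborel)"
        by (rule nn_integral_lborel_swap) measurable
      also have "\<dots> = (\<integral>\<^sup>+z. (\<integral>\<^sup>+x. ennreal (cmod (remainder t x z)) \<partial>lborel) * ennreal (cmod (U z)) \<partial>lborel)"
        by (simp add: ennreal_mult nn_integral_multc)
      also have "\<dots> \<le> (\<integral>\<^sup>+z. ennreal (K * \<tau>) * ennreal (\<Omega> t z * cmod (U z)) \<partial>lborel)"
      proof (intro nn_integral_mono)
        fix z :: "real \<times> (real ^ 'n)"
        show "(\<integral>\<^sup>+x. ennreal (cmod (remainder t x z)) \<partial>lborel) * ennreal (cmod (U z)) \<le> ennreal (K * \<tau>) * ennreal (\<Omega> t z * cmod (U z))"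
        proof (cases "0 \<le> fst z")
          case True
          then show ?thesis
            using mult_right_mono[OF R1[of z], of "ennreal (cmod (U z))"] \<Omega>0[of t z] by (simp add: ennreal_mult mult.assoc)
        next
          case False
          then have "U z = 0" using U_0[of "fst z" "snd z"] by simp
          then show ?thesis by simp
        qed
      qed
      also have "\<dots> = ennreal (K * \<tau>) * (\<integral>\<^sup>+z. ennreal (\<Omega> t z * cmod (U z)) \<partial>lborel)"
        by (rule nn_integral_cmult) measurable
      finally show ?thesis .
    qed
    also have "(\<integral>\<^sup>+x. \<integral>\<^sup>+z. ?f x z \<partial>lborel \<partial>lborel) \<le> ennreal \<tau> * ennreal (K * t powr (real m / 2 + 1 - a))"
    proof -
      have "\<tau> * t powr (real m / 2 + 1 - a) = t powr (1 - a)"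
        using t by (simp add: \<tau>_def powr_add[symmetric])
      then have "B * t powr (1 - a) \<le> \<tau> * (K * t powr (real m / 2 + 1 - a))"
        using mult_right_mono[OF K(4), of "t powr (1 - a)"] by (simp add: mult_ac)
      then show ?thesis
        using order_trans[OF far1[OF t] ennreal_leI] \<tau> K(1) by (simp add: ennreal_mult[symmetric])
    qed
    finally have "(\<integral>\<^sup>+x. ennreal (cmod (V (t, x) - approx t x)) \<partial>lborel) \<le>
        ennreal (K * \<tau>) * (\<integral>\<^sup>+y. ennreal (\<Omega> t (0, y) * cmod (u0 y)) \<partial>lborel) +
        ennreal (K * \<tau>) * (\<integral>\<^sup>+z. ennreal (\<Omega> t z * cmod (U z)) \<partial>lborel) + ennreal \<tau> * ennreal (K * t powr (real m / 2 + 1 - a))"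
      by (simp add: add_mono)
    also have "\<dots> = ennreal \<tau> * E t"
      unfolding E_def J_def using K(1) \<tau> by (simp add: ennreal_mult distrib_left mult_ac)
    finally show ?thesis by (simp add: \<tau>_def)
  qed
  moreover have "AE x in lborel. ennreal (cmod (V (t, x) - approx t x)) \<le> ennreal (t powr (- real m / 2 - real CARD('n) / 2)) * E t"
    if t: "0 < t" for t
    using duhamel_error_le[OF t]
  proof (rule eventually_mono)
    fix x
    define \<tau> where "\<tau> = t powr (- real m / 2 - real CARD('n) / 2)"
    have \<tau>: "0 \<le> \<tau>" by (simp add: \<tau>_def)
    have R1: "cmod (remainder t x z) \<le> K * \<tau> * \<Omega> t z" if "0 \<le> fst z" for z
    proof -
      have "cmod (remainder t x z) \<le> C * t powr (- real m / 2) * \<Omega> t z *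
         (t powr (- real CARD('n) / 2) * (exp (- b * (norm x)\<^sup>2 / t) + exp (- b * (norm (x - snd z))\<^sup>2 / t)))"
        using bd[OF t that, of x] by (simp add: \<Omega>_def)
      also have "\<dots> \<le> C * t powr (- real m / 2) * \<Omega> t z * (t powr (- real CARD('n) / 2) * (1 + 1))"
      proof -
        have "exp (- b * (norm x)\<^sup>2 / t) + exp (- b * (norm (x - snd z))\<^sup>2 / t) \<le> 1 + 1"
          using b t by (intro add_mono) auto
        then show ?thesis using C \<Omega>0[of t z] by (intro mult_left_mono) auto
      qed
      also have "\<dots> = 2 * C * (t powr (- real m / 2) * t powr (- real CARD('n) / 2) * \<Omega> t z)" by (simp add: mult_ac)
      also have "t powr (- real m / 2) * t powr (- real CARD('n) / 2) = \<tau>"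
        using powr_add[of t "- real m / 2" "- real CARD('n) / 2"] by (simp add: \<tau>_def)
      also have "2 * C * (\<tau> * \<Omega> t z) \<le> K * (\<tau> * \<Omega> t z)" using K(2) \<tau> \<Omega>0[of t z] by (intro mult_right_mono) auto
      finally show ?thesis by (simp add: mult.assoc)
    qed
    assume "ennreal (cmod (V (t, x) - approx t x)) \<le>
      (\<integral>\<^sup>+y. ennreal (cmod (remainder t x (0, y)) * cmod (u0 y)) \<partial>lborel) +
      (\<integral>\<^sup>+z. ennreal (cmod (remainder t x z) * cmod (U z)) \<partial>lborel) +
      (\<integral>\<^sup>+z. indicator {t / 2..<t} (fst z) * ennreal (cmod (heat_kernel \<nu> (t - fst z) (x - snd z)) * cmod (U z)) \<partial>lborel)"
    also have "\<dots> \<le> ennreal (K * \<tau>) * (\<integral>\<^sup>+y. ennreal (\<Omega> t (0, y) * cmod (u0 y)) \<partial>lborel) +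
      ennreal (K * \<tau>) * (\<integral>\<^sup>+z. ennreal (\<Omega> t z * cmod (U z)) \<partial>lborel) + ennreal \<tau> * ennreal (K * t powr (real m / 2 + 1 - a))"
    proof (intro add_mono)
      have "(\<integral>\<^sup>+y. ennreal (cmod (remainder t x (0, y)) * cmod (u0 y)) \<partial>lborel) \<le>
          (\<integral>\<^sup>+y. ennreal (K * \<tau>) * ennreal (\<Omega> t (0, y) * cmod (u0 y)) \<partial>lborel)"
      proof (intro nn_integral_mono)
        fix y :: "real ^ 'n"
        have "cmod (remainder t x (0, y)) * cmod (u0 y) \<le> K * \<tau> * \<Omega> t (0, y) * cmod (u0 y)"
          by (intro mult_right_mono R1) auto
        then show "ennreal (cmod (remainder t x (0, y)) * cmod (u0 y)) \<le> ennreal (K * \<tau>) * ennreal (\<Omega> t (0, y) * cmod (u0 y))"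
          using K(1) \<tau> \<Omega>0[of t "(0, y)"] by (simp add: ennreal_mult[symmetric] ennreal_leI mult.assoc)
      qed
      also have "\<dots> = ennreal (K * \<tau>) * (\<integral>\<^sup>+y. ennreal (\<Omega> t (0, y) * cmod (u0 y)) \<partial>lborel)"
        by (rule nn_integral_cmult) measurable
      finally show "(\<integral>\<^sup>+y. ennreal (cmod (remainder t x (0, y)) * cmod (u0 y)) \<partial>lborel) \<le>
          ennreal (K * \<tau>) * (\<integral>\<^sup>+y. ennreal (\<Omega> t (0, y) * cmod (u0 y)) \<partial>lborel)" .
      have "(\<integral>\<^sup>+z. ennreal (cmod (remainder t x z) * cmod (U z)) \<partial>lborel) \<le>
          (\<integral>\<^sup>+z. ennreal (K * \<tau>) * ennreal (\<Omega> t z * cmod (U z)) \<partial>lborel)"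
      proof (intro nn_integral_mono)
        fix z :: "real \<times> (real ^ 'n)"
        have "cmod (remainder t x z) * cmod (U z) \<le> K * \<tau> * \<Omega> t z * cmod (U z)"
        proof (cases "0 \<le> fst z")
          case True
          then show ?thesis by (intro mult_right_mono R1) auto
        next
          case False
          then have "U z = 0" using U_0[of "fst z" "snd z"] by simp
          then show ?thesis by simp
        qed
        then show "ennreal (cmod (remainder t x z) * cmod (U z)) \<le> ennreal (K * \<tau>) * ennreal (\<Omega> t z * cmod (U z))"
          using K(1) \<tau> \<Omega>0[of t z] by (simp add: ennreal_mult[symmetric] ennreal_leI mult.assoc)
      qed
      also have "\<dots> = ennreal (K * \<tau>) * (\<integral>\<^sup>+z. ennreal (\<Omega> t z * cmod (U z)) \<partial>lborel)"
        by (rule nn_integral_cmult) measurable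
      finally show "(\<integral>\<^sup>+z. ennreal (cmod (remainder t x z) * cmod (U z)) \<partial>lborel) \<le>
          ennreal (K * \<tau>) * (\<integral>\<^sup>+z. ennreal (\<Omega> t z * cmod (U z)) \<partial>lborel)" .
      have "\<tau> * t powr (real m / 2 + 1 - a) = t powr (1 - a - real CARD('n) / 2)"
        using t by (simp add: \<tau>_def powr_add[symmetric] algebra_simps)
      then have "B * t powr (1 - a - real CARD('n) / 2) \<le> \<tau> * (K * t powr (real m / 2 + 1 - a))"
        using mult_right_mono[OF K(4), of "t powr (1 - a - real CARD('n) / 2)"] by (simp add: mult_ac)
      then show "(\<integral>\<^sup>+z. indicator {t / 2..<t} (fst z) * ennreal (cmod (heat_kernel \<nu> (t - fst z) (x - snd z)) * cmod (U z)) \<partial>lborel)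
          \<le> ennreal \<tau> * ennreal (K * t powr (real m / 2 + 1 - a))"
        using order_trans[OF far2[OF t, of x] ennreal_leI] \<tau> K(1) by (simp add: ennreal_mult[symmetric])
    qed
    also have "\<dots> = ennreal \<tau> * E t"
      unfolding E_def J_def using K(1) \<tau> by (simp add: ennreal_mult distrib_left mult_ac)
    finally show "ennreal (cmod (V (t, x) - approx t x)) \<le> ennreal (t powr (- real m / 2 - real CARD('n) / 2)) * E t"
      by (simp add: \<tau>_def)
  qed
  ultimately show ?thesis by blast
qed

end

section \<open>The approximation as a sum of moments\<close>

lemma integral_triple_sum:
  fixes c :: "'i \<Rightarrow> 'j \<Rightarrow> 'l \<Rightarrow> complex"
  assumes "\<And>i j l. i \<in> A \<Longrightarrow> j \<in> B i \<Longrightarrow> l \<in> C i j \<Longrightarrow> integrable N (g i j l)"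
  shows "(\<integral>z. (\<Sum>i\<in>A. \<Sum>j\<in>B i. \<Sum>l\<in>C i j. c i j l * g i j l z) \<partial>N) =
    (\<Sum>i\<in>A. \<Sum>j\<in>B i. \<Sum>l\<in>C i j. c i j l * (\<integral>z. g i j l z \<partial>N))"
proof -
  have int: "integrable N (\<lambda>z. c i j l * g i j l z)" if "i \<in> A" "j \<in> B i" "l \<in> C i j" for i j l
    using assms[OF that] by simp
  have "(\<integral>z. (\<Sum>i\<in>A. \<Sum>j\<in>B i. \<Sum>l\<in>C i j. c i j l * g i j l z) \<partial>N) =
      (\<Sum>i\<in>A. \<integral>z. (\<Sum>j\<in>B i. \<Sum>l\<in>C i j. c i j l * g i j l z) \<partial>N)"
    by (intro Bochner_Integration.integral_sum Bochner_Integration.integrable_sum int)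
  also have "\<dots> = (\<Sum>i\<in>A. \<Sum>j\<in>B i. \<integral>z. (\<Sum>l\<in>C i j. c i j l * g i j l z) \<partial>N)"
    by (intro sum.cong refl Bochner_Integration.integral_sum Bochner_Integration.integrable_sum int)
  also have "\<dots> = (\<Sum>i\<in>A. \<Sum>j\<in>B i. \<Sum>l\<in>C i j. \<integral>z. c i j l * g i j l z \<partial>N)"
    by (intro sum.cong refl Bochner_Integration.integral_sum int)
  finally show ?thesis by simp
qed

lemma mi_abs_0: "mi_abs (\<lambda>_. 0) = 0"
  by (simp add: mi_abs_def)

lemma mi_power_scaleR: "mi_power (r *\<^sub>R y) \<beta> = r ^ mi_abs \<beta> * mi_power y \<beta>"
  by (simp add: mi_power_def mi_abs_def power_mult_distrib prod.distrib power_sum)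

lemma abs_mi_power_le: "\<bar>mi_power y \<beta>\<bar> \<le> norm y ^ mi_abs \<beta>"
proof -
  have "\<bar>mi_power y \<beta>\<bar> = (\<Prod>j\<in>UNIV. \<bar>y $ j\<bar> ^ \<beta> j)"
    by (simp add: mi_power_def abs_prod power_abs)
  also have "\<dots> \<le> (\<Prod>j\<in>UNIV. norm y ^ \<beta> j)"
    by (intro prod_mono conjI power_mono component_le_norm_cart) auto
  finally show ?thesis by (simp add: mi_abs_def power_sum)
qed

text \<open>The shared coefficient of a monomial in \<open>profile_kernel\<close> and of the
  corresponding moment, before division by \<beta>!, in \<open>Lambda_profile\<close>. Isolating it
  reduces the comparison of the two to one of moments.\<close>

definition profile_coeff :: "complex \<Rightarrow> real \<Rightarrow> real ^ 'n \<Rightarrow> ('n \<Rightarrow> nat) \<Rightarrow> nat \<Rightarrow> ('n \<Rightarrow> nat) \<Rightarrow> complex" where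
  "profile_coeff \<nu> t x \<gamma> k \<beta> = of_real (t powr (- real CARD('n) / 2)) * gauss \<nu> ((t powr (- 1 / 2)) *\<^sub>R x) *
     hermite \<nu> (\<lambda>j. 2 * \<gamma> j + \<beta> j) ((t powr (- 1 / 2)) *\<^sub>R x) / 2 ^ (2 * mi_abs \<gamma> + k) *
     of_real ((1 / t) ^ mi_abs \<gamma> * (t powr (- 1 / 2)) ^ k) / of_nat (mi_fact \<beta>)"

lemma profile_kernel_eq:
  "profile_kernel \<nu> m t x s y = (\<Sum>\<gamma> | real (mi_abs \<gamma>) \<le> real m / 2. \<Sum>k = 0..m - 2 * mi_abs \<gamma>. \<Sum>\<beta> | mi_abs \<beta> = k.
     ((- \<nu>) ^ mi_abs \<gamma> / of_nat (mi_fact \<gamma>) * profile_coeff \<nu> t x \<gamma> k \<beta>) * of_real (s ^ mi_abs \<gamma> * mi_power y \<beta>))"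
  unfolding profile_kernel_def heat_taylor_def sum_distrib_left
  by (intro sum.cong refl)
     (auto simp: profile_coeff_def mi_power_scaleR power_divide divide_simps)

text \<open>The outer index 2 \<gamma> has even modulus, so the sign of -2 disappears and the powers
  of 2 and of t merge with those of the Taylor polynomial.\<close>

lemma Lambda_profile_even:
  fixes x :: "real ^ 'n"
  assumes t: "0 < t"
  shows "Lambda_profile \<nu> (\<lambda>j. 2 * \<gamma> j) N t \<phi> x = (\<Sum>k = 0..N. \<Sum>\<beta> | mi_abs \<beta> = k.
     profile_coeff \<nu> t x \<gamma> k \<beta> * (LINT y|lebesgue. of_real (mi_power y \<beta>) * \<phi> y))"
proof -
  have abs: "mi_abs (\<lambda>j. 2 * \<gamma> j) = 2 * mi_abs \<gamma>" by (simp add: mi_abs_def sum_distrib_left)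
  have two: "(- 2 :: complex) powi (- int (2 * mi_abs \<gamma>)) = 1 / 2 ^ (2 * mi_abs \<gamma>)"
    by (simp add: power_int_minus power_mult inverse_eq_divide flip: of_nat_mult)
  have two': "(2 :: complex) powi (- int k) = 1 / 2 ^ k" for k
    by (simp add: power_int_minus inverse_eq_divide)
  have t1: "t powr (- real (2 * mi_abs \<gamma>) / 2) = (1 / t) ^ mi_abs \<gamma>"
    using t by (simp add: powr_minus powr_realpow power_one_over inverse_eq_divide)
  have t2: "t powr (- real k / 2) = (t powr (- 1 / 2)) ^ k" for k
    using t by (simp add: powr_realpow[symmetric] powr_powr)
  show ?thesis
    unfolding Lambda_profile_def abs two two' t1 unfolding t2 sum_distrib_left
    by (intro sum.cong refl) (auto simp: profile_coeff_def moment_def dilation_def power_add mult_ac)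
qed

context duhamel_data
begin

text \<open>A monomial of parabolic degree 2k + |\<beta>| \<le> m is dominated by the weight to the
  power m. The second claim is the slice s = 0, where \<open>0 ^ k\<close> is 1 for k = 0.\<close>

lemma integrable_moments:
  assumes "2 * k + mi_abs \<beta> \<le> m"
  shows "integrable lborel (\<lambda>z. of_real (fst z ^ k * mi_power (snd z) \<beta>) * U z)"
    and "integrable lborel (\<lambda>y. of_real (0 ^ k * mi_power y \<beta>) * u0 y)"
proof -
  have bnd: "\<bar>fst z ^ k * mi_power (snd z) \<beta>\<bar> \<le> 1 * parabolic_weight z ^ m"
    if "2 * k + mi_abs \<beta> \<le> m" "0 \<le> fst z" for k \<beta> and z :: "real \<times> (real ^ 'n)"
  proof -
    have w: "sqrt (fst z) \<le> parabolic_weight z" "norm (snd z) \<le> parabolic_weight z"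
      using real_sqrt_ge_zero[OF that(2)] norm_ge_zero[of "snd z"]
      unfolding parabolic_weight_def abs_of_nonneg[OF that(2)] by linarith+
    have "fst z ^ k = sqrt (fst z) ^ (2 * k)" using that(2) by (simp add: power_mult)
    also have "\<dots> \<le> parabolic_weight z ^ (2 * k)" using w(1) that(2) by (intro power_mono) auto
    finally have 1: "fst z ^ k \<le> parabolic_weight z ^ (2 * k)" .
    have "\<bar>mi_power (snd z) \<beta>\<bar> \<le> norm (snd z) ^ mi_abs \<beta>" by (rule abs_mi_power_le)
    also have "\<dots> \<le> parabolic_weight z ^ mi_abs \<beta>" using w(2) by (intro power_mono) auto
    finally have "\<bar>fst z ^ k * mi_power (snd z) \<beta>\<bar> \<le> parabolic_weight z ^ (2 * k) * parabolic_weight z ^ mi_abs \<beta>"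
      using 1 that(2) parabolic_weight_ge_1[of z] by (simp add: abs_mult mult_mono)
    also have "\<dots> = parabolic_weight z ^ (2 * k + mi_abs \<beta>)" by (simp add: power_add)
    also have "\<dots> \<le> parabolic_weight z ^ m" using parabolic_weight_ge_1[of z] that(1) by (intro power_increasing)
    finally show ?thesis by simp
  qed
    have m: "(\<lambda>z :: real \<times> (real ^ 'n). complex_of_real (fst z ^ k * mi_power (snd z) \<beta>)) \<in> borel_measurable borel"
      by measurable
    have b: "cmod (complex_of_real (fst z ^ k * mi_power (snd z) \<beta>)) \<le> 1 * parabolic_weight z ^ m"
      if z: "0 \<le> fst z" for z :: "real \<times> (real ^ 'n)"
      unfolding norm_of_real by (rule bnd[OF assms z])
    show "integrable lborel (\<lambda>z. of_real (fst z ^ k * mi_power (snd z) \<beta>) * U z)"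
      by (rule integrable_weight_bound(1)[OF m b])
    show "integrable lborel (\<lambda>y. of_real (0 ^ k * mi_power y \<beta>) * u0 y)"
      using integrable_weight_bound(2)[OF m b] by simp
qed

text \<open>\<psi> enters through its moments alone, which suits a function that is just one choice
  among those equal almost everywhere.\<close>

lemma approx_eq:
  assumes t: "0 < t"
    and \<psi>: "\<And>k \<beta>. 2 * k + mi_abs \<beta> \<le> m \<Longrightarrow>
       (LINT y|lebesgue. of_real (mi_power y \<beta>) * \<psi> k y) = (\<integral>z. of_real (fst z ^ k * mi_power (snd z) \<beta>) * U z \<partial>lborel)"
    and \<psi>0: "\<And>\<beta>. (LINT y|lebesgue. of_real (mi_power y \<beta>) * \<psi>0 y) = (\<integral>y. of_real (mi_power y \<beta>) * u0 y \<partial>lborel)"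
  shows "approx t x = Lambda_profile \<nu> (\<lambda>_. 0) m t \<psi>0 x +
     (\<Sum>\<gamma> | real (mi_abs \<gamma>) \<le> real m / 2.
        (- \<nu>) ^ mi_abs \<gamma> / of_nat (mi_fact \<gamma>) *
        Lambda_profile \<nu> (\<lambda>j. 2 * \<gamma> j) (m - 2 * mi_abs \<gamma>) t (\<psi> (mi_abs \<gamma>)) x)"
proof -
  let ?G = "{\<gamma> :: 'n \<Rightarrow> nat. real (mi_abs \<gamma>) \<le> real m / 2}"
  note int = integrable_moments
  have G: "2 * mi_abs \<gamma> + mi_abs \<beta> \<le> m" if "\<gamma> \<in> ?G" "k \<in> {0..m - 2 * mi_abs \<gamma>}" "\<beta> \<in> {\<beta>. mi_abs \<beta> = k}"
    for \<gamma> \<beta> :: "'n \<Rightarrow> nat" and k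
    using that by auto
  let ?c = "\<lambda>\<gamma> k \<beta>. (- \<nu>) ^ mi_abs \<gamma> / of_nat (mi_fact \<gamma>) * profile_coeff \<nu> t x \<gamma> k \<beta>"
  have "(\<integral>z. profile_kernel \<nu> m t x (fst z) (snd z) * U z \<partial>lborel) =
      (\<integral>z. (\<Sum>\<gamma>\<in>?G. \<Sum>k\<in>{0..m - 2 * mi_abs \<gamma>}. \<Sum>\<beta>\<in>{\<beta>. mi_abs \<beta> = k}.
         ?c \<gamma> k \<beta> * (of_real (fst z ^ mi_abs \<gamma> * mi_power (snd z) \<beta>) * U z)) \<partial>lborel)"
    unfolding profile_kernel_eq by (simp only: sum_distrib_right mult.assoc)
  also have "\<dots> = (\<Sum>\<gamma>\<in>?G. \<Sum>k\<in>{0..m - 2 * mi_abs \<gamma>}. \<Sum>\<beta>\<in>{\<beta>. mi_abs \<beta> = k}.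
         ?c \<gamma> k \<beta> * (\<integral>z. of_real (fst z ^ mi_abs \<gamma> * mi_power (snd z) \<beta>) * U z \<partial>lborel))"
    by (intro integral_triple_sum int(1) G)
  also have "\<dots> = (\<Sum>\<gamma>\<in>?G. (- \<nu>) ^ mi_abs \<gamma> / of_nat (mi_fact \<gamma>) *
        Lambda_profile \<nu> (\<lambda>j. 2 * \<gamma> j) (m - 2 * mi_abs \<gamma>) t (\<psi> (mi_abs \<gamma>)) x)"
    unfolding Lambda_profile_even[OF t] sum_distrib_left
  proof (intro sum.cong refl)
    fix \<gamma> \<beta> :: "'n \<Rightarrow> nat" and k
    assume "\<gamma> \<in> ?G" "k \<in> {0..m - 2 * mi_abs \<gamma>}" "\<beta> \<in> {\<beta>. mi_abs \<beta> = k}"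
    from \<psi>[OF G[OF this]]
    show "?c \<gamma> k \<beta> * (\<integral>z. of_real (fst z ^ mi_abs \<gamma> * mi_power (snd z) \<beta>) * U z \<partial>lborel) =
      (- \<nu>) ^ mi_abs \<gamma> / of_nat (mi_fact \<gamma>) * (profile_coeff \<nu> t x \<gamma> k \<beta> * (LINT y|lebesgue. of_real (mi_power y \<beta>) * \<psi> (mi_abs \<gamma>) y))"
      by (simp only: mult.assoc)
  qed
  finally have e1: "(\<integral>z. profile_kernel \<nu> m t x (fst z) (snd z) * U z \<partial>lborel) = \<dots>" .
  have "(\<integral>y. profile_kernel \<nu> m t x 0 y * u0 y \<partial>lborel) =
      (\<integral>y. (\<Sum>\<gamma>\<in>?G. \<Sum>k\<in>{0..m - 2 * mi_abs \<gamma>}. \<Sum>\<beta>\<in>{\<beta>. mi_abs \<beta> = k}.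
         ?c \<gamma> k \<beta> * (of_real (0 ^ mi_abs \<gamma> * mi_power y \<beta>) * u0 y)) \<partial>lborel)"
    unfolding profile_kernel_eq by (simp only: sum_distrib_right mult.assoc)
  also have "\<dots> = (\<Sum>\<gamma>\<in>?G. \<Sum>k\<in>{0..m - 2 * mi_abs \<gamma>}. \<Sum>\<beta>\<in>{\<beta>. mi_abs \<beta> = k}.
         ?c \<gamma> k \<beta> * (\<integral>y. of_real (0 ^ mi_abs \<gamma> * mi_power y \<beta>) * u0 y \<partial>lborel))"
    by (intro integral_triple_sum int(2) G)
  \<comment> \<open>At s = 0 every term with |\<gamma>| > 0 carries the factor 0, so the initial
    data contribute only the term with \<gamma> = 0.\<close>
  also have "\<dots> = (\<Sum>\<gamma>\<in>{\<lambda>_. 0}. \<Sum>k\<in>{0..m - 2 * mi_abs \<gamma>}. \<Sum>\<beta>\<in>{\<beta>. mi_abs \<beta> = k}.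
         ?c \<gamma> k \<beta> * (\<integral>y. of_real (0 ^ mi_abs \<gamma> * mi_power y \<beta>) * u0 y \<partial>lborel))"
  proof (rule sum.mono_neutral_right)
    show "\<forall>\<gamma>\<in>?G - {\<lambda>_. 0}. (\<Sum>k\<in>{0..m - 2 * mi_abs \<gamma>}. \<Sum>\<beta>\<in>{\<beta>. mi_abs \<beta> = k}.
         ?c \<gamma> k \<beta> * (\<integral>y. of_real (0 ^ mi_abs \<gamma> * mi_power y \<beta>) * u0 y \<partial>lborel)) = 0"
    proof
      fix \<gamma> :: "'n \<Rightarrow> nat" assume "\<gamma> \<in> ?G - {\<lambda>_. 0}"
      then have "mi_abs \<gamma> \<noteq> 0" by (auto simp: mi_abs_def)
      then show "(\<Sum>k\<in>{0..m - 2 * mi_abs \<gamma>}. \<Sum>\<beta>\<in>{\<beta>. mi_abs \<beta> = k}.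
         ?c \<gamma> k \<beta> * (\<integral>y. of_real (0 ^ mi_abs \<gamma> * mi_power y \<beta>) * u0 y \<partial>lborel)) = 0"
        by (simp add: power_0_left)
    qed
  qed (auto simp: mi_abs_0 intro: finite_mi_abs_le_half simp del: le_divide_eq_numeral1)
  also have "\<dots> = Lambda_profile \<nu> (\<lambda>j. 2 * (\<lambda>_. 0 :: nat) j) m t \<psi>0 x"
    unfolding Lambda_profile_even[OF t] \<psi>0 by (simp add: mi_abs_0 mi_fact_def)
  finally show ?thesis unfolding approx_def e1 by simp
qed

end

section \<open>Mild solutions and their asymptotic profile\<close>

lemma continuous_on_of_power_lipschitz:
  fixes f :: "complex \<Rightarrow> complex"
  assumes p: "1 < p" and K: "0 < K"
    and lip: "\<And>\<xi> \<eta>. cmod (f \<xi> - f \<eta>) \<le> K * (cmod \<xi> powr (p - 1) + cmod \<eta> powr (p - 1)) * cmod (\<xi> - \<eta>)"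
  shows "continuous_on UNIV f"
proof (rule continuous_at_imp_continuous_on, rule ballI)
  fix \<xi> :: complex
  define c where "c = K * ((cmod \<xi> + 1) powr (p - 1) + cmod \<xi> powr (p - 1))"
  have "((\<lambda>\<eta>. c * cmod (\<eta> - \<xi>)) \<longlongrightarrow> c * cmod (\<xi> - \<xi>)) (at \<xi>)"
    by (intro tendsto_intros)
  then have lim: "((\<lambda>\<eta>. c * cmod (\<eta> - \<xi>)) \<longlongrightarrow> 0) (at \<xi>)" by simp
  have "((\<lambda>\<eta>. f \<eta> - f \<xi>) \<longlongrightarrow> 0) (at \<xi>)"
  proof (rule Lim_null_comparison[OF _ lim])
    have "\<forall>\<^sub>F \<eta> in at \<xi>. dist \<eta> \<xi> < 1" by (simp add: eventually_at) (use zero_less_one in blast)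
    then show "\<forall>\<^sub>F \<eta> in at \<xi>. norm (f \<eta> - f \<xi>) \<le> c * cmod (\<eta> - \<xi>)"
    proof (rule eventually_mono)
      fix \<eta> :: complex assume "dist \<eta> \<xi> < 1"
      then have "cmod \<eta> \<le> cmod \<xi> + 1" using norm_triangle_sub[of \<eta> \<xi>] by (simp add: dist_norm)
      then have "cmod \<eta> powr (p - 1) \<le> (cmod \<xi> + 1) powr (p - 1)" using p by (intro powr_mono2) auto
      then have "K * (cmod \<eta> powr (p - 1) + cmod \<xi> powr (p - 1)) * cmod (\<eta> - \<xi>) \<le> c * cmod (\<eta> - \<xi>)"
        unfolding c_def using K by (intro mult_right_mono mult_left_mono add_right_mono) auto
      with lip[of \<eta> \<xi>] show "norm (f \<eta> - f \<xi>) \<le> c * cmod (\<eta> - \<xi>)" by simp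
    qed
  qed
  then show "isCont f \<xi>" by (simp add: isCont_def LIM_zero_iff)
qed

lemma Lq_norm_infinity: "Lq_norm \<infinity> \<phi> = esssup lebesgue (\<lambda>x. ennreal (cmod (\<phi> x)))"
  by (simp add: Lq_norm_def)

lemma AE_le_Lq_norm_infinity: "AE x in lebesgue. ennreal (cmod (\<phi> x)) \<le> Lq_norm \<infinity> \<phi>"
  unfolding Lq_norm_infinity by (rule esssup_AE)

lemma Lq_norm_infinity_le:
  assumes "\<phi> \<in> borel_measurable lebesgue" "AE x in lebesgue. ennreal (cmod (\<phi> x)) \<le> c"
  shows "Lq_norm \<infinity> \<phi> \<le> c"
  unfolding Lq_norm_infinity using assms by (intro esssup_I) auto

text \<open>An essential supremum over times becomes a bound at each time: every interval to the
  right of t contains a time outside the exceptional null set, and continuity in L^\<infinity>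
  carries the bound over to t.\<close>

lemma C_Linf_pointwise_bound:
  assumes u: "u \<in> C_Linf {0<..} \<infinity>"
  shows "\<exists>E<\<infinity>. \<forall>t>0. Lq_norm \<infinity> (u t) \<le> E"
proof -
  define E where "E = esssup (lebesgue_on {0<..}) (\<lambda>t. Lq_norm \<infinity> (u t))"
  have E: "E < \<infinity>" using u by (simp add: C_Linf_def E_def)
  have meas: "u t \<in> borel_measurable lebesgue" if "0 < t" for t
    using u that by (simp add: C_Linf_def normed_fun_space_def)
  have "AE t in lebesgue_on {0<..}. Lq_norm \<infinity> (u t) \<le> E" unfolding E_def by (rule esssup_AE)
  then have ae: "AE t in lebesgue. 0 < t \<longrightarrow> Lq_norm \<infinity> (u t) \<le> E"
    by (subst (asm) AE_restrict_space_iff) auto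
  have "Lq_norm \<infinity> (u t) \<le> E" if t: "0 < t" for t
  proof (rule ennreal_le_epsilon)
    fix e :: real assume e: "0 < e"
    have "((\<lambda>s. Lq_norm \<infinity> (\<lambda>x. u s x - u t x)) \<longlongrightarrow> 0) (at t within {0<..})"
      using u t by (simp add: C_Linf_def)
    then have "\<forall>\<^sub>F s in at t within {0<..}. Lq_norm \<infinity> (\<lambda>x. u s x - u t x) < ennreal e"
      using e by (intro order_tendstoD) auto
    then obtain d where d: "0 < d" "\<And>s. 0 < s \<Longrightarrow> s \<noteq> t \<Longrightarrow> dist s t < d \<Longrightarrow> Lq_norm \<infinity> (\<lambda>x. u s x - u t x) < ennreal e"
      unfolding eventually_at by auto
    have "\<exists>s\<in>{t<..<t + d}. Lq_norm \<infinity> (u s) \<le> E"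
    proof (rule ccontr)
      assume no: "\<not> ?thesis"
      from AE_E[OF ae] obtain N where N: "{s \<in> space lebesgue. \<not> (0 < s \<longrightarrow> Lq_norm \<infinity> (u s) \<le> E)} \<subseteq> N"
        "emeasure lebesgue N = 0" "N \<in> sets lebesgue" by blast
      have "emeasure lebesgue {t<..<t + d} \<le> emeasure lebesgue N"
        using no N t by (intro emeasure_mono) auto
      then show False using N(2) d(1) by simp
    qed
    then obtain s where s: "t < s" "s < t + d" "Lq_norm \<infinity> (u s) \<le> E" by auto
    have "Lq_norm \<infinity> (u t) \<le> Lq_norm \<infinity> (u s) + Lq_norm \<infinity> (\<lambda>x. u s x - u t x)"
    proof (rule Lq_norm_infinity_le[OF meas[OF t]])
      show "AE x in lebesgue. ennreal (cmod (u t x)) \<le> Lq_norm \<infinity> (u s) + Lq_norm \<infinity> (\<lambda>x. u s x - u t x)"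
        using AE_le_Lq_norm_infinity[of "u s"] AE_le_Lq_norm_infinity[of "\<lambda>x. u s x - u t x"]
      proof eventually_elim
        fix x
        assume 1: "ennreal (cmod (u s x)) \<le> Lq_norm \<infinity> (u s)"
          and 2: "ennreal (cmod (u s x - u t x)) \<le> Lq_norm \<infinity> (\<lambda>x. u s x - u t x)"
        have "cmod (u t x) \<le> cmod (u s x) + cmod (u s x - u t x)"
          using norm_triangle_sub[of "u t x" "u s x"] by (simp add: norm_minus_commute)
        then have "ennreal (cmod (u t x)) \<le> ennreal (cmod (u s x)) + ennreal (cmod (u s x - u t x))"
          by (simp add: ennreal_plus[symmetric] ennreal_leI del: ennreal_plus)
        also have "\<dots> \<le> Lq_norm \<infinity> (u s) + Lq_norm \<infinity> (\<lambda>x. u s x - u t x)" using 1 2 by (rule add_mono)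
        finally show "ennreal (cmod (u t x)) \<le> Lq_norm \<infinity> (u s) + Lq_norm \<infinity> (\<lambda>x. u s x - u t x)" .
      qed
    qed
    also have "\<dots> \<le> E + ennreal e"
      using s d(2)[of s] t by (intro add_mono) (auto simp: dist_real_def less_imp_le)
    finally show "Lq_norm \<infinity> (u t) \<le> E + ennreal e" .
  qed
  with E show ?thesis by blast
qed

text \<open>Raised to the power r, |g| is at most the (r - 1)-th power of its sup bound times |g|.
  The exponent of t comes out as ((-\<kappa> - N)(r - 1) - \<kappa>) / r = -(N (1 - 1/r) +
  \<kappa>), so the weight on the left cancels it exactly and e is left without any
  constant.\<close>

lemma Lq_norm_interpolation:
  fixes \<kappa> N t :: real
  assumes t: "0 < t" and q: "1 \<le> q" and g: "g \<in> borel_measurable lebesgue"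
    and L1: "Lq_norm 1 g \<le> ennreal (t powr (- \<kappa>)) * e"
    and Linf: "AE x in lebesgue. ennreal (cmod (g x)) \<le> ennreal (t powr (- \<kappa> - N)) * e"
  shows "ennreal (t powr (N * (1 - enn2real (1 / q)) + \<kappa>)) * Lq_norm q g \<le> e"
proof (cases "e = \<infinity>")
  case False
  then obtain r0 where e: "e = ennreal r0" "0 \<le> r0" by (cases e) auto
  define y x where "y = t powr (- \<kappa> - N) * r0" and "x = t powr (- \<kappa>) * r0"
  have yx: "0 \<le> y" "0 \<le> x" using e by (auto simp: y_def x_def)
  have L1': "Lq_norm 1 g \<le> ennreal x" using L1 e by (simp add: x_def ennreal_mult)
  have Linf': "AE x in lebesgue. cmod (g x) \<le> y"
    using Linf e yx(1) by (auto elim!: eventually_mono simp: y_def ennreal_mult[symmetric])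
  show ?thesis
  proof (cases "q = \<infinity>")
    case True
    have "Lq_norm \<infinity> g \<le> ennreal (t powr (- \<kappa> - N)) * e" using g Linf by (rule Lq_norm_infinity_le)
    then have "ennreal (t powr (N + \<kappa>)) * Lq_norm \<infinity> g \<le> ennreal (t powr (N + \<kappa>)) * (ennreal (t powr (- \<kappa> - N)) * e)"
      by (intro mult_left_mono) auto
    also have "\<dots> = e"
      using t by (simp add: mult.assoc[symmetric] ennreal_mult[symmetric] powr_add[symmetric])
    finally show ?thesis using True by simp
  next
    case False
    then obtain r where r: "q = ennreal r" "1 \<le> r" using q by (cases q) auto
    have rq: "enn2real q = r" "enn2real (1 / q) = 1 / r"
      using r divide_ennreal[of 1 r] by simp_all
    define I where "I = (\<integral>\<^sup>+ x. ennreal (cmod (g x) powr r) \<partial>lebesgue)"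
    have "I \<le> (\<integral>\<^sup>+ x. ennreal (y powr (r - 1)) * ennreal (cmod (g x)) \<partial>lebesgue)"
      unfolding I_def
    proof (rule nn_integral_mono_AE, use Linf' in \<open>rule eventually_mono\<close>)
      fix z assume z: "cmod (g z) \<le> y"
      have "cmod (g z) powr r = cmod (g z) powr (r - 1) * cmod (g z)"
        using powr_add[of "cmod (g z)" "r - 1" 1] by (cases "g z = 0") auto
      also have "\<dots> \<le> y powr (r - 1) * cmod (g z)"
        using z r by (intro mult_right_mono powr_mono2) auto
      finally show "ennreal (cmod (g z) powr r) \<le> ennreal (y powr (r - 1)) * ennreal (cmod (g z))"
        by (simp add: ennreal_mult[symmetric] ennreal_leI)
    qed
    also have "\<dots> = ennreal (y powr (r - 1)) * Lq_norm 1 g"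
      unfolding Lq_norm_1 using g by (intro nn_integral_cmult) auto
    also have "\<dots> \<le> ennreal (y powr (r - 1)) * ennreal x" using L1' by (intro mult_left_mono) auto
    also have "\<dots> = ennreal (y powr (r - 1) * x)" using yx by (simp add: ennreal_mult)
    finally have I: "I \<le> ennreal (y powr (r - 1) * x)" .
    then have Ifin: "I \<noteq> \<infinity>" by (auto simp: top_unique)
    have "enn2real I \<le> y powr (r - 1) * x"
      using enn2real_mono[OF I] yx by simp
    then have "enn2real I powr (1 / r) \<le> (y powr (r - 1) * x) powr (1 / r)"
      using r by (intro powr_mono2) auto
    also have "\<dots> = t powr (- (N * (1 - 1 / r) + \<kappa>)) * r0"
    proof (cases "r0 = 0")
      case False
      then have r0: "0 < r0" using e by simp
      have "y powr (r - 1) * x = t powr ((- \<kappa> - N) * (r - 1) - \<kappa>) * r0 powr r"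
      proof -
        have h1: "y powr (r - 1) = t powr ((- \<kappa> - N) * (r - 1)) * r0 powr (r - 1)"
          unfolding y_def using t r0 by (simp add: powr_mult powr_powr)
        have h2: "r0 powr (r - 1) * r0 = r0 powr r" using r0 powr_add[of r0 "r - 1" 1] by simp
        have h3: "t powr ((- \<kappa> - N) * (r - 1)) * t powr (- \<kappa>) = t powr ((- \<kappa> - N) * (r - 1) - \<kappa>)"
          using powr_add[of t "(- \<kappa> - N) * (r - 1)" "- \<kappa>"] by simp
        show ?thesis unfolding x_def h1 h2[symmetric] h3[symmetric] by (simp only: mult_ac)
      qed
      also have "\<dots> powr (1 / r) = t powr (((- \<kappa> - N) * (r - 1) - \<kappa>) * (1 / r)) * r0"
        using t r0 r by (simp add: powr_mult powr_powr)
      also have "((- \<kappa> - N) * (r - 1) - \<kappa>) * (1 / r) = - (N * (1 - 1 / r) + \<kappa>)"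
        using r by (simp add: field_simps)
      finally show ?thesis .
    qed (simp add: x_def)
    finally have fin: "enn2real I powr (1 / r) \<le> t powr (- (N * (1 - 1 / r) + \<kappa>)) * r0" .
    have "Lq_norm q g = ennreal (enn2real I powr (1 / r))"
      using False Ifin by (simp add: Lq_norm_def rq I_def[symmetric] Let_def)
    also have "\<dots> \<le> ennreal (t powr (- (N * (1 - 1 / r) + \<kappa>)) * r0)" using fin by (rule ennreal_leI)
    finally have "ennreal (t powr (N * (1 - 1 / r) + \<kappa>)) * Lq_norm q g \<le>
        ennreal (t powr (N * (1 - 1 / r) + \<kappa>)) * ennreal (t powr (- (N * (1 - 1 / r) + \<kappa>)) * r0)"
      by (intro mult_left_mono) auto
    also have "\<dots> = ennreal (t powr (N * (1 - 1 / r) + \<kappa>) * (t powr (- (N * (1 - 1 / r) + \<kappa>)) * r0))"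
      using e by (intro ennreal_mult[symmetric]) auto
    also have "t powr (N * (1 - 1 / r) + \<kappa>) * (t powr (- (N * (1 - 1 / r) + \<kappa>)) * r0) = r0"
      using t powr_add[of t "N * (1 - 1 / r) + \<kappa>" "- (N * (1 - 1 / r) + \<kappa>)"] by (simp only: mult.assoc[symmetric]) simp
    finally show ?thesis by (simp add: rq e)
  qed
qed simp

lemma heat_semigroup_eq:
  fixes g g' :: "real ^ 'n \<Rightarrow> complex"
  assumes \<nu>: "\<nu> \<noteq> 0" and t: "0 < t" and g: "g \<in> borel_measurable lebesgue"
    and [measurable]: "g' \<in> borel_measurable borel" and eq: "AE y in lebesgue. g y = g' y"
  shows "heat_semigroup \<nu> t g x = (\<integral>y. heat_kernel \<nu> t (x - y) * g' y \<partial>lborel)"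
proof -
  have [measurable]: "(\<lambda>y. heat_kernel \<nu> t (x - y)) \<in> borel_measurable borel" by measurable
  have m: "(\<lambda>y. heat_kernel \<nu> t (x - y)) \<in> borel_measurable lebesgue" "g' \<in> borel_measurable lebesgue"
    by (intro measurable_completion, simp)+
  have "heat_semigroup \<nu> t g x = (LINT y|lebesgue. heat_kernel \<nu> t (x - y) * g y)"
    using t by (simp add: heat_semigroup_def Defs.convolution_def gauss_eq_heat_kernel[OF \<nu> t])
  also have "\<dots> = (LINT y|lebesgue. heat_kernel \<nu> t (x - y) * g' y)"
    using eq m g by (intro integral_cong_AE) (auto elim!: eventually_mono)
  also have "\<dots> = (\<integral>y. heat_kernel \<nu> t (x - y) * g' y \<partial>lborel)"
    by (rule integral_completion) measurable
  finally show ?thesis .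
qed

lemma lebesgue_on_integral_lborel:
  fixes g :: "real \<Rightarrow> complex"
  assumes g: "g \<in> borel_measurable borel" and S: "S \<in> sets borel" and out: "\<And>s. s \<notin> S \<Longrightarrow> g s = 0"
  shows "integrable (lebesgue_on S) g \<longleftrightarrow> integrable lborel g" "integral\<^sup>L (lebesgue_on S) g = integral\<^sup>L lborel g"
proof -
  have ind: "(\<lambda>s. indicator S s *\<^sub>R g s) = g" using out by (auto simp: fun_eq_iff indicator_def)
  have S': "S \<inter> space lebesgue \<in> sets lebesgue" using S by simp
  have "integrable (lebesgue_on S) g \<longleftrightarrow> integrable lebesgue g"
    using integrable_restrict_space[OF S', of g] unfolding ind .
  also have "\<dots> \<longleftrightarrow> integrable lborel g" using g by (intro integrable_completion) simp
  finally show "integrable (lebesgue_on S) g \<longleftrightarrow> integrable lborel g" .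
  have "integral\<^sup>L (lebesgue_on S) g = integral\<^sup>L lebesgue g"
    using integral_restrict_space[OF S', of g] unfolding ind .
  also have "\<dots> = integral\<^sup>L lborel g" using g by (intro integral_completion) simp
  finally show "integral\<^sup>L (lebesgue_on S) g = integral\<^sup>L lborel g" .
qed

lemma duhamel_bochner_integral:
  fixes u :: "real \<Rightarrow> real ^ 'n \<Rightarrow> complex" and U :: "real \<times> (real ^ 'n) \<Rightarrow> complex"
  assumes \<nu>: "\<nu> \<noteq> 0" and t: "0 < t"
    and B: "has_fun_bochner_integral L1_Linf_norm (lebesgue_on {0..t}) (\<lambda>s. heat_semigroup \<nu> (t - s) (\<lambda>x. f (u s x))) w"
    and [measurable]: "U \<in> borel_measurable borel"
    and meas: "\<And>s. 0 < s \<Longrightarrow> (\<lambda>x. f (u s x)) \<in> borel_measurable lebesgue"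
    and eq: "\<And>s. 0 < s \<Longrightarrow> AE x in lebesgue. f (u s x) = U (s, x)"
  shows "AE x in lborel.
       integrable lborel (\<lambda>s. indicator {0<..<t} s *\<^sub>R (\<integral>y. heat_kernel \<nu> (t - s) (x - y) * U (s, y) \<partial>lborel)) \<and>
       w x = (\<integral>s. indicator {0<..<t} s *\<^sub>R (\<integral>y. heat_kernel \<nu> (t - s) (x - y) * U (s, y) \<partial>lborel) \<partial>lborel)"
proof -
  define Fj where "Fj z = indicator {0<..<t} (fst z) *\<^sub>R (\<integral>y. heat_kernel \<nu> (t - fst z) (snd z - y) * U (fst z, y) \<partial>lborel)" for z
  have Fj[measurable]: "Fj \<in> borel_measurable borel" unfolding Fj_def by measurable
  have M: "sigma_finite_measure (lebesgue_on {0..t})" by (rule sigma_finite_lebesgue_on) simp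
  interpret M: sigma_finite_measure "lebesgue_on {0..t}" by (rule M)
  interpret pair_sigma_finite "lebesgue_on {0..t}" "lebesgue :: (real ^ 'n) measure" ..
  have N: "Lq_norm 1 \<phi> \<le> L1_Linf_norm \<phi>" for \<phi> :: "real ^ 'n \<Rightarrow> complex"
    by (simp add: L1_Linf_norm_def)
  have ae: "AE s in lebesgue_on {0..t}. AE x in lebesgue. heat_semigroup \<nu> (t - s) (\<lambda>x. f (u s x)) x = Fj (s, x)"
  proof -
    have "AE s in lebesgue. s \<noteq> 0 \<and> s \<noteq> t"
      using AE_completion[OF AE_lborel_singleton[of 0]] AE_completion[OF AE_lborel_singleton[of t]] by eventually_elim simp
    then have "AE s in lebesgue. s \<in> {0..t} \<longrightarrow> 0 < s \<and> s < t"
      by (rule eventually_mono) auto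
    then have "AE s in lebesgue_on {0..t}. 0 < s \<and> s < t"
      by (rule iffD2[OF AE_restrict_space_iff, rotated]) simp
    then show ?thesis
    proof (rule eventually_mono)
      fix s assume s: "0 < s \<and> s < t"
      have "heat_semigroup \<nu> (t - s) (\<lambda>x. f (u s x)) x = Fj (s, x)" for x
        using s heat_semigroup_eq[OF \<nu>, of "t - s" "\<lambda>x. f (u s x)" "\<lambda>y. U (s, y)" x] meas[of s] eq[of s]
        by (simp add: Fj_def)
      then show "AE x in lebesgue. heat_semigroup \<nu> (t - s) (\<lambda>x. f (u s x)) x = Fj (s, x)" by simp
    qed
  qed
  note R = has_fun_bochner_integral_pair[OF M B N borel_measurable_lebesgue_on_pair[OF Fj] ae]
  have 1: "AE x in lebesgue. integrable (lebesgue_on {0..t}) (\<lambda>s. Fj (s, x))"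
    using AE_integrable_snd[of "\<lambda>s x. Fj (s, x)"] R(1) by simp
  have out: "Fj (s, x) = 0" if "s \<notin> {0..t}" for s x using that by (auto simp: Fj_def indicator_def)
  have conv: "integrable (lebesgue_on {0..t}) (\<lambda>s. Fj (s, x)) \<longleftrightarrow> integrable lborel (\<lambda>s. Fj (s, x))"
    "(\<integral>s. Fj (s, x) \<partial>lebesgue_on {0..t}) = (\<integral>s. Fj (s, x) \<partial>lborel)" for x
    by (rule lebesgue_on_integral_lborel; use out in simp)+
  have "AE x in lebesgue. integrable lborel (\<lambda>s. Fj (s, x)) \<and> w x = (\<integral>s. Fj (s, x) \<partial>lborel)"
    using 1 R(2) by eventually_elim (simp add: conv)
  then show ?thesis unfolding AE_completion_iff by (simp add: Fj_def)
qed

context duhamel_data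
begin

text \<open>\<open>psi\<close> selects some Bochner integral, so one has to exist first. The
  integrand s^k f(u(s)) is continuous in L^1 and bounded by a multiple of (1 + s)^{-(a - k)}, with a
  - k > 1 because k \<le> m/2. Then \<open>psi\<close> equals the pointwise time integral almost
  everywhere, and Fubini's theorem gives its moments.\<close>

lemma psi_moment:
  assumes k: "2 * k + mi_abs \<beta> \<le> m"
    and meas: "\<And>s. 0 < s \<Longrightarrow> (\<lambda>x. f (u s x)) \<in> borel_measurable lebesgue"
    and eq: "\<And>s. 0 < s \<Longrightarrow> AE x in lebesgue. f (u s x) = U (s, x)"
    and cont: "\<And>s. 0 < s \<Longrightarrow> ((\<lambda>r. Lq_norm 1 (\<lambda>x. f (u r x) - f (u s x))) \<longlongrightarrow> 0) (at s)"
  shows "(LINT y|lebesgue. of_real (mi_power y \<beta>) * psi f u k y) =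
    (\<integral>z. of_real (fst z ^ k * mi_power (snd z) \<beta>) * U z \<partial>lborel)"
proof -
  define Hj where "Hj z = of_real (fst z ^ k) * U z" for z
  define H where "H = (\<lambda>s x. complex_of_real (s ^ k) * f (u s x))"
  have [measurable]: "Hj \<in> borel_measurable borel" unfolding Hj_def by measurable
  have Us[measurable]: "(\<lambda>x. U (s, x)) \<in> borel_measurable borel" for s by measurable
  have N1: "Lq_norm 1 (\<lambda>x. f (u s x)) \<le> ennreal (h * M * (1 + s) powr (- a))" if s: "0 < s" for s
  proof -
    have "Lq_norm 1 (\<lambda>x. f (u s x)) = (\<integral>\<^sup>+x. ennreal (cmod (U (s, x))) \<partial>lebesgue)"
      unfolding Lq_norm_1 using eq[OF s] by (intro nn_integral_cong_AE) (auto elim!: eventually_mono)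
    also have "\<dots> = (\<integral>\<^sup>+x. ennreal (cmod (U (s, x))) \<partial>lborel)" by (rule nn_integral_completion)
    also have "\<dots> \<le> (\<integral>\<^sup>+x. ennreal (h * (1 + s) powr (- a)) * ennreal (cmod (V (s, x))) \<partial>lborel)"
      using U_V[OF s] h by (intro nn_integral_mono) (simp add: ennreal_mult[symmetric] ennreal_leI)
    also have "\<dots> = ennreal (h * (1 + s) powr (- a)) * (\<integral>\<^sup>+x. ennreal (cmod (V (s, x))) \<partial>lborel)"
      by (rule nn_integral_cmult) measurable
    also have "\<dots> \<le> ennreal (h * (1 + s) powr (- a)) * ennreal M" using V_L1[OF s] by (intro mult_left_mono) auto
    also have "\<dots> = ennreal (h * M * (1 + s) powr (- a))" using h M by (simp add: ennreal_mult[symmetric] mult_ac)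
    finally show ?thesis .
  qed
  have NH: "Lq_norm 1 (\<lambda>x. of_real c * \<phi> x) = ennreal \<bar>c\<bar> * Lq_norm 1 \<phi>"
    if "\<phi> \<in> borel_measurable lebesgue" for c :: real and \<phi> :: "real ^ 'n \<Rightarrow> complex"
    unfolding Lq_norm_1 using that
    by (subst nn_integral_cmult[symmetric]) (auto simp: norm_mult ennreal_mult)
  have Hfin: "H s \<in> Lq 1" if s: "0 < s" for s
  proof -
    have "Lq_norm 1 (H s) \<le> ennreal \<bar>s ^ k\<bar> * ennreal (h * M * (1 + s) powr (- a))"
      unfolding H_def NH[OF meas[OF s]] using N1[OF s] by (intro mult_left_mono) auto
    also have "\<dots> < \<infinity>" by (simp add: ennreal_mult_less_top)
    finally show ?thesis using meas[OF s] by (auto simp: normed_fun_space_def H_def)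
  qed
  \<comment> \<open>Decreasing on s \<ge> 0, so its value at s bounds the norm of H on all of
    [s, s + 1].\<close>
  define g where "g s = ennreal (h * M) * (ennreal ((1 + s) powr (- (a - real k))) * indicator {0..} s)" for s
  have km: "2 * real k \<le> real m" using k by (simp flip: of_nat_mult)
  then have ak: "1 < a - real k" using a by linarith
  have "\<exists>w. has_fun_bochner_integral (Lq_norm 1) (lebesgue_on {0..}) H w"
  proof (rule has_fun_bochner_integral_L1_exists)
    show "Hj \<in> borel_measurable borel" by measurable
    show "AE x in lebesgue. H s x = Hj (s, x)" if "0 < s" for s
      using eq[OF that] by (rule eventually_mono) (simp add: H_def Hj_def)
    show "H s \<in> Lq 1" if "0 < s" for s by (rule Hfin[OF that])
    show "Lq_norm 1 (H r) \<le> g s" if s: "0 < s" "s \<le> r" "r \<le> s + 1" for s r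
    proof -
      have r: "0 < r" using s by linarith
      have "Lq_norm 1 (H r) = ennreal (r ^ k) * Lq_norm 1 (\<lambda>x. f (u r x))"
        unfolding H_def NH[OF meas[OF r]] using r by simp
      also have "\<dots> \<le> ennreal (r ^ k) * ennreal (h * M * (1 + r) powr (- a))" using N1[OF r] by (intro mult_left_mono) auto
      also have "\<dots> = ennreal (r ^ k * (h * M * (1 + r) powr (- a)))" using r h M by (simp add: ennreal_mult[symmetric])
      also have "\<dots> \<le> ennreal (h * M * (1 + s) powr (- (a - real k)))"
      proof (rule ennreal_leI)
        have "r ^ k \<le> (1 + r) powr real k" using r by (simp add: powr_realpow power_mono)
        then have "r ^ k * (1 + r) powr (- a) \<le> (1 + r) powr real k * (1 + r) powr (- a)" by (intro mult_right_mono) auto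
        also have "\<dots> = (1 + r) powr (- (a - real k))" by (simp add: powr_add[symmetric])
        also have "\<dots> \<le> (1 + s) powr (- (a - real k))" using s ak by (intro powr_mono2') auto
        finally have "h * M * (r ^ k * (1 + r) powr (- a)) \<le> h * M * (1 + s) powr (- (a - real k))"
          using h M by (intro mult_left_mono) auto
        then show "r ^ k * (h * M * (1 + r) powr (- a)) \<le> h * M * (1 + s) powr (- (a - real k))" by (simp add: mult_ac)
      qed
      also have "\<dots> = g s" using s h M by (simp add: g_def ennreal_mult)
      finally show ?thesis .
    qed
    show "g \<in> borel_measurable borel" unfolding g_def by measurable
    have "(\<integral>\<^sup>+s. g s \<partial>lebesgue_on {0..}) = (\<integral>\<^sup>+s. g s * indicator {0..} s \<partial>lebesgue)"
      by (rule nn_integral_restrict_space) simp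
    also have "\<dots> = (\<integral>\<^sup>+s. g s \<partial>lebesgue)"
      by (intro nn_integral_cong) (simp add: g_def indicator_def)
    also have "\<dots> = (\<integral>\<^sup>+s. g s \<partial>lborel)" by (rule nn_integral_completion)
    also have "\<dots> = ennreal (h * M) * ennreal (1 / (a - real k - 1))"
      unfolding g_def nn_integral_decay_finite[OF ak, symmetric] by (rule nn_integral_cmult) measurable
    also have "\<dots> < \<infinity>" by (simp add: ennreal_mult_less_top)
    finally show "(\<integral>\<^sup>+s. g s \<partial>lebesgue_on {0..}) < \<infinity>" .
    show "((\<lambda>r. Lq_norm 1 (\<lambda>x. H r x - H s x)) \<longlongrightarrow> 0) (at s)" if s: "0 < s" for s
    proof -
      define c where "c = Lq_norm 1 (\<lambda>x. f (u s x))"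
      have c: "c < \<infinity>" unfolding c_def using N1[OF s] by (rule le_less_trans) simp
      let ?d = "\<lambda>r. Lq_norm 1 (\<lambda>x. f (u r x) - f (u s x))"
      have bound: "Lq_norm 1 (\<lambda>x. H r x - H s x) \<le> ennreal ((s + 1) ^ k) * ?d r + c * ennreal \<bar>r ^ k - s ^ k\<bar>"
        if r: "0 < r" "r < s + 1" for r
      proof -
        have [measurable]: "(\<lambda>x. f (u r x)) \<in> borel_measurable lebesgue" "(\<lambda>x. f (u s x)) \<in> borel_measurable lebesgue"
          using meas r s by auto
        have "Lq_norm 1 (\<lambda>x. H r x - H s x) =
            Lq_norm 1 (\<lambda>x. of_real (r ^ k) * (f (u r x) - f (u s x)) - of_real (s ^ k - r ^ k) * f (u s x))"
          by (simp add: H_def algebra_simps)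
        also have "\<dots> \<le> Lq_norm 1 (\<lambda>x. of_real (r ^ k) * (f (u r x) - f (u s x))) + Lq_norm 1 (\<lambda>x. of_real (s ^ k - r ^ k) * f (u s x))"
          by (intro Lq_norm_1_triangle) measurable
        also have "\<dots> = ennreal (r ^ k) * ?d r + ennreal \<bar>s ^ k - r ^ k\<bar> * c"
          using r by (subst (1 2) NH) (auto simp: c_def)
        also have "\<dots> \<le> ennreal ((s + 1) ^ k) * ?d r + c * ennreal \<bar>r ^ k - s ^ k\<bar>"
          using r by (intro add_mono mult_right_mono ennreal_leI power_mono) (auto simp: mult.commute abs_minus_commute)
        finally show ?thesis .
      qed
      have "((\<lambda>r. ennreal ((s + 1) ^ k) * ?d r) \<longlongrightarrow> ennreal ((s + 1) ^ k) * 0) (at s)"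
        by (intro ennreal_tendsto_cmult cont s) auto
      moreover have "((\<lambda>r. ennreal \<bar>r ^ k - s ^ k\<bar>) \<longlongrightarrow> ennreal \<bar>s ^ k - s ^ k\<bar>) (at s)"
        by (intro tendsto_ennrealI tendsto_intros)
      then have "((\<lambda>r. c * ennreal \<bar>r ^ k - s ^ k\<bar>) \<longlongrightarrow> c * ennreal \<bar>s ^ k - s ^ k\<bar>) (at s)"
        using c by (intro ennreal_tendsto_cmult) auto
      ultimately have "((\<lambda>r. ennreal ((s + 1) ^ k) * ?d r + c * ennreal \<bar>r ^ k - s ^ k\<bar>) \<longlongrightarrow>
          ennreal ((s + 1) ^ k) * 0 + c * ennreal \<bar>s ^ k - s ^ k\<bar>) (at s)"
        by (rule tendsto_add)
      then have lim: "((\<lambda>r. ennreal ((s + 1) ^ k) * ?d r + c * ennreal \<bar>r ^ k - s ^ k\<bar>) \<longlongrightarrow> 0) (at s)" by simp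
      have "\<forall>\<^sub>F r in at s. r \<in> {0<..<s + 1}"
        using s by (intro eventually_at_in_open') auto
      then have "\<forall>\<^sub>F r in at s. Lq_norm 1 (\<lambda>x. H r x - H s x) \<le> ennreal ((s + 1) ^ k) * ?d r + c * ennreal \<bar>r ^ k - s ^ k\<bar>"
        by (rule eventually_mono) (use bound in auto)
      then show ?thesis
        by (rule tendsto_sandwich[OF _ _ tendsto_const lim, rotated]) auto
    qed
  qed
  then have B: "has_fun_bochner_integral (Lq_norm 1) (lebesgue_on {0..}) H (psi f u k)"
    unfolding psi_def L1_bochner_integral_def H_def by (rule someI_ex)
  have pm: "psi f u k \<in> borel_measurable lebesgue"
    using B by (simp add: has_fun_bochner_integral_def normed_fun_space_def)
  have ae: "AE s in lebesgue_on {0..}. AE x in lebesgue. H s x = Hj (s, x)"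
  proof -
    have "AE s in lebesgue. s \<noteq> (0::real)" by (rule AE_completion[OF AE_lborel_singleton])
    then have "AE s in lebesgue_on {0..}. (0::real) < s"
      by (subst AE_restrict_space_iff) (auto elim!: eventually_mono)
    then show ?thesis
    proof (rule eventually_mono)
      fix s :: real assume "0 < s"
      from eq[OF this] show "AE x in lebesgue. H s x = Hj (s, x)" by (rule eventually_mono) (simp add: H_def Hj_def)
    qed
  qed
  have sf: "sigma_finite_measure (lebesgue_on {0::real..})" by (rule sigma_finite_lebesgue_on) simp
  have HjM: "Hj \<in> borel_measurable (lebesgue_on {0..} \<Otimes>\<^sub>M lebesgue)"
    by (rule borel_measurable_lebesgue_on_pair) measurable
  have psi_eq: "AE x in lebesgue. psi f u k x = (\<integral>s. Hj (s, x) \<partial>lborel)"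
  proof -
    have "(\<integral>s. Hj (s, x) \<partial>lebesgue_on {0..}) = (\<integral>s. Hj (s, x) \<partial>lborel)" for x
      by (rule lebesgue_on_integral_lborel(2)) (auto simp: Hj_def U_0)
    then show ?thesis using has_fun_bochner_integral_pair(2)[OF sf B order_refl HjM ae] by simp
  qed
  have m1: "(\<lambda>y. of_real (mi_power y \<beta>) * (\<integral>s. Hj (s, y) \<partial>lborel)) \<in> borel_measurable borel"
    by measurable
  have m2: "(\<lambda>y. complex_of_real (mi_power y \<beta>)) \<in> borel_measurable lebesgue"
    by (intro measurable_completion) simp
  have "(LINT y|lebesgue. of_real (mi_power y \<beta>) * psi f u k y) = (LINT y|lebesgue. of_real (mi_power y \<beta>) * (\<integral>s. Hj (s, y) \<partial>lborel))"
    using psi_eq by (intro integral_cong_AE borel_measurable_times m2 pm measurable_completion)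
      (use m1 in \<open>auto elim!: eventually_mono\<close>)
  also have "\<dots> = (\<integral>y. of_real (mi_power y \<beta>) * (\<integral>s. Hj (s, y) \<partial>lborel) \<partial>lborel)"
    using m1 by (intro integral_completion) simp
  also have "\<dots> = (\<integral>y. (\<integral>s. of_real (s ^ k * mi_power y \<beta>) * U (s, y) \<partial>lborel) \<partial>lborel)"
    unfolding Hj_def by (intro Bochner_Integration.integral_cong refl) (simp add: mult_ac flip: integral_mult_right_zero)
  also have "\<dots> = (\<integral>z. of_real (fst z ^ k * mi_power (snd z) \<beta>) * U z \<partial>lborel)"
  proof -
    have "integrable (lborel \<Otimes>\<^sub>M lborel) (\<lambda>(s, y). of_real (s ^ k * mi_power y \<beta>) * U (s, y))"
      using integrable_moments(1)[OF k] by (simp add: lborel_prod case_prod_beta')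
    from lborel_pair.integral_snd[OF this] show ?thesis by (simp add: lborel_prod case_prod_beta')
  qed
  finally show ?thesis .
qed

end

text \<open>The pure powers of the coordinates suffice: |y| is at most n times its largest
  coordinate, so |y|^m is at most n^m times the sum of the m-th powers of all coordinates in
  absolute value.\<close>

lemma L1_weighted_moment_finite:
  fixes \<phi> :: "real ^ 'n \<Rightarrow> complex"
  assumes "\<phi> \<in> L1_weighted m"
  shows "(\<integral>\<^sup>+y. ennreal (norm y ^ m * cmod (\<phi> y)) \<partial>lebesgue) < \<infinity>"
proof -
  define \<alpha> where "\<alpha> j = (\<lambda>i :: 'n. if i = j then m else 0)" for j
  have \<alpha>: "mi_abs (\<alpha> j) \<le> m" "mi_power y (\<alpha> j) = (y $ j) ^ m" for j and y :: "real ^ 'n"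
  proof -
    show "mi_abs (\<alpha> j) \<le> m" by (simp add: mi_abs_def \<alpha>_def)
    have "mi_power y (\<alpha> j) = (\<Prod>i\<in>UNIV. if i = j then (y $ i) ^ m else 1)"
      unfolding mi_power_def \<alpha>_def by (intro prod.cong) auto
    then show "mi_power y (\<alpha> j) = (y $ j) ^ m" by simp
  qed
  have L: "(\<lambda>x. of_real (mi_power x (\<alpha> j)) * \<phi> x) \<in> Lq 1" for j
    using assms \<alpha>(1)[of j] by (simp add: L1_weighted_def)
  have fin: "(\<integral>\<^sup>+y. ennreal (\<bar>y $ j\<bar> ^ m * cmod (\<phi> y)) \<partial>lebesgue) < \<infinity>"
    and meas: "(\<lambda>y. ennreal (\<bar>y $ j\<bar> ^ m * cmod (\<phi> y))) \<in> borel_measurable lebesgue" for j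
  proof -
    have e: "ennreal (\<bar>y $ j\<bar> ^ m * cmod (\<phi> y)) = ennreal (cmod (of_real (mi_power y (\<alpha> j)) * \<phi> y))" for y
      by (simp add: \<alpha>(2) norm_mult norm_power)
    show "(\<integral>\<^sup>+y. ennreal (\<bar>y $ j\<bar> ^ m * cmod (\<phi> y)) \<partial>lebesgue) < \<infinity>"
      using L[of j] unfolding e by (simp add: normed_fun_space_def Lq_norm_1)
    show "(\<lambda>y. ennreal (\<bar>y $ j\<bar> ^ m * cmod (\<phi> y))) \<in> borel_measurable lebesgue"
      using L[of j] unfolding e normed_fun_space_def by auto
  qed
  have pw: "norm y ^ m \<le> real CARD('n) ^ m * (\<Sum>j\<in>UNIV. \<bar>y $ j\<bar> ^ m)" for y :: "real ^ 'n"
  proof -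
    obtain k where k: "\<And>j. \<bar>y $ j\<bar> \<le> \<bar>y $ k\<bar>"
    proof -
      have "Max (range (\<lambda>j. \<bar>y $ j\<bar>)) \<in> range (\<lambda>j. \<bar>y $ j\<bar>)" by (rule Max_in) auto
      then obtain k where "Max (range (\<lambda>j. \<bar>y $ j\<bar>)) = \<bar>y $ k\<bar>" by (rule rangeE)
      then have "\<bar>y $ j\<bar> \<le> \<bar>y $ k\<bar>" for j using Max_ge[of "range (\<lambda>j. \<bar>y $ j\<bar>)" "\<bar>y $ j\<bar>"] by simp
      then show ?thesis by (rule that)
    qed
    have "norm y \<le> (\<Sum>j\<in>UNIV. \<bar>y $ j\<bar>)" by (rule norm_le_l1_cart)
    also have "\<dots> \<le> (\<Sum>j\<in>(UNIV :: 'n set). \<bar>y $ k\<bar>)" by (intro sum_mono k)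
    finally have "norm y \<le> real CARD('n) * \<bar>y $ k\<bar>" by simp
    then have "norm y ^ m \<le> (real CARD('n) * \<bar>y $ k\<bar>) ^ m" by (intro power_mono) auto
    also have "\<dots> = real CARD('n) ^ m * \<bar>y $ k\<bar> ^ m" by (rule power_mult_distrib)
    also have "\<bar>y $ k\<bar> ^ m \<le> (\<Sum>j\<in>UNIV. \<bar>y $ j\<bar> ^ m)" by (rule member_le_sum) auto
    finally show ?thesis by simp
  qed
  have "(\<integral>\<^sup>+y. ennreal (norm y ^ m * cmod (\<phi> y)) \<partial>lebesgue) \<le>
      (\<integral>\<^sup>+y. ennreal (real CARD('n) ^ m) * (\<Sum>j\<in>UNIV. ennreal (\<bar>y $ j\<bar> ^ m * cmod (\<phi> y))) \<partial>lebesgue)"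
  proof (intro nn_integral_mono)
    fix y :: "real ^ 'n"
    have "norm y ^ m * cmod (\<phi> y) \<le> real CARD('n) ^ m * (\<Sum>j\<in>UNIV. \<bar>y $ j\<bar> ^ m) * cmod (\<phi> y)"
      by (intro mult_right_mono pw) auto
    also have "\<dots> = real CARD('n) ^ m * (\<Sum>j\<in>UNIV. \<bar>y $ j\<bar> ^ m * cmod (\<phi> y))"
      by (simp add: sum_distrib_right mult.assoc)
    finally have "ennreal (norm y ^ m * cmod (\<phi> y)) \<le> ennreal (real CARD('n) ^ m * (\<Sum>j\<in>UNIV. \<bar>y $ j\<bar> ^ m * cmod (\<phi> y)))"
      by (rule ennreal_leI)
    also have "\<dots> = ennreal (real CARD('n) ^ m) * (\<Sum>j\<in>UNIV. ennreal (\<bar>y $ j\<bar> ^ m * cmod (\<phi> y)))"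
      by (subst ennreal_mult) (auto intro!: sum_nonneg simp: sum_ennreal)
    finally show "ennreal (norm y ^ m * cmod (\<phi> y)) \<le>
        ennreal (real CARD('n) ^ m) * (\<Sum>j\<in>UNIV. ennreal (\<bar>y $ j\<bar> ^ m * cmod (\<phi> y)))" .
  qed
  also have "\<dots> = ennreal (real CARD('n) ^ m) * (\<Sum>j\<in>UNIV. \<integral>\<^sup>+y. ennreal (\<bar>y $ j\<bar> ^ m * cmod (\<phi> y)) \<partial>lebesgue)"
    by (subst nn_integral_cmult, intro borel_measurable_sum meas, subst nn_integral_sum, rule meas, rule refl)
  also have "\<dots> < \<infinity>" using fin by (simp add: ennreal_mult_less_top)
  finally show ?thesis .
qed

text \<open>A uniform bound c2, useful for small t, and a decay bound c1, useful for large t, merge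
  through (1 + t)^N \<le> 2^N max(1, t)^N \<le> 2^N (1 + t^N).\<close>

lemma decay_bound_combine:
  fixes t c1 c2 v N :: real
  assumes "0 < t" "0 \<le> N" "0 \<le> v" "t powr N * v \<le> c1" "v \<le> c2"
  shows "v \<le> 2 powr N * (c1 + c2) * (1 + t) powr (- N)"
proof -
  have "(1 + t) powr N \<le> (2 * max 1 t) powr N" using assms by (intro powr_mono2) auto
  also have "\<dots> = 2 powr N * max 1 t powr N" using assms by (intro powr_mult)
  also have "max 1 t powr N \<le> 1 + t powr N" using assms by (auto simp: max_def)
  finally have "(1 + t) powr N * v \<le> 2 powr N * (1 + t powr N) * v"
    using assms by (intro mult_right_mono) auto
  also have "\<dots> = 2 powr N * (v + t powr N * v)" by (simp add: algebra_simps)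
  also have "\<dots> \<le> 2 powr N * (c2 + c1)" using assms by (intro mult_left_mono add_mono) auto
  finally have "(1 + t) powr N * v * (1 + t) powr (- N) \<le> 2 powr N * (c2 + c1) * (1 + t) powr (- N)"
    by (intro mult_right_mono) auto
  moreover have "(1 + t) powr N * (1 + t) powr (- N) = 1" using assms by (simp add: powr_add[symmetric])
  then have "(1 + t) powr N * v * (1 + t) powr (- N) = v" by (simp only: mult_ac mult_1_right)
  ultimately show ?thesis by (simp add: add.commute)
qed

theorem theorem1p3:
  fixes \<nu> :: complex and p K :: real and f :: "complex \<Rightarrow> complex" and m :: nat
    and u0 :: "real ^ 'n \<Rightarrow> complex" and u :: "real \<Rightarrow> real ^ 'n \<Rightarrow> complex"
  assumes "Re \<nu> > 0"
    and "p > 1"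
    and "f 0 = 0"
    and "K > 0"
    and "\<And>\<xi> \<eta>. cmod (f \<xi> - f \<eta>)
             \<le> K * (cmod \<xi> powr (p - 1) + cmod \<eta> powr (p - 1)) * cmod (\<xi> - \<eta>)"
    and "p > 1 + (real m + 2) / real CARD('n)"
    and "u0 \<in> L1_weighted m \<inter> Lq \<infinity>"
    and "u \<in> solution_space"
    and "global_solution \<nu> f u0 u"
    and "(SUP q\<in>{1..}. SUP t\<in>{0<..}.
            ennreal (t powr (real CARD('n) / 2 * (1 - enn2real (1 / q)))) * Lq_norm q (u t)) < \<infinity>"
  shows "\<forall>q\<in>{1..}.
           ((\<lambda>t. ennreal (t powr (real CARD('n) / 2 * (1 - enn2real (1 / q)) + real m / 2))
                  * Lq_norm q (\<lambda>x. u t x - asymptotic_profile \<nu> f u0 u m t x)) \<longlongrightarrow> 0) at_top"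
proof -
  note \<nu> = assms(1) and p = assms(2) and f0 = assms(3) and K = assms(4) and lip = assms(5)
  have nz: "\<nu> \<noteq> 0" using \<nu> by auto
  define N where "N = real CARD('n) / 2"
  have N: "0 < N" by (simp add: N_def)
  define S where "S = (SUP q\<in>{1..}. SUP t\<in>{0<..}. ennreal (t powr (N * (1 - enn2real (1 / q)))) * Lq_norm q (u t))"
  have Sfin: "S < \<infinity>" using assms(10) by (simp add: S_def N_def)
  have S: "ennreal (t powr (N * (1 - enn2real (1 / q)))) * Lq_norm q (u t) \<le> S" if "1 \<le> q" "0 < t" for q t
  proof -
    define F where "F q t = ennreal (t powr (N * (1 - enn2real (1 / q)))) * Lq_norm q (u t)" for q t
    have "F q t \<le> (SUP t\<in>{0<..}. F q t)" using that by (intro SUP_upper) simp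
    also have "\<dots> \<le> (SUP q\<in>{1..}. SUP t\<in>{0<..}. F q t)"
      using that by (intro SUP_upper[of q _ "\<lambda>q. SUP t\<in>{0<..}. F q t"]) simp
    finally show ?thesis unfolding S_def F_def .
  qed
  have uL1: "u t \<in> Lq 1" if "0 \<le> t" for t
    using assms(8) that by (simp add: solution_space_def C_Linf_def)
  have umeas: "u t \<in> borel_measurable lebesgue" if "0 < t" for t
    using uL1[of t] that by (simp add: normed_fun_space_def)
  have ucont: "((\<lambda>r. Lq_norm 1 (\<lambda>x. u r x - u s x)) \<longlongrightarrow> 0) (at s)" if s: "0 < s" for s
  proof -
    have "((\<lambda>r. Lq_norm 1 (\<lambda>x. u r x - u s x)) \<longlongrightarrow> 0) (at s within {0..})"
      using assms(8) s unfolding solution_space_def C_Linf_def by fastforce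
    moreover have "at s within {0..} = at s" using s by (intro at_within_interior) simp
    ultimately show ?thesis by (simp only:)
  qed
  \<comment> \<open>The decay hypothesis tolerates a blow-up like t^{-n/2} in L^\<infinity> as t
    tends to 0. Membership in X excludes it, and the two bounds together give the factor (1 +
    t)^{-n/2}.\<close>
  have "u \<in> C_Linf {0<..} \<infinity>" using assms(8) by (simp add: solution_space_def)
  then obtain E where E: "E < \<infinity>" "\<And>t. 0 < t \<Longrightarrow> Lq_norm \<infinity> (u t) \<le> E"
    using C_Linf_pointwise_bound by blast
  define c1 c2 where "c1 = enn2real S" and "c2 = enn2real E"
  have c1: "S = ennreal c1" "0 \<le> c1" and c2: "E = ennreal c2" "0 \<le> c2"
    using Sfin E(1) by (simp_all add: c1_def c2_def ennreal_enn2real)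
  define M where "M = 2 powr N * (c1 + c2)"
  have M: "0 \<le> M" using c1 c2 by (simp add: M_def)
  have c1M: "c1 \<le> M"
  proof -
    have "1 * (c1 + c2) \<le> M" unfolding M_def using c1 c2 N by (intro mult_right_mono) (auto simp: ge_one_powr_ge_zero)
    then show ?thesis using c2 by simp
  qed
  have uN1: "Lq_norm 1 (u t) \<le> ennreal M" if "0 < t" for t
  proof -
    have "Lq_norm 1 (u t) \<le> ennreal c1" using S[of 1 t] that by (simp add: c1(1))
    also have "\<dots> \<le> ennreal M" using c1M by (rule ennreal_leI)
    finally show ?thesis .
  qed
  have uNinf: "AE x in lebesgue. cmod (u t x) \<le> M * (1 + t) powr (- N)" if t: "0 < t" for t
    using AE_le_Lq_norm_infinity[of "u t"]
  proof (rule eventually_mono)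
    fix x assume le: "ennreal (cmod (u t x)) \<le> Lq_norm \<infinity> (u t)"
    have "ennreal (cmod (u t x)) \<le> ennreal c2" using le E(2)[OF t] c2(1) by simp
    then have 2: "cmod (u t x) \<le> c2" using c2(2) by simp
    have "ennreal (t powr N * cmod (u t x)) \<le> ennreal (t powr N) * Lq_norm \<infinity> (u t)"
      using le by (simp add: ennreal_mult mult_left_mono)
    also have "\<dots> \<le> ennreal c1" using S[of \<infinity> t] t by (simp add: c1(1))
    finally have 1: "t powr N * cmod (u t x) \<le> c1" using c1(2) by simp
    show "cmod (u t x) \<le> M * (1 + t) powr (- N)"
      unfolding M_def using decay_bound_combine[OF t _ _ 1 2] N by simp
  qed
  obtain V0 where V0[measurable]: "V0 \<in> borel_measurable borel" and V0_eq: "\<And>s. 0 < s \<Longrightarrow> AE x in lebesgue. V0 (s, x) = u s x"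
  proof (rule L1_continuous_borel_representative[OF uL1[OF less_imp_le] ucont])
    fix V assume "V \<in> borel_measurable borel" "\<And>s. 0 < s \<Longrightarrow> AE x in lebesgue. V (s, x) = u s x"
    then show thesis by (rule that)
  qed
  \<comment> \<open>Values violating the bound are set to 0. For each s > 0 this changes V0 only on
    a null set in x, and the bound now holds at every point. The value 0 for s \<le> 0 makes U
    vanish there, since f 0 = 0.\<close>
  define V where "V z = (if 0 < fst z \<and> cmod (V0 z) \<le> M * (1 + fst z) powr (- N) then V0 z else 0)" for z
  have V[measurable]: "V \<in> borel_measurable borel" unfolding V_def by measurable
  have V_eq: "AE x in lebesgue. V (s, x) = u s x" if s: "0 < s" for s
    using V0_eq[OF s] uNinf[OF s] by eventually_elim (simp add: V_def s)
  have V_bound: "cmod (V (s, y)) \<le> M * (1 + s) powr (- N)" if "0 < s" for s y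
    using that M by (auto simp: V_def)
  have fcont: "continuous_on UNIV f" using p K lip by (rule continuous_on_of_power_lipschitz)
  then have f[measurable]: "f \<in> borel_measurable borel" by (rule borel_measurable_continuous_onI)
  define U where "U z = f (V z)" for z
  have U[measurable]: "U \<in> borel_measurable borel" unfolding U_def by measurable
  have fmeas: "(\<lambda>x. f (u s x)) \<in> borel_measurable lebesgue" if "0 < s" for s
    using umeas[OF that] by measurable
  have U_eq: "AE x in lebesgue. f (u s x) = U (s, x)" if "0 < s" for s
    using V_eq[OF that] by eventually_elim (simp add: U_def)
  \<comment> \<open>Since |f(v)| \<le> K |v|^{p-1} |v|, the bound M (1 + s)^{-N} on \<open>V\<close>
    turns the factor K |v|^{p-1} into h (1 + s)^{-a}.\<close>
  define a h where "a = N * (p - 1)" and "h = K * M powr (p - 1)"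
  have a: "1 + real m / 2 < a"
  proof -
    have "(real m + 2) / real CARD('n) < p - 1" using assms(6) by simp
    then have "N * ((real m + 2) / real CARD('n)) < a" unfolding a_def using N by (intro mult_strict_left_mono)
    moreover have "N * ((real m + 2) / real CARD('n)) = 1 + real m / 2" by (simp add: N_def field_simps)
    ultimately show ?thesis by simp
  qed
  have h: "0 \<le> h" using K by (simp add: h_def)
  have fV: "cmod (f v) \<le> K * cmod v powr (p - 1) * cmod v" for v using lip[of v 0] by (simp add: f0)
  have U_V: "cmod (U (s, y)) \<le> h * (1 + s) powr (- a) * cmod (V (s, y))" if s: "0 < s" for s y
  proof -
    have "cmod (V (s, y)) powr (p - 1) \<le> (M * (1 + s) powr (- N)) powr (p - 1)"
      using V_bound[OF s] p by (intro powr_mono2) auto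
    also have "\<dots> = M powr (p - 1) * (1 + s) powr (- a)"
      using M by (simp add: powr_mult powr_powr a_def)
    finally have "K * cmod (V (s, y)) powr (p - 1) * cmod (V (s, y)) \<le> h * (1 + s) powr (- a) * cmod (V (s, y))"
      unfolding h_def mult.assoc using K by (intro mult_left_mono) (auto simp: mult.assoc[symmetric] intro!: mult_right_mono)
    with fV[of "V (s, y)"] show ?thesis by (simp add: U_def)
  qed
  have fcontL1: "((\<lambda>r. Lq_norm 1 (\<lambda>x. f (u r x) - f (u s x))) \<longlongrightarrow> 0) (at s)" if s: "0 < s" for s
  proof -
    \<comment> \<open>A Lipschitz constant of f on the disc of radius M, which contains the values
      of u(t) up to null sets for every t > 0.\<close>
    define c where "c = K * (M powr (p - 1) + M powr (p - 1))"
    have c: "0 \<le> c" using K by (simp add: c_def)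
    have le: "Lq_norm 1 (\<lambda>x. f (u r x) - f (u s x)) \<le> ennreal c * Lq_norm 1 (\<lambda>x. u r x - u s x)" if r: "0 < r" for r
    proof -
      have "Lq_norm 1 (\<lambda>x. f (u r x) - f (u s x)) \<le> (\<integral>\<^sup>+x. ennreal c * ennreal (cmod (u r x - u s x)) \<partial>lebesgue)"
        unfolding Lq_norm_1
      proof (rule nn_integral_mono_AE)
        show "AE x in lebesgue. ennreal (cmod (f (u r x) - f (u s x))) \<le> ennreal c * ennreal (cmod (u r x - u s x))"
          using uNinf[OF r] uNinf[OF s]
        proof eventually_elim
          fix x assume 1: "cmod (u r x) \<le> M * (1 + r) powr (- N)" and 2: "cmod (u s x) \<le> M * (1 + s) powr (- N)"
          have le1: "M * (1 + w) powr (- N) \<le> M" if "0 < w" for w :: real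
            using that M N powr_mono[of "- N" 0 "1 + w"] by (intro mult_left_le) auto
          have "cmod (f (u r x) - f (u s x)) \<le> K * (cmod (u r x) powr (p - 1) + cmod (u s x) powr (p - 1)) * cmod (u r x - u s x)"
            by (rule lip)
          also have "\<dots> \<le> c * cmod (u r x - u s x)"
            unfolding c_def using K p order_trans[OF 1 le1[OF r]] order_trans[OF 2 le1[OF s]]
            by (intro mult_right_mono mult_left_mono add_mono powr_mono2) auto
          finally show "ennreal (cmod (f (u r x) - f (u s x))) \<le> ennreal c * ennreal (cmod (u r x - u s x))"
            using c by (simp add: ennreal_mult[symmetric] ennreal_leI)
        qed
      qed
      also have "\<dots> = ennreal c * Lq_norm 1 (\<lambda>x. u r x - u s x)"
        unfolding Lq_norm_1 using umeas[OF r] umeas[OF s] by (intro nn_integral_cmult) auto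
      finally show ?thesis .
    qed
    have lim: "((\<lambda>r. ennreal c * Lq_norm 1 (\<lambda>x. u r x - u s x)) \<longlongrightarrow> 0) (at s)"
      using ennreal_tendsto_cmult[OF _ ucont[OF s], of "ennreal c"] by simp
    have "\<forall>\<^sub>F r in at s. r \<in> {0<..}" using s by (intro eventually_at_in_open') auto
    then have "\<forall>\<^sub>F r in at s. Lq_norm 1 (\<lambda>x. f (u r x) - f (u s x)) \<le> ennreal c * Lq_norm 1 (\<lambda>x. u r x - u s x)"
      by (rule eventually_mono) (use le in auto)
    then show ?thesis by (rule tendsto_sandwich[OF _ _ tendsto_const lim, rotated]) auto
  qed
  have u0W: "u0 \<in> L1_weighted m" using assms(7) by simp
  then have u0L1: "u0 \<in> Lq 1" by (simp add: L1_weighted_def)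
  then have u0m: "u0 \<in> borel_measurable lebesgue" by (simp add: normed_fun_space_def)
  obtain v0 where v0[measurable]: "v0 \<in> borel_measurable borel" and v0_eq: "AE x in lebesgue. v0 x = u0 x"
    by (rule complex_borel_representative[OF u0m])
  have D: "duhamel_data \<nu> m v0 V U a h M"
  proof (rule duhamel_data.intro)
    show "0 < Re \<nu>" by (rule \<nu>)
    show "0 \<le> h" by (rule h)
    show "0 \<le> M" by (rule M)
    show "1 + real m / 2 < a" by (rule a)
    show "v0 \<in> borel_measurable borel" by (rule v0)
    show "V \<in> borel_measurable borel" by (rule V)
    show "U \<in> borel_measurable borel" by (rule U)
  next
    have "(\<integral>\<^sup>+y. ennreal (cmod (v0 y)) \<partial>lborel) = (\<integral>\<^sup>+y. ennreal (cmod (v0 y)) \<partial>lebesgue)"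
      by (rule nn_integral_completion[symmetric])
    also have "\<dots> = Lq_norm 1 u0"
      unfolding Lq_norm_1 using v0_eq by (intro nn_integral_cong_AE) (auto elim!: eventually_mono)
    finally show "(\<integral>\<^sup>+y. ennreal (cmod (v0 y)) \<partial>lborel) < \<infinity>"
      using u0L1 by (simp add: normed_fun_space_def)
    have "(\<integral>\<^sup>+y. ennreal (norm y ^ m * cmod (v0 y)) \<partial>lborel) = (\<integral>\<^sup>+y. ennreal (norm y ^ m * cmod (v0 y)) \<partial>lebesgue)"
      by (rule nn_integral_completion[symmetric])
    also have "\<dots> = (\<integral>\<^sup>+y. ennreal (norm y ^ m * cmod (u0 y)) \<partial>lebesgue)"
      using v0_eq by (intro nn_integral_cong_AE) (auto elim!: eventually_mono)
    finally show "(\<integral>\<^sup>+y. ennreal (norm y ^ m * cmod (v0 y)) \<partial>lborel) < \<infinity>"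
      using L1_weighted_moment_finite[OF u0W] by simp
  next
    fix s :: real assume s: "0 < s"
    have "(\<integral>\<^sup>+y. ennreal (cmod (V (s, y))) \<partial>lborel) = (\<integral>\<^sup>+y. ennreal (cmod (V (s, y))) \<partial>lebesgue)"
      by (rule nn_integral_completion[symmetric])
    also have "\<dots> = Lq_norm 1 (u s)"
      unfolding Lq_norm_1 using V_eq[OF s] by (intro nn_integral_cong_AE) (auto elim!: eventually_mono)
    finally show "(\<integral>\<^sup>+y. ennreal (cmod (V (s, y))) \<partial>lborel) \<le> ennreal M" using uN1[OF s] by simp
  next
    fix s :: real and y :: "real ^ 'n" assume s: "0 < s"
    show "cmod (V (s, y)) \<le> M * (1 + s) powr (- real CARD('n) / 2)" using V_bound[OF s, of y] by (simp add: N_def)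
  next
    fix s :: real and y :: "real ^ 'n" assume "s \<le> 0"
    then show "U (s, y) = 0" by (simp add: U_def V_def f0)
  next
    fix t :: real assume t: "0 < t"
    from assms(9) t obtain w where
      B: "has_fun_bochner_integral L1_Linf_norm (lebesgue_on {0..t}) (\<lambda>s. heat_semigroup \<nu> (t - s) (\<lambda>x. f (u s x))) w"
      and uw: "AE x in lebesgue. u t x = heat_semigroup \<nu> t u0 x + w x"
      unfolding global_solution_def by blast
    have hs: "heat_semigroup \<nu> t u0 x = (\<integral>y. heat_kernel \<nu> t (x - y) * v0 y \<partial>lborel)" for x
      using v0_eq by (intro heat_semigroup_eq[OF nz t u0m v0]) (auto elim!: eventually_mono)
    have DB: "AE x in lborel.
       integrable lborel (\<lambda>s. indicator {0<..<t} s *\<^sub>R (\<integral>y. heat_kernel \<nu> (t - s) (x - y) * U (s, y) \<partial>lborel)) \<and>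
       w x = (\<integral>s. indicator {0<..<t} s *\<^sub>R (\<integral>y. heat_kernel \<nu> (t - s) (x - y) * U (s, y) \<partial>lborel) \<partial>lborel)"
      by (rule duhamel_bochner_integral[where f = f and u = u, OF nz t B U fmeas U_eq])
    have "AE x in lborel. V (t, x) = u t x" using V_eq[OF t] by (simp add: AE_completion_iff)
    moreover have "AE x in lborel. u t x = heat_semigroup \<nu> t u0 x + w x" using uw by (simp add: AE_completion_iff)
    ultimately show "AE x in lborel.
       integrable lborel (\<lambda>s. indicator {0<..<t} s *\<^sub>R (\<integral>y. heat_kernel \<nu> (t - s) (x - y) * U (s, y) \<partial>lborel)) \<and>
       V (t, x) = (\<integral>y. heat_kernel \<nu> t (x - y) * v0 y \<partial>lborel) +
         (\<integral>s. indicator {0<..<t} s *\<^sub>R (\<integral>y. heat_kernel \<nu> (t - s) (x - y) * U (s, y) \<partial>lborel) \<partial>lborel)"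
      using DB by eventually_elim (simp add: hs)
  next
    fix s :: real and y :: "real ^ 'n" assume "0 < s"
    then show "cmod (U (s, y)) \<le> h * (1 + s) powr (- a) * cmod (V (s, y))" by (rule U_V)
  qed
  interpret D: duhamel_data \<nu> m v0 V U a h M by (rule D)
  obtain e where e: "(e \<longlongrightarrow> 0) at_top"
    and e1: "\<And>t. 0 < t \<Longrightarrow> (\<integral>\<^sup>+x. ennreal (cmod (V (t, x) - D.approx t x)) \<partial>lborel) \<le> ennreal (t powr (- real m / 2)) * e t"
    and e2: "\<And>t. 0 < t \<Longrightarrow> AE x in lborel. ennreal (cmod (V (t, x) - D.approx t x)) \<le> ennreal (t powr (- real m / 2 - real CARD('n) / 2)) * e t"
    using D.asymptotics by blast
  have v0_mom: "(LINT y|lebesgue. of_real (mi_power y \<beta>) * u0 y) = (\<integral>y. of_real (mi_power y \<beta>) * v0 y \<partial>lborel)" for \<beta>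
  proof -
    have m1: "(\<lambda>y. of_real (mi_power y \<beta>) * v0 y) \<in> borel_measurable lborel" by measurable
    have m2: "(\<lambda>y. complex_of_real (mi_power y \<beta>)) \<in> borel_measurable lebesgue"
      by (intro measurable_completion) simp
    have "(LINT y|lebesgue. of_real (mi_power y \<beta>) * u0 y) = (LINT y|lebesgue. of_real (mi_power y \<beta>) * v0 y)"
      using v0_eq by (intro integral_cong_AE borel_measurable_times m2 u0m measurable_completion)
        (auto elim!: eventually_mono)
    also have "\<dots> = (\<integral>y. of_real (mi_power y \<beta>) * v0 y \<partial>lborel)" using m1 by (rule integral_completion)
    finally show ?thesis .
  qed
  \<comment> \<open>With the moments supplied by \<open>psi_moment\<close> and
    \<open>v0_mom\<close>, the profile and the approximation agree at every point, not just almost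
    everywhere.\<close>
  have profile: "asymptotic_profile \<nu> f u0 u m t x = D.approx t x" if t: "0 < t" for t x
    unfolding asymptotic_profile_def
    by (rule D.approx_eq[OF t D.psi_moment[where f = f and u = u, OF _ fmeas U_eq fcontL1] v0_mom, symmetric])
  show ?thesis
  proof
    fix q :: ennreal assume q: "q \<in> {1..}"
    have le: "ennreal (t powr (N * (1 - enn2real (1 / q)) + real m / 2)) *
        Lq_norm q (\<lambda>x. u t x - asymptotic_profile \<nu> f u0 u m t x) \<le> e t" if t: "0 < t" for t
    proof (rule Lq_norm_interpolation[OF t])
      have [measurable]: "(\<lambda>x. D.approx t x) \<in> borel_measurable borel"
        unfolding D.approx_def by measurable
      have "(\<lambda>x. D.approx t x) \<in> borel_measurable lebesgue" by (intro measurable_completion) simp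
      then show "(\<lambda>x. u t x - asymptotic_profile \<nu> f u0 u m t x) \<in> borel_measurable lebesgue"
        unfolding profile[OF t] using umeas[OF t] by (intro borel_measurable_diff)
      have "Lq_norm 1 (\<lambda>x. u t x - asymptotic_profile \<nu> f u0 u m t x) = (\<integral>\<^sup>+x. ennreal (cmod (V (t, x) - D.approx t x)) \<partial>lebesgue)"
        unfolding Lq_norm_1 profile[OF t] using V_eq[OF t]
        by (intro nn_integral_cong_AE) (auto elim!: eventually_mono)
      also have "\<dots> = (\<integral>\<^sup>+x. ennreal (cmod (V (t, x) - D.approx t x)) \<partial>lborel)" by (rule nn_integral_completion)
      finally show "Lq_norm 1 (\<lambda>x. u t x - asymptotic_profile \<nu> f u0 u m t x) \<le> ennreal (t powr (- (real m / 2))) * e t"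
        using e1[OF t] by simp
      have "AE x in lebesgue. ennreal (cmod (V (t, x) - D.approx t x)) \<le> ennreal (t powr (- real m / 2 - real CARD('n) / 2)) * e t"
        using e2[OF t] by (rule AE_completion)
      then show "AE x in lebesgue. ennreal (cmod (u t x - asymptotic_profile \<nu> f u0 u m t x)) \<le> ennreal (t powr (- (real m / 2) - N)) * e t"
        using V_eq[OF t] by eventually_elim (simp add: profile[OF t] N_def)
    qed (use q in auto)
    have "\<forall>\<^sub>F t in at_top. ennreal (t powr (N * (1 - enn2real (1 / q)) + real m / 2)) *
        Lq_norm q (\<lambda>x. u t x - asymptotic_profile \<nu> f u0 u m t x) \<le> e t"
      using eventually_gt_at_top[of 0] by (rule eventually_mono) (rule le)
    then show "((\<lambda>t. ennreal (t powr (real CARD('n) / 2 * (1 - enn2real (1 / q)) + real m / 2))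
                  * Lq_norm q (\<lambda>x. u t x - asymptotic_profile \<nu> f u0 u m t x)) \<longlongrightarrow> 0) at_top"
      unfolding N_def by (rule tendsto_sandwich[OF _ _ tendsto_const e, rotated]) auto
  qed
qed

end
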